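(* Let $\mathcal H$ be a real separable Hilbert space and let $B:[a,b]\to\mathrm B_{\mathrm{sym}}(\mathcal H)$, $t\mapsto B_t$, be a continuous path of symmetric Fredholm forms on $\mathcal H$. Let $\mathcal V$ be a finite codimensional closed subspace of $\mathcal H$, and denote by $T:[a,b]\to\mathcal F_{\mathrm{sa}}(\mathcal H)$ and $\widetilde T:[a,b]\to\mathcal F_{\mathrm{sa}}(\mathcal V)$ the continuous paths of self-adjoint Fredholm operators associated with $B$ and with the restriction $B|_{\mathcal V\times\mathcal V}$, respectively (so $\widetilde T_t=P_{\mathcal V}\circ T_t|_{\mathcal V}$). Assume that $T_t=\mathfrak J+K_t$ for all $t\in[a,b]$, where $\mathfrak J$ is a symmetry of $\mathcal H$ and $K_t$ is compact for all $t$. Then $$\mathfrak{sf}(T,[a,b])-\mathfrak{sf}(\widetilde T,[a,b])=\dim\big(V^-(T_a),V^-(\widetilde T_a)\big)-\dim\big(V^-(T_b),V^-(\widetilde T_b)\big)$$ $$=\mathrm n_-\big(B_a|_{\mathcal V^{\perp_{B_a}}\times\mathcal V^{\perp_{B_a}}}\big)+\dim\big(\mathcal V\cap\mathcal V^{\perp_{B_a}}\big)-\dim\big(\mathcal V\cap\mathrm{Ker}\,B_a\big)$$ $$\quad-\mathrm n_-\big(B_b|_{\mathcal V^{\perp_{B_b}}\times\mathcal V^{\perp_{B_b}}}\big)-\dim\big(\mathcal V\cap\mathcal V^{\perp_{B_b}}\big)+\dim\big(\mathcal V\cap\mathrm{Ker}\,B_b\big).$$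
   Context: $P_{\mathcal V}$ is the orthogonal projection onto a closed subspace $\mathcal V$. A continuous symmetric bilinear form $B$ on a Hilbert space $\mathcal H$ has an associated self-adjoint operator $T$, defined by $B(x,y)=\langle Tx,y\rangle$; $B$ is a symmetric Fredholm form if $T$ is Fredholm. $\mathrm B_{\mathrm{sym}}(\mathcal H)$ is the set of symmetric Fredholm forms on $\mathcal H$ and $\mathcal F_{\mathrm{sa}}(\mathcal H)$ is the set of bounded self-adjoint Fredholm operators on $\mathcal H$ (norm topology). $\mathrm{Ker}\,B=\{x: B(x,y)=0\ \forall y\}=\mathrm{Ker}\,T$. The Morse index $\mathrm n_-(B)$ is the supremum of the dimensions of subspaces on which $B$ is negative definite. The $B$-orthogonal complement of $\mathcal V$ is $\mathcal V^{\perp_B}=\{x\in\mathcal H: B(x,y)=0\ \forall y\in\mathcal V\}$. For $T\in\mathcal F_{\mathrm{sa}}(\mathcal H)$ there is a unique orthogonal splitting $\mathcal H=V^-(T)\oplus V^+(T)\oplus\mathrm{Ker}\,T$ into closed subspaces with $V^\pm(T)$ $T$-invariant and $\langle T\cdot,\cdot\rangle$ negative definite on $V^-(T)$ and positive definite on $V^+(T)$; this defines $V^\pm(T)$. $V^-(\widetilde T_t)\subseteq\mathcal V$ is regarded as a subspace of $\mathcal H$. Two closed subspaces $\mathcal X,\mathcal Y$ of $\mathcal H$ are commensurable if $P_{\mathcal X}-P_{\mathcal Y}$ is compact; their relative dimension is then the integer $\dim(\mathcal X,\mathcal Y)=\dim(\mathcal X\cap\mathcal Y^\perp)-\dim(\mathcal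 Y\cap\mathcal X^\perp)$. A symmetry of $\mathcal H$ is a bounded self-adjoint operator $\mathfrak J$ with $\mathfrak J^2=I$. Spectral flow of a continuous path $T:[a,b]\to\mathcal F_{\mathrm{sa}}(\mathcal H)$: choose a partition $a=t_0<\dots<t_N=b$ and $a_1,\dots,a_N>0$ such that on $[t_{i-1},t_i]$ the map $t\mapsto\chi_{[-a_i,a_i]}(T_t)$ (functional calculus) is continuous with values in finite rank projections; then $\mathfrak{sf}(T,[a,b])=\sum_{i=1}^N\big[\mathrm{rk}\,\chi_{[0,a_i]}(T_{t_i})-\mathrm{rk}\,\chi_{[0,a_i]}(T_{t_{i-1}})\big]$. For a path of the form $T_t=\mathfrak J+K_t$, with $\mathfrak J$ a fixed symmetry and $K_t$ compact self-adjoint, one has $\mathfrak{sf}(T,[a,b])=\dim\big(V^-(T_a),V^-(T_b)\big)$. *)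

theory Defs
  imports "HOL-Analysis.Analysis" "HOL-Library.Extended_Nat"
begin

section \<open>Dimension\<close>

definition finite_dimensional :: "'a::real_vector set \<Rightarrow> bool" where
  "finite_dimensional X \<longleftrightarrow> (\<exists>F. finite F \<and> X \<subseteq> span F)"

definition finite_codimensional :: "'a::real_vector set \<Rightarrow> bool" where
  "finite_codimensional X \<longleftrightarrow> (\<exists>F. finite F \<and> span (X \<union> F) = UNIV)"

text \<open>The library's \<^const>\<open>dim\<close> is \<open>0\<close> on infinite-dimensional spaces; \<open>edim\<close> is \<open>\<infinity>\<close> there.\<close>

definition edim :: "'a::real_vector set \<Rightarrow> enat" where
  "edim X = (if finite_dimensional X then enat (dim X) else \<infinity>)"


section \<open>Operators on a closed subspace\<close>

text \<open>
  A bounded operator on a closed subspace \<open>W\<close> is encoded as the bounded operator on the ambient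
  space that agrees with it on \<open>W\<close> and vanishes on the orthogonal complement of \<open>W\<close>. This
  encoding is linear, multiplicative and isometric, so norm continuity of paths of operators on
  \<open>W\<close> is norm continuity in the ambient operator space. For \<open>W = UNIV\<close> there is no restriction.
\<close>

definition operator_on :: "'a::real_inner set \<Rightarrow> ('a \<Rightarrow>\<^sub>L 'a) \<Rightarrow> bool" where
  "operator_on W A \<longleftrightarrow> (\<forall>x\<in>W. A x \<in> W) \<and> (\<forall>x\<in>W\<^sup>\<bottom>. A x = 0)"

definition self_adjoint :: "('a::real_inner \<Rightarrow>\<^sub>L 'a) \<Rightarrow> bool" where
  "self_adjoint A \<longleftrightarrow> (\<forall>x y. A x \<bullet> y = x \<bullet> A y)"

definition compact_operator :: "('a::real_normed_vector \<Rightarrow>\<^sub>L 'a) \<Rightarrow> bool" where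
  "compact_operator A \<longleftrightarrow> compact (closure (A ` cball 0 1))"

definition fredholm :: "('a::real_normed_vector \<Rightarrow>\<^sub>L 'a) \<Rightarrow> bool" where
  "fredholm A \<longleftrightarrow> finite_dimensional {x. A x = 0} \<and> closed (range A) \<and>
     finite_codimensional (range A)"

definition is_symmetry :: "('a::real_inner \<Rightarrow>\<^sub>L 'a) \<Rightarrow> bool" where
  "is_symmetry J \<longleftrightarrow> self_adjoint J \<and> J o\<^sub>L J = id_blinfun"

definition orth_proj :: "'a::real_inner set \<Rightarrow> 'a \<Rightarrow>\<^sub>L 'a" where
  "orth_proj W = (THE P :: 'a \<Rightarrow>\<^sub>L 'a. \<forall>x. P x \<in> W \<and> x - P x \<in> W\<^sup>\<bottom>)"


section \<open>Commensurable subspaces and relative dimension\<close>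

definition commensurable :: "'a::real_inner set \<Rightarrow> 'a set \<Rightarrow> bool" where
  "commensurable X Y \<longleftrightarrow> subspace X \<and> closed X \<and> subspace Y \<and> closed Y \<and>
     compact_operator (orth_proj X - orth_proj Y)"

definition rel_dim :: "'a::real_inner set \<Rightarrow> 'a set \<Rightarrow> int" where
  "rel_dim X Y = int (dim (X \<inter> Y\<^sup>\<bottom>)) - int (dim (Y \<inter> X\<^sup>\<bottom>))"


section \<open>Symmetric bilinear forms\<close>

text \<open>Continuous bilinear forms, with their norm topology, are elements of
  \<open>'a \<Rightarrow>\<^sub>L 'a \<Rightarrow>\<^sub>L real\<close>.\<close>

definition symmetric_form :: "('a::real_inner \<Rightarrow>\<^sub>L 'a \<Rightarrow>\<^sub>L real) \<Rightarrow> bool" where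
  "symmetric_form B \<longleftrightarrow> (\<forall>x y. B x y = B y x)"

text \<open>The operator on \<open>W\<close> associated with the restriction of \<open>B\<close> to \<open>W \<times> W\<close>.\<close>

definition form_operator ::
    "'a::real_inner set \<Rightarrow> ('a \<Rightarrow>\<^sub>L 'a \<Rightarrow>\<^sub>L real) \<Rightarrow> 'a \<Rightarrow>\<^sub>L 'a" where
  "form_operator W B = (THE A :: 'a \<Rightarrow>\<^sub>L 'a. operator_on W A \<and> (\<forall>x\<in>W. \<forall>y\<in>W. B x y = A x \<bullet> y))"

definition symmetric_fredholm_form :: "('a::real_inner \<Rightarrow>\<^sub>L 'a \<Rightarrow>\<^sub>L real) \<Rightarrow> bool" where
  "symmetric_fredholm_form B \<longleftrightarrow> symmetric_form B \<and> fredholm (form_operator UNIV B)"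

definition form_kernel :: "('a::real_inner \<Rightarrow>\<^sub>L 'a \<Rightarrow>\<^sub>L real) \<Rightarrow> 'a set" where
  "form_kernel B = {x. \<forall>y. B x y = 0}"

definition form_orth :: "('a::real_inner \<Rightarrow>\<^sub>L 'a \<Rightarrow>\<^sub>L real) \<Rightarrow> 'a set \<Rightarrow> 'a set" where
  "form_orth B V = {x. \<forall>y\<in>V. B x y = 0}"

text \<open>Morse index of the restriction of \<open>B\<close> to \<open>X \<times> X\<close>.\<close>

definition morse_index :: "'a::real_inner set \<Rightarrow> ('a \<Rightarrow>\<^sub>L 'a \<Rightarrow>\<^sub>L real) \<Rightarrow> enat" where
  "morse_index X B =
     (SUP L \<in> {L. subspace L \<and> L \<subseteq> X \<and> (\<forall>x\<in>L. x \<noteq> 0 \<longrightarrow> B x x < 0)}. edim L)"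


section \<open>Positive and negative spaces of a self-adjoint operator\<close>

text \<open>\<open>W = M \<oplus> P \<oplus> Ker A\<close>, where \<open>A\<close> is an operator on \<open>W\<close> and \<open>Ker A\<close> is its kernel in \<open>W\<close>.\<close>

definition sign_splitting ::
    "'a::real_inner set \<Rightarrow> ('a \<Rightarrow>\<^sub>L 'a) \<Rightarrow> 'a set \<Rightarrow> 'a set \<Rightarrow> bool" where
  "sign_splitting W A M P \<longleftrightarrow>
     (let N = {x\<in>W. A x = 0} in
       subspace M \<and> closed M \<and> subspace P \<and> closed P \<and>
       M \<subseteq> P\<^sup>\<bottom> \<and> M \<subseteq> N\<^sup>\<bottom> \<and> P \<subseteq> N\<^sup>\<bottom> \<and>
       W = {m + p + k | m p k. m \<in> M \<and> p \<in> P \<and> k \<in> N} \<and>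
       A ` M \<subseteq> M \<and> A ` P \<subseteq> P \<and>
       (\<forall>x\<in>M. x \<noteq> 0 \<longrightarrow> A x \<bullet> x < 0) \<and> (\<forall>x\<in>P. x \<noteq> 0 \<longrightarrow> A x \<bullet> x > 0))"

definition neg_space :: "'a::real_inner set \<Rightarrow> ('a \<Rightarrow>\<^sub>L 'a) \<Rightarrow> 'a set" where
  "neg_space W A = (THE M. \<exists>P. sign_splitting W A M P)"


section \<open>Spectral projections and spectral flow\<close>

definition projection_valued_measure ::
    "'a::real_inner set \<Rightarrow> (real set \<Rightarrow> 'a \<Rightarrow>\<^sub>L 'a) \<Rightarrow> bool" where
  "projection_valued_measure W E \<longleftrightarrow>
     E UNIV = orth_proj W \<and>
     (\<forall>S\<in>sets borel. self_adjoint (E S)) \<and>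
     (\<forall>S\<in>sets borel. \<forall>S'\<in>sets borel. E (S \<inter> S') = E S o\<^sub>L E S') \<and>
     (\<forall>S::nat \<Rightarrow> real set. range S \<subseteq> sets borel \<longrightarrow> disjoint_family S \<longrightarrow>
        (\<forall>x. (\<lambda>n. E (S n) x) sums E (\<Union>n. S n) x))"

definition scalar_spectral_measure ::
    "(real set \<Rightarrow> 'a::real_inner \<Rightarrow>\<^sub>L 'a) \<Rightarrow> 'a \<Rightarrow> real measure" where
  "scalar_spectral_measure E x = measure_of UNIV (sets borel) (\<lambda>S. ennreal (E S x \<bullet> x))"

text \<open>\<open>A = \<integral> s dE(s)\<close> weakly. Since \<open>A\<close> is self-adjoint, the quadratic forms suffice, and they
  are integrals against positive measures.\<close>

definition spectral_measure ::
    "'a::real_inner set \<Rightarrow> ('a \<Rightarrow>\<^sub>L 'a) \<Rightarrow> (real set \<Rightarrow> 'a \<Rightarrow>\<^sub>L 'a) \<Rightarrow> bool" where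
  "spectral_measure W A E \<longleftrightarrow> self_adjoint A \<and> projection_valued_measure W E \<and>
     (\<forall>x\<in>W. has_bochner_integral (scalar_spectral_measure E x) (\<lambda>s. s) (A x \<bullet> x))"

text \<open>The Borel functional calculus \<open>\<chi>\<^sub>S(A)\<close> of a self-adjoint operator \<open>A\<close> on \<open>W\<close>, for Borel
  \<open>S\<close>.\<close>

definition spectral_proj ::
    "'a::real_inner set \<Rightarrow> ('a \<Rightarrow>\<^sub>L 'a) \<Rightarrow> real set \<Rightarrow> 'a \<Rightarrow>\<^sub>L 'a" where
  "spectral_proj W A S = (THE Q. \<exists>E. spectral_measure W A E \<and> Q = E S)"

definition has_spectral_flow ::
    "'a::real_inner set \<Rightarrow> (real \<Rightarrow> 'a \<Rightarrow>\<^sub>L 'a) \<Rightarrow> real \<Rightarrow> real \<Rightarrow> int \<Rightarrow> bool" where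
  "has_spectral_flow W T a b n \<longleftrightarrow>
     (\<exists>(N::nat) (\<tau>::nat \<Rightarrow> real) (\<alpha>::nat \<Rightarrow> real).
        \<tau> 0 = a \<and> \<tau> N = b \<and>
        (\<forall>i\<in>{1..N}. \<tau> (i - 1) < \<tau> i \<and> \<alpha> i > 0 \<and>
           continuous_on {\<tau> (i - 1)..\<tau> i} (\<lambda>t. spectral_proj W (T t) {- \<alpha> i..\<alpha> i}) \<and>
           (\<forall>t\<in>{\<tau> (i - 1)..\<tau> i}.
              finite_dimensional (range (spectral_proj W (T t) {- \<alpha> i..\<alpha> i})))) \<and>
        n = (\<Sum>i=1..N. int (dim (range (spectral_proj W (T (\<tau> i)) {0..\<alpha> i})))
                     - int (dim (range (spectral_proj W (T (\<tau> (i - 1))) {0..\<alpha> i})))))"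

text \<open>The spectral flow does not depend on the choices made in its definition.\<close>

definition spectral_flow ::
    "'a::real_inner set \<Rightarrow> (real \<Rightarrow> 'a \<Rightarrow>\<^sub>L 'a) \<Rightarrow> real \<Rightarrow> real \<Rightarrow> int" where
  "spectral_flow W T a b = (THE n. has_spectral_flow W T a b n)"

end

theory Submission
  imports Defs
begin

text \<open>
  The operators in the theorem are symmetries modulo compact operators: bounded self-adjoint \<open>A\<close>
  on a closed subspace \<open>W\<close> with \<open>A\<^sup>2 - I\<close> compact on \<open>W\<close>. This holds for \<open>T\<^sub>t = \<JJ> + K\<^sub>t\<close> and for
  the compressions of \<open>T\<^sub>t\<close> to \<open>\<V>\<close>. Because \<open>A\<^sup>2 - I\<close> is compact, such an operator has an
  orthonormal eigenbasis (\<open>essential_symmetry_diagonal\<close>), and its eigenvalues can accumulate only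
  at \<open>\<plusminus>1\<close>. So the functional calculus is explicit: \<open>\<chi>\<^sub>S(A)\<close> is the projection onto the closed span
  of the eigenvectors with eigenvalue in \<open>S\<close> (\<open>spectral_proj_eq\<close>), and \<open>V\<^sup>-(A)\<close> is the range of
  \<open>\<chi>\<^bsub>(-\<infinity>,0)\<^esub>(A)\<close> (\<open>neg_space_eq\<close>). Moreover \<open>A\<close> differs from \<open>I - 2 P\<close>, with \<open>P\<close> the projection
  onto \<open>V\<^sup>-(A)\<close>, by a compact operator. So all the negative spaces that occur are commensurable
  (\<open>commensurable_neg_space\<close>).

  The relative dimension is additive (\<open>rel_dim_add\<close>): three commensurable subspaces nearly contain
  a common subspace of finite codimension in each, and the relative dimensions are the differences
  of these codimensions.

  The spectral flow of a path with compact differences is \<open>dim (V\<^sup>-(T\<^sub>a), V\<^sup>-(T\<^sub>b))\<close>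
  (\<open>spectral_flow_eq_rel_dim\<close>). On an interval where \<open>\<chi>\<^bsub>[-\<alpha>,\<alpha>]\<^esub>(T\<^sub>t)\<close> is continuous of finite rank,
  replace \<open>T\<^sub>t\<close> by \<open>\<alpha>\<close> on the range of this projection. The negative spaces of the resulting
  operators, which have a gap around \<open>0\<close>, have relative dimension \<open>0\<close> for nearby parameters, while
  the rank of the window is constant. So an increase of the rank of \<open>\<chi>\<^bsub>[0,\<alpha>]\<^esub>\<close> is a decrease of
  \<open>V\<^sup>-\<close>. The first equality of the theorem follows from additivity for the four spaces
  \<open>V\<^sup>-(T\<^sub>a)\<close>, \<open>V\<^sup>-(T\<^sub>b)\<close> and their counterparts in \<open>\<V>\<close>.

  The second equality is a statement about a single form (\<open>index_formula\<close>). Let \<open>X\<close> and \<open>N\<close> be the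
  negative spaces of the form and of its restriction to \<open>\<V>\<close>, let \<open>C\<close> be the \<open>B\<close>-orthogonal
  complement of \<open>\<V>\<close>, and \<open>K = \<V> \<inter> C\<close>. The form is negative on \<open>N\<close> and nonnegative on \<open>X\<^sup>\<bottom>\<close>, so
  the relative dimension is \<open>dim (X \<inter> N\<^sup>\<bottom>)\<close>. If \<open>L \<subseteq> C\<close> is negative, the form is nonpositive on
  \<open>L \<oplus> K\<close>, and the projection of this space onto \<open>X \<inter> N\<^sup>\<bottom>\<close> annihilates only the part of \<open>K\<close> in
  the kernel of \<open>B\<close> (\<open>defect_upper\<close>). Conversely, the vectors of \<open>X\<close> that are \<open>B\<close>-orthogonal to
  \<open>N\<close> and \<open>K\<close> become elements of \<open>C\<close> after subtraction of a vector of the positive space of the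
  restriction, which keeps them negative (\<open>defect_lower\<close>).
\<close>

section \<open>Orthogonal complements\<close>

lemma mem_orthogonal_comp_iff: "x \<in> W\<^sup>\<bottom> \<longleftrightarrow> (\<forall>y\<in>W. x \<bullet> y = 0)"
  by (auto simp: orthogonal_comp_def orthogonal_def inner_commute)

lemma orthogonal_compD: "x \<in> W\<^sup>\<bottom> \<Longrightarrow> y \<in> W \<Longrightarrow> x \<bullet> y = 0"
  by (simp add: mem_orthogonal_comp_iff)

lemma closed_orthogonal_comp: "closed (W\<^sup>\<bottom>)"
proof -
  have "W\<^sup>\<bottom> = (\<Inter>y\<in>W. {x. x \<bullet> y = 0})" by (auto simp: mem_orthogonal_comp_iff)
  moreover have "closed {x. x \<bullet> y = 0}" for y :: 'a
    by (intro closed_Collect_eq continuous_intros)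
  ultimately show ?thesis by auto
qed

lemma orthogonal_comp_Int_self: "x \<in> W \<Longrightarrow> x \<in> W\<^sup>\<bottom> \<Longrightarrow> x = 0"
  by (auto simp: mem_orthogonal_comp_iff)

section \<open>Finite-dimensional subspaces\<close>

lemma finite_dimensional_subset: "finite_dimensional Y \<Longrightarrow> X \<subseteq> Y \<Longrightarrow> finite_dimensional X"
  unfolding finite_dimensional_def by blast

lemma finite_dimensional_zero: "finite_dimensional {0::'a::real_vector}"
  unfolding finite_dimensional_def by (rule exI[of _ "{}"]) simp

lemma finite_dimensional_span: "finite F \<Longrightarrow> finite_dimensional (span F)"
  unfolding finite_dimensional_def by blast

lemma finite_dimensional_basis:
  fixes X :: "'a::real_vector set"
  assumes "finite_dimensional X"
  obtains B where "finite B" "independent B" "B \<subseteq> X" "X \<subseteq> span B" "card B = dim X"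
proof -
  obtain F where F: "finite F" "X \<subseteq> span F" using assms by (auto simp: finite_dimensional_def)
  obtain B where B: "B \<subseteq> X" "independent B" "X \<subseteq> span B" "card B = dim X"
    using basis_exists by blast
  have "finite B" using independent_span_bound[OF F(1) B(2)] B(1) F(2) by auto
  with B show ?thesis using that by blast
qed

lemma dim_subset_finite:
  fixes X :: "'a::real_vector set"
  assumes "finite_dimensional Y" "X \<subseteq> Y"
  shows "dim X \<le> dim Y"
proof -
  obtain B where "finite B" "Y \<subseteq> span B" "card B = dim Y"
    using finite_dimensional_basis[OF assms(1)] by metis
  then show ?thesis using dim_le_card[of X B] assms(2) by auto
qed

lemma finite_dimensional_image:
  fixes f :: "'a::real_vector \<Rightarrow> 'b::real_vector"
  assumes "linear f" "finite_dimensional X"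
  shows "finite_dimensional (f ` X)" "dim (f ` X) \<le> dim X"
proof -
  obtain B where B: "finite B" "X \<subseteq> span B" "card B = dim X"
    using finite_dimensional_basis[OF assms(2)] by metis
  have *: "f ` X \<subseteq> span (f ` B)" using linear_span_image[OF assms(1), of B] B(2) by auto
  then show "finite_dimensional (f ` X)" using B(1) by (auto simp: finite_dimensional_def)
  have "dim (f ` X) \<le> card (f ` B)" using dim_le_card[OF *] B(1) by simp
  also have "\<dots> \<le> dim X" using card_image_le[OF B(1), of f] B(3) by simp
  finally show "dim (f ` X) \<le> dim X" .
qed

text \<open>
  The source is not assumed to be finite-dimensional: an injective linear map into a
  finite-dimensional space carries independent sets to independent sets.
\<close>

lemma finite_dimensional_injective:
  fixes f :: "'a::real_vector \<Rightarrow> 'b::real_vector"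
  assumes "linear f" "subspace L" and inj: "\<And>x. x \<in> L \<Longrightarrow> f x = 0 \<Longrightarrow> x = 0"
    and im: "\<And>x. x \<in> L \<Longrightarrow> f x \<in> G" and G: "finite_dimensional G"
  shows "finite_dimensional L" "dim L \<le> dim G"
proof -
  obtain B where B: "B \<subseteq> L" "independent B" "L \<subseteq> span B" "card B = dim L"
    using basis_exists by blast
  obtain C where C: "finite C" "G \<subseteq> span C" "card C = dim G"
    using finite_dimensional_basis[OF G] by metis
  have sp: "span B \<subseteq> L" using span_minimal[OF B(1) assms(2)] .
  have "inj_on f (span B)"
  proof (rule inj_onI)
    fix x y assume "x \<in> span B" "y \<in> span B" and e: "f x = f y"
    then have "x - y \<in> L" using sp assms(2) by (meson subsetD subspace_diff)
    moreover have "f (x - y) = 0" using e by (simp add: linear_diff[OF assms(1)])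
    ultimately show "x = y" using inj by fastforce
  qed
  then have i: "independent (f ` B)" "inj_on f B"
    using linear_independent_injective_image[OF assms(1) B(2)] span_superset
    by (auto intro: inj_on_subset)
  have "f ` B \<subseteq> span C" using im B(1) C(2) by auto
  from independent_span_bound[OF C(1) i(1) this]
  have fin: "finite (f ` B)" "card (f ` B) \<le> card C" by auto
  have "finite B" using finite_imageD[OF fin(1) i(2)] .
  then show "finite_dimensional L" using B(3) by (auto simp: finite_dimensional_def)
  show "dim L \<le> dim G" using fin(2) card_image[OF i(2)] B(4) C(3) by simp
qed

lemma dim_injective_image:
  fixes f :: "'a::real_vector \<Rightarrow> 'b::real_vector"
  assumes "linear f" "subspace L" "finite_dimensional L" "\<And>x. x \<in> L \<Longrightarrow> f x = 0 \<Longrightarrow> x = 0"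
  shows "dim (f ` L) = dim L"
proof (rule antisym)
  show "dim (f ` L) \<le> dim L" using finite_dimensional_image[OF assms(1,3)] by simp
  show "dim L \<le> dim (f ` L)"
    using finite_dimensional_injective(2)[OF assms(1,2,4), of "f ` L"]
      finite_dimensional_image(1)[OF assms(1,3)] by auto
qed

lemma finite_dimensional_orthogonal_basis:
  fixes X :: "'a::real_inner set"
  assumes "subspace X" "finite_dimensional X"
  obtains C where "finite C" "pairwise orthogonal C" "0 \<notin> C" "span C = X" "card C = dim X"
proof -
  obtain B where B: "finite B" "B \<subseteq> X" "X \<subseteq> span B"
    using finite_dimensional_basis[OF assms(2)] by metis
  obtain C where C: "finite C" "span C = span B" "pairwise orthogonal C"
    using basis_orthogonal[OF B(1)] by blast
  have sX: "span B = X" using B span_minimal[OF B(2) assms(1)] by auto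
  let ?C = "C - {0}"
  have p: "pairwise orthogonal ?C" using C(3) by (auto simp: pairwise_def)
  have s: "span ?C = X" using C(2) sX by simp
  have "independent ?C" using pairwise_orthogonal_independent[OF p] by simp
  then have "card ?C = dim (span ?C)" by (rule dim_span_eq_card_independent[symmetric])
  then have "card ?C = dim X" unfolding s .
  with p s C(1) that[of ?C] show ?thesis by simp
qed

lemma inner_orthogonal_sum:
  fixes C :: "'a::real_inner set"
  assumes "finite C" "pairwise orthogonal C" "c \<in> C"
  shows "(\<Sum>d\<in>C. k d *\<^sub>R d) \<bullet> c = k c * (c \<bullet> c)"
proof -
  have "(\<Sum>d\<in>C. k d *\<^sub>R d) \<bullet> c = (\<Sum>d\<in>C. if d = c then k c * (c \<bullet> c) else 0)"
    unfolding inner_sum_left using assms(2,3)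
    by (intro sum.cong) (auto simp: pairwise_def orthogonal_def)
  then show ?thesis using assms(1,3) by simp
qed

lemma span_eq_orthogonal_expansion:
  fixes C :: "'a::real_inner set"
  assumes "finite C" "pairwise orthogonal C" "0 \<notin> C" "x \<in> span C"
  shows "x = (\<Sum>c\<in>C. (x \<bullet> c / (c \<bullet> c)) *\<^sub>R c)"
proof -
  obtain k where k: "x = (\<Sum>c\<in>C. k c *\<^sub>R c)" using assms(1,4) by (auto simp: span_finite)
  have "x \<bullet> c / (c \<bullet> c) = k c" if "c \<in> C" for c
    using inner_orthogonal_sum[OF assms(1,2) that, of k] that assms(3) by (auto simp: k)
  then show ?thesis using k by (simp cong: sum.cong)
qed

lemma closed_finite_dimensional:
  fixes X :: "'a::real_inner set"
  assumes "subspace X" "finite_dimensional X"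
  shows "closed X"
proof -
  obtain C where C: "finite C" "pairwise orthogonal C" "0 \<notin> C" "span C = X"
    using finite_dimensional_orthogonal_basis[OF assms] by metis
  have "X = {x. x = (\<Sum>c\<in>C. (x \<bullet> c / (c \<bullet> c)) *\<^sub>R c)}" (is "_ = ?R")
  proof
    show "X \<subseteq> ?R" using span_eq_orthogonal_expansion[OF C(1-3)] C(4) by blast
    show "?R \<subseteq> X"
    proof
      fix x assume "x \<in> ?R"
      moreover have "(\<Sum>c\<in>C. (x \<bullet> c / (c \<bullet> c)) *\<^sub>R c) \<in> span C"
        by (intro span_sum span_scale span_base)
      ultimately show "x \<in> X" using C(4) by simp
    qed
  qed
  moreover have "closed ?R"
    using C(3) by (intro closed_Collect_eq continuous_intros) auto
  ultimately show ?thesis by simp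
qed

lemma dim_orthogonal_split:
  fixes F :: "'a::real_inner set"
  assumes "subspace F" "finite_dimensional F" "subspace F1" "F1 \<subseteq> F"
  shows "dim F = dim F1 + dim (F \<inter> F1\<^sup>\<bottom>)"
proof -
  let ?F2 = "F \<inter> F1\<^sup>\<bottom>"
  have fd: "finite_dimensional F1" "finite_dimensional ?F2"
    using finite_dimensional_subset[OF assms(2)] assms(4) by auto
  have s2: "subspace ?F2" using assms(1) subspace_orthogonal_comp by (intro subspace_inter) auto
  obtain C where C: "finite C" "pairwise orthogonal C" "0 \<notin> C" "span C = F1" "card C = dim F1"
    using finite_dimensional_orthogonal_basis[OF assms(3) fd(1)] by metis
  obtain D where D: "finite D" "pairwise orthogonal D" "0 \<notin> D" "span D = ?F2" "card D = dim ?F2"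
    using finite_dimensional_orthogonal_basis[OF s2 fd(2)] by metis
  have sub: "C \<subseteq> F1" "D \<subseteq> ?F2" using C(4) D(4) span_superset by blast+
  have o: "orthogonal c d" "orthogonal d c" if "c \<in> C" "d \<in> D" for c d
    using that subsetD[OF sub(1), of c] subsetD[OF sub(2), of d]
    by (auto simp: mem_orthogonal_comp_iff orthogonal_def inner_commute[of d])
  have dis: "C \<inter> D = {}" using o C(3) by (force simp: orthogonal_self)
  have po: "pairwise orthogonal (C \<union> D)"
    using C(2) D(2) o by (auto simp: pairwise_def)
  have ind: "independent (C \<union> D)" using pairwise_orthogonal_independent[OF po] C(3) D(3) by simp
  have "span (C \<union> D) = F"
  proof
    show "span (C \<union> D) \<subseteq> F" using sub assms(1,4) by (intro span_minimal) auto
    show "F \<subseteq> span (C \<union> D)"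
    proof
      fix x assume x: "x \<in> F"
      define p where "p = (\<Sum>c\<in>C. (x \<bullet> c / (c \<bullet> c)) *\<^sub>R c)"
      have "p \<in> span C" unfolding p_def by (intro span_sum span_scale span_base)
      then have p: "p \<in> F1" using C(4) by simp
      have "(x - p) \<bullet> c = 0" if "c \<in> C" for c
        using inner_orthogonal_sum[OF C(1,2) that, of "\<lambda>c. x \<bullet> c / (c \<bullet> c)"] that C(3)
        by (auto simp: p_def inner_diff_left)
      then have "\<forall>c\<in>C. orthogonal (x - p) c" by (simp add: orthogonal_def)
      then have "\<forall>y\<in>F1. orthogonal (x - p) y" using orthogonal_to_span[of _ C] C(4) by blast
      then have "x - p \<in> ?F2" using x p assms(1,4)
        by (auto simp: mem_orthogonal_comp_iff orthogonal_def intro: subspace_diff)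
      then have "x - p \<in> span (C \<union> D)" using D(4) span_mono[of D "C \<union> D"] by blast
      moreover have "p \<in> span (C \<union> D)" using p C(4) span_mono[of C "C \<union> D"] by blast
      ultimately have "(x - p) + p \<in> span (C \<union> D)" by (rule span_add)
      then show "x \<in> span (C \<union> D)" by simp
    qed
  qed
  then have "dim F = card (C \<union> D)" using dim_span_eq_card_independent[OF ind] by simp
  then show ?thesis using card_Un_disjoint[OF C(1) D(1) dis] C(5) D(5) by simp
qed

section \<open>Orthogonal projections\<close>

lemma linear_blinfun_apply: "linear (blinfun_apply A)"
  by (rule bounded_linear.linear) (rule blinfun.bounded_linear_right)

text \<open>
  A minimising sequence for the distance from \<open>x\<close> to \<open>W\<close> is a Cauchy sequence by the
  parallelogram law, and its limit is the foot of the perpendicular.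
\<close>

lemma orthogonal_decomposition:
  fixes W :: "'a::{real_inner, complete_space} set"
  assumes "subspace W" "closed W"
  obtains p where "p \<in> W" "x - p \<in> W\<^sup>\<bottom>"
proof -
  define d where "d = (INF w\<in>W. (norm (x - w))\<^sup>2)"
  have ne: "W \<noteq> {}" using assms(1) subspace_0 by auto
  have bd: "bdd_below ((\<lambda>w. (norm (x - w))\<^sup>2) ` W)" by (rule bdd_belowI[of _ 0]) auto
  have dle: "d \<le> (norm (x - w))\<^sup>2" if "w \<in> W" for w
    unfolding d_def using bd that by (rule cINF_lower)
  have "\<exists>w\<in>W. (norm (x - w))\<^sup>2 < d + inverse (real (Suc n))" for n
  proof -
    have "d < d + inverse (real (Suc n))" by simp
    then show ?thesis unfolding d_def using cINF_less_iff[OF ne bd] by blast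
  qed
  then obtain w where w: "\<And>n. w n \<in> W" "\<And>n. (norm (x - w n))\<^sup>2 < d + inverse (real (Suc n))" by metis
  have par: "(norm (u - v))\<^sup>2 \<le> 2 * (norm (x - u))\<^sup>2 + 2 * (norm (x - v))\<^sup>2 - 4 * d"
    if "u \<in> W" "v \<in> W" for u v
  proof -
    have "(1/2) *\<^sub>R (u + v) \<in> W" using that assms(1) by (intro subspace_scale subspace_add)
    from dle[OF this] have "d \<le> (norm (x - (1/2) *\<^sub>R (u + v)))\<^sup>2" .
    moreover have "(norm (u - v))\<^sup>2 + 4 * (norm (x - (1/2) *\<^sub>R (u + v)))\<^sup>2
      = 2 * (norm (x - u))\<^sup>2 + 2 * (norm (x - v))\<^sup>2"
      by (simp add: power2_norm_eq_inner inner_diff inner_add algebra_simps inner_commute)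
    ultimately show ?thesis by linarith
  qed
  have cau: "Cauchy w"
  proof (rule metric_CauchyI)
    fix e :: real assume e: "0 < e"
    obtain N where N: "inverse (real (Suc N)) < e\<^sup>2 / 4" using reals_Archimedean e
      by (metis divide_pos_pos zero_less_numeral zero_less_power)
    show "\<exists>M. \<forall>m\<ge>M. \<forall>n\<ge>M. dist (w m) (w n) < e"
    proof (intro exI allI impI)
      fix m n assume mn: "m \<ge> N" "n \<ge> N"
      have "inverse (real (Suc m)) \<le> inverse (real (Suc N))" "inverse (real (Suc n)) \<le> inverse (real (Suc N))"
        using mn by (auto intro!: le_imp_inverse_le)
      then have "(norm (w m - w n))\<^sup>2 < e\<^sup>2" using par[OF w(1) w(1), of m n] w(2)[of m] w(2)[of n] N
        by linarith
      then show "dist (w m) (w n) < e" using e by (simp add: dist_norm power_less_imp_less_base)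
    qed
  qed
  then obtain p where p: "w \<longlonglongrightarrow> p" using Cauchy_convergent convergent_def by blast
  have pW: "p \<in> W" using assms(2) p w(1) closed_sequentially by blast
  have "(\<lambda>n. (norm (x - w n))\<^sup>2) \<longlonglongrightarrow> (norm (x - p))\<^sup>2" by (intro tendsto_intros p)
  moreover have "(\<lambda>n. d + inverse (real (Suc n))) \<longlonglongrightarrow> d + 0"
    by (intro tendsto_add tendsto_const LIMSEQ_inverse_real_of_nat)
  ultimately have pd: "(norm (x - p))\<^sup>2 \<le> d"
    using w(2) by (intro LIMSEQ_le[of "\<lambda>n. (norm (x - w n))\<^sup>2" _ "\<lambda>n. d + inverse (real (Suc n))"])
      (auto intro: less_imp_le)
  have "(x - p) \<bullet> y = 0" if y: "y \<in> W" for y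
  proof (cases "y = 0")
    case False
    define t where "t = ((x - p) \<bullet> y) / (y \<bullet> y)"
    have "p + t *\<^sub>R y \<in> W" using pW y assms(1) by (intro subspace_add subspace_scale)
    from dle[OF this] pd have "(norm (x - p))\<^sup>2 \<le> (norm (x - (p + t *\<^sub>R y)))\<^sup>2" by linarith
    also have "\<dots> = (norm (x - p))\<^sup>2 - 2 * t * ((x - p) \<bullet> y) + t\<^sup>2 * (y \<bullet> y)"
      unfolding power2_norm_eq_inner
      by (simp add: inner_diff inner_add algebra_simps inner_commute power2_eq_square)
    also have "\<dots> = (norm (x - p))\<^sup>2 - ((x - p) \<bullet> y)\<^sup>2 / (y \<bullet> y)"
      using False by (simp add: t_def power2_eq_square)
    finally have "((x - p) \<bullet> y)\<^sup>2 / (y \<bullet> y) \<le> 0" by simp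
    moreover have "y \<bullet> y > 0" using False by simp
    ultimately show ?thesis by (simp add: divide_le_0_iff)
  qed simp
  then have "x - p \<in> W\<^sup>\<bottom>" by (simp add: mem_orthogonal_comp_iff)
  with pW that show ?thesis by blast
qed

lemma orthogonal_decomposition_unique:
  assumes "subspace W" "p \<in> W" "x - p \<in> W\<^sup>\<bottom>" "q \<in> W" "x - q \<in> W\<^sup>\<bottom>"
  shows "p = q"
proof -
  have "p - q \<in> W" using assms by (intro subspace_diff)
  moreover have "(x - q) - (x - p) \<in> W\<^sup>\<bottom>"
    using assms subspace_orthogonal_comp subspace_diff by blast
  ultimately show ?thesis using orthogonal_comp_Int_self[of "p - q" W] by simp
qed

locale closed_subspace =
  fixes W :: "'a::{real_inner, complete_space} set"
  assumes sub: "subspace W" and cl: "closed W"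
begin

lemma orth_proj_exists: "\<exists>P::'a \<Rightarrow>\<^sub>L 'a. \<forall>x. P x \<in> W \<and> x - P x \<in> W\<^sup>\<bottom>"
proof -
  have "\<exists>p. p \<in> W \<and> x - p \<in> W\<^sup>\<bottom>" for x
    using orthogonal_decomposition[OF sub cl] by metis
  then obtain p where p: "\<And>x. p x \<in> W" "\<And>x. x - p x \<in> W\<^sup>\<bottom>" by metis
  have "bounded_linear p"
  proof (rule bounded_linear_intro[where K=1])
    show "p (x + y) = p x + p y" for x y
    proof (rule orthogonal_decomposition_unique[OF sub p])
      show "p x + p y \<in> W" using p sub by (intro subspace_add)
      have "(x - p x) + (y - p y) \<in> W\<^sup>\<bottom>" using p(2) subspace_orthogonal_comp subspace_add by blast
      then show "x + y - (p x + p y) \<in> W\<^sup>\<bottom>" by (simp add: algebra_simps)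
    qed
    show "p (c *\<^sub>R x) = c *\<^sub>R p x" for c x
    proof (rule orthogonal_decomposition_unique[OF sub p])
      show "c *\<^sub>R p x \<in> W" using p sub by (intro subspace_scale)
      have "c *\<^sub>R (x - p x) \<in> W\<^sup>\<bottom>" using p(2) subspace_orthogonal_comp subspace_scale by blast
      then show "c *\<^sub>R x - c *\<^sub>R p x \<in> W\<^sup>\<bottom>" by (simp add: algebra_simps)
    qed
    show "norm (p x) \<le> norm x * 1" for x
    proof -
      have "(x - p x) \<bullet> p x = 0" using p by (simp add: mem_orthogonal_comp_iff)
      then have "(norm x)\<^sup>2 = (norm (p x))\<^sup>2 + (norm (x - p x))\<^sup>2"
        by (simp add: power2_norm_eq_inner inner_diff algebra_simps inner_commute)
      then have "(norm (p x))\<^sup>2 \<le> (norm x)\<^sup>2" by simp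
      then show ?thesis by (simp add: power_mono_iff)
    qed
  qed
  then show ?thesis using p by (intro exI[of _ "Blinfun p"]) (simp add: bounded_linear_Blinfun_apply)
qed

lemma orth_proj: "orth_proj W x \<in> W" "x - orth_proj W x \<in> W\<^sup>\<bottom>"
proof -
  have "\<exists>!P::'a \<Rightarrow>\<^sub>L 'a. \<forall>x. P x \<in> W \<and> x - P x \<in> W\<^sup>\<bottom>"
    using orth_proj_exists orthogonal_decomposition_unique[OF sub]
    by (metis blinfun_eqI)
  from theI'[OF this] show "orth_proj W x \<in> W" "x - orth_proj W x \<in> W\<^sup>\<bottom>"
    by (auto simp: orth_proj_def)
qed

lemma orth_proj_eqI: "p \<in> W \<Longrightarrow> x - p \<in> W\<^sup>\<bottom> \<Longrightarrow> orth_proj W x = p"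
  using orthogonal_decomposition_unique[OF sub] orth_proj by blast

lemma orth_proj_id: "x \<in> W \<Longrightarrow> orth_proj W x = x"
  by (rule orth_proj_eqI) (auto simp: mem_orthogonal_comp_iff)

lemma orth_proj_zero: "x \<in> W\<^sup>\<bottom> \<Longrightarrow> orth_proj W x = 0"
  by (rule orth_proj_eqI) (auto simp: sub subspace_0)

lemma orth_proj_idem [simp]: "orth_proj W (orth_proj W x) = orth_proj W x"
  by (simp add: orth_proj_id orth_proj)

lemma inner_orth_proj_right: "y \<in> W \<Longrightarrow> orth_proj W x \<bullet> y = x \<bullet> y"
  using orth_proj(2)[of x] by (auto simp: mem_orthogonal_comp_iff inner_diff_left)

lemma inner_orth_proj_left: "y \<in> W \<Longrightarrow> y \<bullet> orth_proj W x = y \<bullet> x"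
  using inner_orth_proj_right by (simp add: inner_commute)

lemma orth_proj_sym: "orth_proj W x \<bullet> y = x \<bullet> orth_proj W y"
  using inner_orth_proj_right[OF orth_proj(1), of x y] inner_orth_proj_left[OF orth_proj(1), of x y]
  by simp

lemma self_adjoint_orth_proj: "self_adjoint (orth_proj W)"
  by (simp add: self_adjoint_def orth_proj_sym)

lemma norm_orth_proj_decomp: "(norm x)\<^sup>2 = (norm (orth_proj W x))\<^sup>2 + (norm (x - orth_proj W x))\<^sup>2"
proof -
  have "(x - orth_proj W x) \<bullet> orth_proj W x = 0" using orth_proj[of x] by (simp add: mem_orthogonal_comp_iff)
  then show ?thesis by (simp add: power2_norm_eq_inner inner_diff algebra_simps inner_commute)
qed

lemma norm_orth_proj_le: "norm (orth_proj W x) \<le> norm x"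
proof -
  have "(norm (orth_proj W x))\<^sup>2 \<le> (norm x)\<^sup>2" using norm_orth_proj_decomp[of x] by simp
  then show ?thesis by (simp add: power_mono_iff)
qed

lemma norm_diff_orth_proj_le: "norm (x - orth_proj W x) \<le> norm x"
proof -
  have "(norm (x - orth_proj W x))\<^sup>2 \<le> (norm x)\<^sup>2" using norm_orth_proj_decomp[of x] by simp
  then show ?thesis by (simp add: power_mono_iff)
qed

lemma range_orth_proj: "range (orth_proj W) = W"
  using orth_proj orth_proj_id by (metis image_subset_iff rangeI subsetI subset_antisym UNIV_I)

end

lemma closed_subspace_finite_dimensional:
  "subspace X \<Longrightarrow> finite_dimensional X \<Longrightarrow> closed_subspace (X :: 'a::{real_inner, complete_space} set)"
  by (simp add: closed_subspace_def closed_finite_dimensional)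

lemma closed_subspace_orthogonal_comp: "closed_subspace ((W::'a::{real_inner, complete_space} set)\<^sup>\<bottom>)"
  by (simp add: closed_subspace_def closed_orthogonal_comp subspace_orthogonal_comp)

lemma closed_subspace_Int: "closed_subspace X \<Longrightarrow> closed_subspace Y \<Longrightarrow> closed_subspace (X \<inter> Y)"
  by (auto simp: closed_subspace_def intro: subspace_inter)

lemma closed_subspace_UNIV: "closed_subspace UNIV"
  by (simp add: closed_subspace_def)

text \<open>
  The projection onto \<open>F\<close> is injective on \<open>L\<close>. Spaces on which a compact operator is bounded
  below are recognised as finite-dimensional in this way.
\<close>

lemma finite_dimensional_transversal:
  fixes L :: "'a::{real_inner, complete_space} set"
  assumes "subspace L" "subspace F" "finite_dimensional F" "\<And>x. x \<in> L \<Longrightarrow> x \<in> F\<^sup>\<bottom> \<Longrightarrow> x = 0"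
  shows "finite_dimensional L" "dim L \<le> dim F"
proof -
  interpret closed_subspace F using closed_subspace_finite_dimensional assms by blast
  have *: "x = 0" if "x \<in> L" "orth_proj F x = 0" for x
    using assms(4)[OF that(1)] orth_proj(2)[of x] that(2) by simp
  show "finite_dimensional L" "dim L \<le> dim F"
    using finite_dimensional_injective[OF linear_blinfun_apply[of "orth_proj F"] assms(1) * _ assms(3)]
      orth_proj(1) by auto
qed

text \<open>
  The projection onto \<open>G\<close> maps the complement of \<open>F \<inter> G\<^sup>\<bottom>\<close> in \<open>F\<close> injectively into the
  complement of \<open>G \<inter> F\<^sup>\<bottom>\<close> in \<open>G\<close>.
\<close>

lemma rel_dim_finite_dimensional_le:
  fixes F G :: "'a::{real_inner, complete_space} set"
  assumes "subspace F" "finite_dimensional F" "subspace G" "finite_dimensional G"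
  shows "dim F + dim (G \<inter> F\<^sup>\<bottom>) \<le> dim G + dim (F \<inter> G\<^sup>\<bottom>)"
proof -
  interpret G: closed_subspace G using closed_subspace_finite_dimensional assms by blast
  let ?F1 = "F \<inter> G\<^sup>\<bottom>" and ?G1 = "G \<inter> F\<^sup>\<bottom>"
  have s: "subspace ?F1" "subspace ?G1" "subspace (F \<inter> ?F1\<^sup>\<bottom>)"
    using assms subspace_orthogonal_comp by (auto intro!: subspace_inter)
  have F: "dim F = dim ?F1 + dim (F \<inter> ?F1\<^sup>\<bottom>)" and G: "dim G = dim ?G1 + dim (G \<inter> ?G1\<^sup>\<bottom>)"
    using assms s by (auto intro!: dim_orthogonal_split)
  have "dim (F \<inter> ?F1\<^sup>\<bottom>) \<le> dim (G \<inter> ?G1\<^sup>\<bottom>)"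
  proof (rule finite_dimensional_injective(2)[OF linear_blinfun_apply[of "orth_proj G"] s(3)])
    fix x assume x: "x \<in> F \<inter> ?F1\<^sup>\<bottom>"
    show "x = 0" if "orth_proj G x = 0"
    proof -
      have "x \<in> G\<^sup>\<bottom>" using G.orth_proj(2)[of x] that by simp
      then show ?thesis using x orthogonal_comp_Int_self[of x ?F1] by blast
    qed
    have "orth_proj G x \<bullet> y = 0" if "y \<in> ?G1" for y
      using that x G.inner_orth_proj_right[of y x] by (auto simp: mem_orthogonal_comp_iff inner_commute)
    then show "orth_proj G x \<in> G \<inter> ?G1\<^sup>\<bottom>" using G.orth_proj(1) by (simp add: mem_orthogonal_comp_iff)
  qed (use assms(4) finite_dimensional_subset in blast)
  then show ?thesis using F G by linarith
qed

lemma rel_dim_finite_dimensional: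
  fixes F G :: "'a::{real_inner, complete_space} set"
  assumes "subspace F" "finite_dimensional F" "subspace G" "finite_dimensional G"
  shows "rel_dim F G = int (dim F) - int (dim G)"
  using rel_dim_finite_dimensional_le[OF assms] rel_dim_finite_dimensional_le[OF assms(3,4,1,2)]
  unfolding rel_dim_def by linarith

section \<open>Compact operators\<close>

text \<open>
  Points of the closure of the image are approximated by images of vectors of the unit ball, so
  that sequences in the unit ball suffice.
\<close>

lemma compact_operatorI:
  fixes A :: "'a::real_normed_vector \<Rightarrow>\<^sub>L 'a"
  assumes "\<And>x::nat \<Rightarrow> 'a. (\<And>n. norm (x n) \<le> 1) \<Longrightarrow> \<exists>r. strict_mono (r::nat \<Rightarrow> nat) \<and> convergent (\<lambda>n. A (x (r n)))"
  shows "compact_operator A"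
  unfolding compact_operator_def compact_eq_seq_compact_metric seq_compact_def
proof (intro allI impI)
  fix y :: "nat \<Rightarrow> 'a" assume y: "\<forall>n. y n \<in> closure (A ` cball 0 1)"
  have "\<exists>x. norm x \<le> 1 \<and> dist (A x) (y n) < inverse (real (Suc n))" for n
  proof -
    have "inverse (real (Suc n)) > 0" by simp
    then obtain z where "z \<in> A ` cball 0 1" "dist z (y n) < inverse (real (Suc n))"
      using y closure_approachable by metis
    then show ?thesis by auto
  qed
  then obtain x where x: "\<And>n. norm (x n) \<le> 1" "\<And>n. dist (A (x n)) (y n) < inverse (real (Suc n))" by metis
  obtain r l where r: "strict_mono (r::nat\<Rightarrow>nat)" "(\<lambda>n. A (x (r n))) \<longlonglongrightarrow> l"
    using assms[of x, OF x(1)] by (auto simp: convergent_def)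
  have "(\<lambda>n. inverse (real (Suc (r n)))) \<longlonglongrightarrow> 0"
    using LIMSEQ_subseq_LIMSEQ[OF LIMSEQ_inverse_real_of_nat r(1)] by (simp add: o_def)
  then have "(\<lambda>n. dist (A (x (r n))) (y (r n))) \<longlonglongrightarrow> 0"
    by (rule Lim_null_comparison[rotated])
      (use x(2) in \<open>auto intro!: always_eventually intro: less_imp_le\<close>)
  then have "(\<lambda>n. A (x (r n)) - y (r n)) \<longlonglongrightarrow> 0" by (simp add: dist_norm tendsto_norm_zero_iff)
  from tendsto_diff[OF r(2) this] have l: "(\<lambda>n. y (r n)) \<longlonglongrightarrow> l" by simp
  then have "l \<in> closure (A ` cball 0 1)"
    using y closed_sequentially[of "closure (A ` cball 0 1)" "\<lambda>n. y (r n)" l] by simp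
  then show "\<exists>l\<in>closure (A ` cball 0 1). \<exists>r. strict_mono r \<and> (y \<circ> r) \<longlonglongrightarrow> l"
    using l r(1) by (auto simp: o_def)
qed

lemma compact_operatorE:
  fixes A :: "'a::real_normed_vector \<Rightarrow>\<^sub>L 'a"
  assumes "compact_operator A" "\<And>n. norm (x n) \<le> c"
  obtains r where "strict_mono (r::nat \<Rightarrow> nat)" "convergent (\<lambda>n. A (x (r n)))"
proof -
  define d where "d = max c 1"
  have d: "d > 0" "\<And>n. norm (x n) \<le> d" using assms(2) by (auto simp: d_def le_max_iff_disj)
  have "\<forall>n. A ((1/d) *\<^sub>R x n) \<in> closure (A ` cball 0 1)"
    using d by (intro allI subsetD[OF closure_subset] imageI) (auto simp: divide_simps)
  then obtain l r where "strict_mono (r::nat\<Rightarrow>nat)" "((\<lambda>n. A ((1/d) *\<^sub>R x n)) \<circ> r) \<longlonglongrightarrow> l"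
    using assms(1) unfolding compact_operator_def compact_eq_seq_compact_metric seq_compact_def by metis
  then have r: "strict_mono r" "(\<lambda>n. A ((1/d) *\<^sub>R x (r n))) \<longlonglongrightarrow> l" by (auto simp: o_def)
  have "(\<lambda>n. d *\<^sub>R A ((1/d) *\<^sub>R x (r n))) \<longlonglongrightarrow> d *\<^sub>R l" by (intro tendsto_intros r)
  moreover have "d *\<^sub>R A ((1/d) *\<^sub>R x (r n)) = A (x (r n))" for n
    using d by (simp add: blinfun.scaleR_right)
  ultimately have "convergent (\<lambda>n. A (x (r n)))" by (auto simp: convergent_def)
  with r(1) that show ?thesis by blast
qed

lemma compact_operator_add:
  assumes "compact_operator A" "compact_operator B"
  shows "compact_operator (A + B)"
proof (rule compact_operatorI)
  fix x :: "nat \<Rightarrow> 'a" assume x: "\<And>n. norm (x n) \<le> 1"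
  obtain r where r: "strict_mono (r::nat\<Rightarrow>nat)" "convergent (\<lambda>n. A (x (r n)))"
    by (rule compact_operatorE[where x=x, OF assms(1) x])
  obtain s where s: "strict_mono (s::nat\<Rightarrow>nat)" "convergent (\<lambda>n. B (x (r (s n))))"
    by (rule compact_operatorE[where x="\<lambda>n. x (r n)", OF assms(2) x])
  have "convergent (\<lambda>n. A (x (r (s n))))"
    using convergent_subseq_convergent[OF r(2) s(1)] by (simp add: o_def)
  then have "convergent (\<lambda>n. (A + B) (x (r (s n))))"
    using convergent_add[OF _ s(2)] by (simp add: blinfun.add_left)
  then show "\<exists>r. strict_mono (r::nat\<Rightarrow>nat) \<and> convergent (\<lambda>n. (A + B) (x (r n)))"
    using strict_mono_o[OF r(1) s(1)] by (intro exI[of _ "r \<circ> s"]) (auto simp: o_def)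
qed

text \<open>
  Along a subsequence on which the images under \<open>A\<close> converge, those under \<open>B\<close> form a Cauchy
  sequence. A factor that is bounded below can thus be split off without inverting it.
\<close>

lemma compact_operator_dominated:
  fixes A B :: "'a::{real_normed_vector, complete_space} \<Rightarrow>\<^sub>L 'a"
  assumes "compact_operator A" "\<And>z. norm (B z) \<le> c * norm (A z)"
  shows "compact_operator B"
proof (rule compact_operatorI)
  fix x :: "nat \<Rightarrow> 'a" assume x: "\<And>n. norm (x n) \<le> 1"
  obtain r where r: "strict_mono (r::nat\<Rightarrow>nat)" "convergent (\<lambda>n. A (x (r n)))"
    by (rule compact_operatorE[where x=x, OF assms(1) x])
  have "Cauchy (\<lambda>n. B (x (r n)))"
  proof (rule metric_CauchyI)
    fix e :: real assume e: "0 < e"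
    define k where "k = \<bar>c\<bar> + 1"
    have k: "k > 0" "c \<le> k" by (auto simp: k_def)
    obtain N where N: "\<And>m n. m \<ge> N \<Longrightarrow> n \<ge> N \<Longrightarrow> dist (A (x (r m))) (A (x (r n))) < e / k"
      using metric_CauchyD[OF convergent_Cauchy[OF r(2)], of "e / k"] e k by auto
    show "\<exists>M. \<forall>m\<ge>M. \<forall>n\<ge>M. dist (B (x (r m))) (B (x (r n))) < e"
    proof (intro exI allI impI)
      fix m n assume "m \<ge> N" "n \<ge> N"
      have "dist (B (x (r m))) (B (x (r n))) \<le> c * norm (A (x (r m) - x (r n)))"
        using assms(2)[of "x (r m) - x (r n)"] by (simp add: dist_norm blinfun.diff_right)
      also have "\<dots> \<le> k * dist (A (x (r m))) (A (x (r n)))"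
        using k by (auto simp: dist_norm blinfun.diff_right intro!: mult_right_mono)
      also have "\<dots> < e" using N[OF \<open>m \<ge> N\<close> \<open>n \<ge> N\<close>] k by (simp add: field_simps)
      finally show "dist (B (x (r m))) (B (x (r n))) < e" .
    qed
  qed
  then show "\<exists>r. strict_mono (r::nat\<Rightarrow>nat) \<and> convergent (\<lambda>n. B (x (r n)))"
    using r(1) Cauchy_convergent by blast
qed

lemma compact_operator_compose_right:
  assumes "compact_operator A"
  shows "compact_operator (A o\<^sub>L B)"
proof (rule compact_operatorI)
  fix x :: "nat \<Rightarrow> 'a" assume x: "\<And>n. norm (x n) \<le> 1"
  have "norm (B (x n)) \<le> norm B" for n
    using norm_blinfun[of B "x n"] mult_left_mono[OF x[of n] norm_ge_zero[of B]] by simp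
  then obtain r where "strict_mono (r::nat\<Rightarrow>nat)" "convergent (\<lambda>n. A (B (x (r n))))"
    by (rule compact_operatorE[where x="\<lambda>n. B (x n)", OF assms])
  then show "\<exists>r. strict_mono (r::nat\<Rightarrow>nat) \<and> convergent (\<lambda>n. (A o\<^sub>L B) (x (r n)))" by auto
qed

lemma compact_operator_compose_left:
  fixes A :: "'a::{real_normed_vector, complete_space} \<Rightarrow>\<^sub>L 'a"
  assumes "compact_operator A"
  shows "compact_operator (B o\<^sub>L A)"
  by (rule compact_operator_dominated[OF assms, of _ "norm B"]) (simp add: norm_blinfun)

lemma compact_operator_scaleR:
  fixes A :: "'a::{real_normed_vector, complete_space} \<Rightarrow>\<^sub>L 'a"
  assumes "compact_operator A"
  shows "compact_operator (c *\<^sub>R A)"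
  by (rule compact_operator_dominated[OF assms, of _ "\<bar>c\<bar>"]) (simp add: blinfun.scaleR_left)

lemma compact_operator_uminus:
  fixes A :: "'a::{real_normed_vector, complete_space} \<Rightarrow>\<^sub>L 'a"
  assumes "compact_operator A"
  shows "compact_operator (- A)"
  by (rule compact_operator_dominated[OF assms, of _ 1]) (simp add: blinfun.minus_left)

lemma compact_operator_diff:
  fixes A :: "'a::{real_normed_vector, complete_space} \<Rightarrow>\<^sub>L 'a"
  assumes "compact_operator A" "compact_operator B"
  shows "compact_operator (A - B)"
  using compact_operator_add[OF assms(1) compact_operator_uminus[OF assms(2)]] by simp

lemma compact_operator_zero: "compact_operator (0 :: 'a::real_normed_vector \<Rightarrow>\<^sub>L 'a)"
proof (rule compact_operatorI)
  fix x :: "nat \<Rightarrow> 'a"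
  show "\<exists>r. strict_mono (r::nat\<Rightarrow>nat) \<and> convergent (\<lambda>n. (0::'a \<Rightarrow>\<^sub>L 'a) (x (r n)))"
    by (rule exI[of _ "\<lambda>n. n"]) (simp add: strict_mono_def convergent_const)
qed

lemma compact_operator_rank_one:
  fixes A :: "'a::real_inner \<Rightarrow>\<^sub>L 'a"
  assumes "\<And>x. A x = (x \<bullet> c) *\<^sub>R d"
  shows "compact_operator A"
proof (rule compact_operatorI)
  fix x :: "nat \<Rightarrow> 'a" assume x: "\<And>n. norm (x n) \<le> 1"
  have "\<bar>x n \<bullet> c\<bar> \<le> norm c" for n
    using Cauchy_Schwarz_ineq2[of "x n" c] mult_right_mono[OF x[of n] norm_ge_zero[of c]] by simp
  then have "bounded (range (\<lambda>n. x n \<bullet> c))" by (auto simp: bounded_iff)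
  then obtain l r where r: "strict_mono (r::nat\<Rightarrow>nat)" "((\<lambda>n. x n \<bullet> c) \<circ> r) \<longlonglongrightarrow> l"
    using bounded_imp_convergent_subsequence by blast
  have "(\<lambda>n. A (x (r n))) \<longlonglongrightarrow> l *\<^sub>R d"
    unfolding assms using r(2) by (intro tendsto_intros) (simp add: o_def)
  then show "\<exists>r. strict_mono (r::nat\<Rightarrow>nat) \<and> convergent (\<lambda>n. A (x (r n)))"
    using r(1) by (auto simp: convergent_def)
qed

lemma compact_operator_orth_proj:
  fixes F :: "'a::{real_inner, complete_space} set"
  assumes "subspace F" "finite_dimensional F"
  shows "compact_operator (orth_proj F)"
proof -
  interpret closed_subspace F using closed_subspace_finite_dimensional assms by blast
  obtain C where C: "finite C" "pairwise orthogonal C" "0 \<notin> C" "span C = F"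
    using finite_dimensional_orthogonal_basis[OF assms] by metis
  define R where "R c = Blinfun (\<lambda>x. (x \<bullet> c / (c \<bullet> c)) *\<^sub>R c)" for c :: 'a
  have R: "R c x = (x \<bullet> ((1 / (c \<bullet> c)) *\<^sub>R c)) *\<^sub>R c" for c x
  proof -
    have "bounded_linear (\<lambda>x. (x \<bullet> ((1 / (c \<bullet> c)) *\<^sub>R c)) *\<^sub>R c)"
      by (rule bounded_linear_scaleR_const[OF bounded_linear_inner_left])
    then show ?thesis unfolding R_def
      by (subst bounded_linear_Blinfun_apply) auto
  qed
  have "compact_operator (\<Sum>c\<in>D. R c)" if "finite D" for D
    using that
  proof induction
    case (insert d D)
    have "compact_operator (R d)" using R by (rule compact_operator_rank_one)
    then show ?case using insert by (simp add: compact_operator_add)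
  qed (simp add: compact_operator_zero)
  moreover have "orth_proj F x = (\<Sum>c\<in>C. R c) x" for x
  proof -
    have e: "orth_proj F x = (\<Sum>c\<in>C. (orth_proj F x \<bullet> c / (c \<bullet> c)) *\<^sub>R c)"
      using span_eq_orthogonal_expansion[OF C(1-3)] C(4) orth_proj(1) by blast
    have "orth_proj F x \<bullet> c = x \<bullet> c" if "c \<in> C" for c
      using inner_orth_proj_right that C(4) span_base by blast
    then show ?thesis by (subst e) (simp add: blinfun.sum_left R)
  qed
  then have "orth_proj F = (\<Sum>c\<in>C. R c)" by (rule blinfun_eqI)
  ultimately show ?thesis using C(1) by simp
qed

lemma compact_operator_finite_rank:
  fixes A :: "'a::{real_inner, complete_space} \<Rightarrow>\<^sub>L 'a"
  assumes "subspace F" "finite_dimensional F" "\<And>x. A x \<in> F"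
  shows "compact_operator A"
proof -
  interpret closed_subspace F using closed_subspace_finite_dimensional assms by blast
  have "A = orth_proj F o\<^sub>L A" by (rule blinfun_eqI) (simp add: orth_proj_id assms(3))
  then show ?thesis using compact_operator_compose_right[OF compact_operator_orth_proj[OF assms(1,2)]] by metis
qed

text \<open>
  For \<open>x\<close> orthogonal to a finite \<open>e\<close>-net of the image of the unit ball, \<open>\<langle>D x, y\<rangle> = \<langle>x, D y\<rangle>\<close>
  changes only by the error of the net when \<open>D y\<close> is replaced by a point of the net, and that
  point contributes nothing.
\<close>

lemma compact_self_adjoint_small:
  fixes D :: "'a::{real_inner, complete_space} \<Rightarrow>\<^sub>L 'a"
  assumes "compact_operator D" "self_adjoint D" "e > 0"
  obtains G where "subspace G" "finite_dimensional G" "\<And>x. x \<in> G\<^sup>\<bottom> \<Longrightarrow> norm (D x) \<le> e * norm x"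
proof -
  obtain k where k: "finite k" "closure (D ` cball 0 1) \<subseteq> (\<Union>x\<in>k. ball x e)"
    using assms(1,3) unfolding compact_operator_def compact_eq_totally_bounded by metis
  have "norm (D x) \<le> e * norm x" if x: "x \<in> (span k)\<^sup>\<bottom>" for x
  proof (cases "D x = 0")
    case False
    define y where "y = (1 / norm (D x)) *\<^sub>R D x"
    have y: "norm y = 1" using False by (simp add: y_def)
    then have "D y \<in> closure (D ` cball 0 1)" by (intro subsetD[OF closure_subset] imageI) simp
    then obtain d where d: "d \<in> k" "dist d (D y) < e" using k(2) by auto
    have "x \<bullet> d = 0" using x d(1) span_base by (auto simp: mem_orthogonal_comp_iff)
    have "norm (D x) = D x \<bullet> y" using False by (simp add: y_def dot_square_norm power2_eq_square)
    also have "\<dots> = x \<bullet> (D y - d)" using assms(2) \<open>x \<bullet> d = 0\<close> by (simp add: self_adjoint_def inner_diff_right)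
    also have "\<dots> \<le> norm x * norm (D y - d)" by (rule norm_cauchy_schwarz)
    also have "\<dots> \<le> norm x * e" using d(2) by (intro mult_left_mono) (auto simp: dist_norm norm_minus_commute)
    finally show ?thesis by (simp add: mult.commute)
  qed (use assms(3) in simp)
  then show ?thesis using that[of "span k"] k(1) finite_dimensional_span by auto
qed



section \<open>Relative dimension\<close>

lemma closed_subspace_image:
  fixes A :: "'a::{real_inner, complete_space} \<Rightarrow>\<^sub>L 'a"
  assumes "closed_subspace L" "c > 0" "\<And>x. x \<in> L \<Longrightarrow> norm (A x) \<ge> c * norm x"
  shows "closed_subspace (A ` L)"
proof -
  interpret closed_subspace L by fact
  have "complete (A ` L)"
    using assms(2,3) sub cl by (intro complete_isometric_image[where e=c])
      (auto simp: complete_eq_closed blinfun.bounded_linear_right)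
  then show ?thesis using linear_subspace_image[OF linear_blinfun_apply sub]
    by (simp add: closed_subspace_def complete_eq_closed)
qed

lemma closed_subspace_orthogonal_decomp:
  assumes "closed_subspace X" "closed_subspace Y" "X \<subseteq> Y"
  shows "y \<in> Y \<Longrightarrow> y - orth_proj X y \<in> Y \<inter> X\<^sup>\<bottom>"
  using assms closed_subspace.orth_proj[OF assms(1)]
  by (auto simp: closed_subspace_def intro: subspace_diff)

text \<open>
  The relative dimension of \<open>Y\<close> and \<open>Z\<close> is that of the finite-dimensional spaces
  \<open>F = Y \<inter> Y0\<^sup>\<bottom>\<close> and \<open>G = Z \<inter> Y0\<^sup>\<bottom>\<close>. On one side \<open>G \<inter> F\<^sup>\<bottom> = Z \<inter> Y\<^sup>\<bottom>\<close>. On the other side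
  the component in \<open>F\<close> identifies \<open>Y \<inter> Z\<^sup>\<bottom>\<close> with \<open>F \<inter> G\<^sup>\<bottom>\<close>: if \<open>x \<in> F\<close> is orthogonal to \<open>G\<close>,
  then the projection of \<open>x\<close> to \<open>Z\<close> lies in the image of \<open>Y0\<close>, which is closed by the lower
  bound, and subtracting a preimage from \<open>x\<close> gives an element of \<open>Y \<inter> Z\<^sup>\<bottom>\<close>.
\<close>

lemma rel_dim_bounded_below:
  fixes Y Z Y0 :: "'a::{real_inner, complete_space} set"
  assumes Y: "closed_subspace Y" and Z: "closed_subspace Z" and Y0: "closed_subspace Y0" "Y0 \<subseteq> Y"
    and F: "finite_dimensional (Y \<inter> Y0\<^sup>\<bottom>)" and G: "finite_dimensional (Z \<inter> Y0\<^sup>\<bottom>)"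
    and c: "c > 0" "\<And>y. y \<in> Y0 \<Longrightarrow> norm (orth_proj Z y) \<ge> c * norm y"
  shows "rel_dim Y Z = int (dim (Y \<inter> Y0\<^sup>\<bottom>)) - int (dim (Z \<inter> Y0\<^sup>\<bottom>))"
proof -
  interpret Y: closed_subspace Y by fact
  interpret Z: closed_subspace Z by fact
  interpret Y0: closed_subspace Y0 by fact
  let ?F = "Y \<inter> Y0\<^sup>\<bottom>" and ?G = "Z \<inter> Y0\<^sup>\<bottom>"
  have sF: "subspace ?F" and sG: "subspace ?G" and sYZ: "subspace (Y \<inter> Z\<^sup>\<bottom>)"
    using Y.sub Z.sub subspace_orthogonal_comp by (auto intro!: subspace_inter)
  let ?Z0 = "orth_proj Z ` Y0"
  interpret Z0: closed_subspace ?Z0 using closed_subspace_image[OF Y0(1) c] .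
  have Z0Z: "?Z0 \<subseteq> Z" using Z.orth_proj by auto
  have GF: "?G \<inter> ?F\<^sup>\<bottom> = Z \<inter> Y\<^sup>\<bottom>"
  proof
    show "?G \<inter> ?F\<^sup>\<bottom> \<subseteq> Z \<inter> Y\<^sup>\<bottom>"
    proof
      fix z assume z: "z \<in> ?G \<inter> ?F\<^sup>\<bottom>"
      have "z \<bullet> y = 0" if "y \<in> Y" for y
      proof -
        have "z \<bullet> (y - orth_proj Y0 y) = 0"
          using z closed_subspace_orthogonal_decomp[OF Y0(1) Y Y0(2) that] by (simp add: mem_orthogonal_comp_iff)
        moreover have "z \<bullet> orth_proj Y0 y = 0" using z Y0.orth_proj(1) by (simp add: mem_orthogonal_comp_iff)
        ultimately show ?thesis by (simp add: inner_diff_right)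
      qed
      then show "z \<in> Z \<inter> Y\<^sup>\<bottom>" using z by (simp add: mem_orthogonal_comp_iff)
    qed
    show "Z \<inter> Y\<^sup>\<bottom> \<subseteq> ?G \<inter> ?F\<^sup>\<bottom>"
      using Y0(2) orthogonal_comp_anti_mono[of Y0 Y] orthogonal_comp_anti_mono[of ?F Y] by blast
  qed
  define f where "f = (\<lambda>y. y - orth_proj Y0 y)"
  have lin: "linear f"
  proof -
    have "f = blinfun_apply (id_blinfun - orth_proj Y0)" by (simp add: f_def fun_eq_iff blinfun.diff_left)
    then show ?thesis using linear_blinfun_apply by metis
  qed
  have inj: "y = 0" if "y \<in> Y \<inter> Z\<^sup>\<bottom>" "f y = 0" for y
  proof -
    have "y \<in> Y0" using that(2) Y0.orth_proj(1)[of y] by (simp add: f_def)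
    moreover have "orth_proj Z y = 0" using that(1) Z.orth_proj_zero by simp
    ultimately show ?thesis using c(2)[of y] c(1) by (simp add: mult_le_0_iff)
  qed
  have im: "f y \<in> ?F \<inter> ?G\<^sup>\<bottom>" if y: "y \<in> Y \<inter> Z\<^sup>\<bottom>" for y
  proof -
    have "f y \<bullet> g = 0" if "g \<in> ?G" for g
    proof -
      have "y \<bullet> g = 0" using y that by (simp add: mem_orthogonal_comp_iff)
      moreover have "orth_proj Y0 y \<bullet> g = 0"
        using that Y0.orth_proj(1)[of y] by (auto simp: mem_orthogonal_comp_iff inner_commute[of g])
      ultimately show ?thesis by (simp add: f_def inner_diff_left)
    qed
    then show ?thesis using closed_subspace_orthogonal_decomp[OF Y0(1) Y Y0(2)] y
      by (simp add: f_def mem_orthogonal_comp_iff)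
  qed
  have surj: "\<exists>y\<in>Y \<inter> Z\<^sup>\<bottom>. f y = x" if x: "x \<in> ?F \<inter> ?G\<^sup>\<bottom>" for x
  proof -
    define g where "g = orth_proj Z x - orth_proj ?Z0 (orth_proj Z x)"
    have gZ: "g \<in> Z" "g \<in> ?Z0\<^sup>\<bottom>"
      using closed_subspace_orthogonal_decomp[OF Z0.closed_subspace_axioms Z Z0Z Z.orth_proj(1)]
      by (auto simp: g_def)
    have "g \<bullet> y = 0" if "y \<in> Y0" for y
      using gZ that Z.inner_orth_proj_left[OF gZ(1), of y] by (simp add: mem_orthogonal_comp_iff)
    then have "g \<in> ?G" using gZ by (simp add: mem_orthogonal_comp_iff)
    then have xg: "x \<bullet> g = 0" using x by (simp add: mem_orthogonal_comp_iff)
    have "g \<bullet> orth_proj ?Z0 (orth_proj Z x) = 0"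
      using orthogonal_compD[OF gZ(2) Z0.orth_proj(1)] .
    moreover have "g \<bullet> orth_proj Z x = 0" using Z.inner_orth_proj_left[OF gZ(1)] xg by (simp add: inner_commute)
    ultimately have "g \<bullet> g = 0" by (metis g_def inner_diff_right diff_self)
    then have "orth_proj Z x \<in> ?Z0" using Z0.orth_proj(1)[of "orth_proj Z x"] by (simp add: g_def)
    then obtain y where y: "y \<in> Y0" "orth_proj Z x = orth_proj Z y" by auto
    have 1: "x - y \<in> Y" using x y Y0(2) Y.sub by (auto intro: subspace_diff)
    have 2: "x - y \<in> Z\<^sup>\<bottom>" using Z.orth_proj(2)[of "x - y"] y(2) by (simp add: blinfun.diff_right)
    have "f (x - y) = x" using y(1) x by (simp add: f_def blinfun.diff_right Y0.orth_proj_id Y0.orth_proj_zero)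
    with 1 2 show ?thesis by blast
  qed
  have img: "f ` (Y \<inter> Z\<^sup>\<bottom>) = ?F \<inter> ?G\<^sup>\<bottom>" using im surj by auto
  have fd: "finite_dimensional (?F \<inter> ?G\<^sup>\<bottom>)" using finite_dimensional_subset[OF F Int_lower1] .
  have "finite_dimensional (Y \<inter> Z\<^sup>\<bottom>)"
    using finite_dimensional_injective(1)[OF lin sYZ inj im fd] .
  then have "dim (f ` (Y \<inter> Z\<^sup>\<bottom>)) = dim (Y \<inter> Z\<^sup>\<bottom>)"
    by (rule dim_injective_image[OF lin sYZ]) (rule inj)
  then have "dim (?F \<inter> ?G\<^sup>\<bottom>) = dim (Y \<inter> Z\<^sup>\<bottom>)" unfolding img .
  then show ?thesis using rel_dim_finite_dimensional[OF sF F sG G] GF by (simp add: rel_dim_def)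
qed

text \<open>
  Let \<open>z \<in> Z\<close> be orthogonal to \<open>B ` L\<close> and to \<open>Z \<inter> (A ` L)\<^sup>\<bottom>\<close>. The second condition gives
  \<open>z = A x\<close> with \<open>x \<in> L\<close>, and the first one \<open>\<parallel>z\<parallel>\<^sup>2 = \<langle>z, A x - B x\<rangle> \<le> (b/a) \<parallel>z\<parallel>\<^sup>2\<close>, whence
  \<open>z = 0\<close>.
\<close>

lemma orthogonal_comp_image_le:
  fixes A B :: "'a::{real_inner, complete_space} \<Rightarrow>\<^sub>L 'a"
  assumes Z: "closed_subspace Z" and L: "closed_subspace L" and A: "\<And>x. A x \<in> Z"
    and b: "b < a" "0 < a" "\<And>x. x \<in> L \<Longrightarrow> norm (A x) \<ge> a * norm x"
      "\<And>x. x \<in> L \<Longrightarrow> norm (A x - B x) \<le> b * norm x"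
    and fd: "finite_dimensional (Z \<inter> (A ` L)\<^sup>\<bottom>)"
  shows "finite_dimensional (Z \<inter> (B ` L)\<^sup>\<bottom>)" "dim (Z \<inter> (B ` L)\<^sup>\<bottom>) \<le> dim (Z \<inter> (A ` L)\<^sup>\<bottom>)"
proof -
  interpret Z: closed_subspace Z by fact
  interpret AL: closed_subspace "A ` L" using closed_subspace_image[OF L b(2,3)] .
  have ALZ: "A ` L \<subseteq> Z" using A by auto
  have s: "subspace (Z \<inter> (B ` L)\<^sup>\<bottom>)" "subspace (Z \<inter> (A ` L)\<^sup>\<bottom>)"
    using Z.sub subspace_orthogonal_comp by (auto intro!: subspace_inter)
  have *: "z = 0" if z: "z \<in> Z \<inter> (B ` L)\<^sup>\<bottom>" "z \<in> (Z \<inter> (A ` L)\<^sup>\<bottom>)\<^sup>\<bottom>" for z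
  proof -
    let ?p = "orth_proj (A ` L) z"
    have 1: "z - ?p \<in> Z \<inter> (A ` L)\<^sup>\<bottom>"
      using closed_subspace_orthogonal_decomp[OF AL.closed_subspace_axioms Z ALZ] z by simp
    have "z \<bullet> (z - ?p) = 0" using z(2) 1 by (simp add: mem_orthogonal_comp_iff)
    moreover have "?p \<bullet> (z - ?p) = 0"
      using AL.orth_proj[of z] by (auto simp: mem_orthogonal_comp_iff inner_commute)
    ultimately have "(z - ?p) \<bullet> (z - ?p) = 0" by (metis inner_diff_left diff_self)
    then have "z = ?p" by simp
    then obtain x where x: "x \<in> L" "z = A x" using AL.orth_proj(1)[of z] by auto
    have "z \<bullet> B x = 0" using z(1) x(1) by (auto simp: mem_orthogonal_comp_iff)
    then have "(norm z)\<^sup>2 = z \<bullet> (A x - B x)" using x(2) by (simp add: power2_norm_eq_inner inner_diff_right)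
    also have "\<dots> \<le> norm z * norm (A x - B x)" by (rule norm_cauchy_schwarz)
    also have "\<dots> \<le> norm z * (b * norm x)" using b(4)[OF x(1)] by (intro mult_left_mono) auto
    finally have le: "norm z * norm z \<le> norm z * (b * norm x)" by (simp add: power2_eq_square)
    show "z = 0"
    proof (rule ccontr)
      assume "z \<noteq> 0"
      then have "norm z \<le> b * norm x" using le by simp
      moreover have "a * norm x \<le> norm z" using b(3)[OF x(1)] x(2) by simp
      ultimately have "(a - b) * norm x \<le> 0" by (simp add: algebra_simps)
      then have "x = 0" using b(1) by (simp add: mult_le_0_iff)
      then show False using \<open>z \<noteq> 0\<close> x(2) by simp
    qed
  qed
  show "finite_dimensional (Z \<inter> (B ` L)\<^sup>\<bottom>)" "dim (Z \<inter> (B ` L)\<^sup>\<bottom>) \<le> dim (Z \<inter> (A ` L)\<^sup>\<bottom>)"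
    using finite_dimensional_transversal[OF s fd *] by auto
qed

lemma Int_orthogonal_comp_image_orth_proj:
  assumes "closed_subspace Z"
  shows "Z \<inter> (orth_proj Z ` L)\<^sup>\<bottom> = Z \<inter> L\<^sup>\<bottom>"
  using closed_subspace.inner_orth_proj_left[OF assms] by (auto simp: mem_orthogonal_comp_iff)

text \<open>
  A space \<open>X0\<close> that is nearly contained in both \<open>Y\<close> and \<open>Z\<close> has a codimension in each of them,
  and the relative dimension is the difference. To see this, move \<open>X0\<close> into \<open>Y\<close> by projection:
  the codimension in \<open>Y\<close> stays the same, and so does the codimension in \<open>Z\<close> because \<open>X0\<close> has
  moved only a little.
\<close>

lemma rel_dim_hub:
  fixes Y Z X0 :: "'a::{real_inner, complete_space} set"
  assumes Y: "closed_subspace Y" and Z: "closed_subspace Z" and X0: "closed_subspace X0"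
    and nY: "\<And>x. x \<in> X0 \<Longrightarrow> norm (x - orth_proj Y x) \<le> (1/4) * norm x"
    and nZ: "\<And>x. x \<in> X0 \<Longrightarrow> norm (x - orth_proj Z x) \<le> (1/4) * norm x"
    and F: "finite_dimensional (Y \<inter> X0\<^sup>\<bottom>)" and G: "finite_dimensional (Z \<inter> X0\<^sup>\<bottom>)"
  shows "rel_dim Y Z = int (dim (Y \<inter> X0\<^sup>\<bottom>)) - int (dim (Z \<inter> X0\<^sup>\<bottom>))"
proof -
  interpret Y: closed_subspace Y by fact
  interpret Z: closed_subspace Z by fact
  interpret X0: closed_subspace X0 by fact
  let ?A = "orth_proj Z" and ?B = "orth_proj Z o\<^sub>L orth_proj Y"
  \<comment> \<open>An error of \<open>1/4\<close> leaves the lower bounds \<open>3/4\<close> for \<open>?A\<close> and \<open>1/2\<close> for \<open>?B\<close>, both above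
    the distance \<open>1/4\<close> between \<open>?A\<close> and \<open>?B\<close>.\<close>
  have lY: "norm (orth_proj Y x) \<ge> (3/4) * norm x" if "x \<in> X0" for x
    using nY[OF that] norm_triangle_ineq2[of x "orth_proj Y x"] by linarith
  have lA: "norm (?A x) \<ge> (3/4) * norm x" if "x \<in> X0" for x
    using nZ[OF that] norm_triangle_ineq2[of x "orth_proj Z x"] by linarith
  have AB: "norm (?A x - ?B x) \<le> (1/4) * norm x" if "x \<in> X0" for x
    using nY[OF that] Z.norm_orth_proj_le[of "x - orth_proj Y x"] by (simp add: blinfun.diff_right)
  have lB: "norm (?B x) \<ge> (1/2) * norm x" if "x \<in> X0" for x
    using lA[OF that] AB[OF that] norm_triangle_ineq2[of "?A x" "?B x"] by linarith
  let ?Y0 = "orth_proj Y ` X0"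
  have Y0: "closed_subspace ?Y0" using closed_subspace_image[OF X0 _ lY] by simp
  have YY: "Y \<inter> ?Y0\<^sup>\<bottom> = Y \<inter> X0\<^sup>\<bottom>" by (rule Int_orthogonal_comp_image_orth_proj[OF Y])
  have ZA: "Z \<inter> (?A ` X0)\<^sup>\<bottom> = Z \<inter> X0\<^sup>\<bottom>" by (rule Int_orthogonal_comp_image_orth_proj[OF Z])
  have "?B ` X0 = orth_proj Z ` ?Y0" by (auto simp: image_iff)
  then have ZB: "Z \<inter> (?B ` X0)\<^sup>\<bottom> = Z \<inter> ?Y0\<^sup>\<bottom>" using Int_orthogonal_comp_image_orth_proj[OF Z] by metis
  have 1: "finite_dimensional (Z \<inter> (?B ` X0)\<^sup>\<bottom>)" "dim (Z \<inter> (?B ` X0)\<^sup>\<bottom>) \<le> dim (Z \<inter> (?A ` X0)\<^sup>\<bottom>)"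
    using orthogonal_comp_image_le[OF Z X0 _ _ _ lA AB] Z.orth_proj(1) G ZA by auto
  have "dim (Z \<inter> (?A ` X0)\<^sup>\<bottom>) \<le> dim (Z \<inter> (?B ` X0)\<^sup>\<bottom>)"
    using orthogonal_comp_image_le(2)[OF Z X0 _ _ _ lB, of "1/4" ?A] Z.orth_proj(1) AB 1(1)
    by (simp add: norm_minus_commute)
  then have dim: "dim (Z \<inter> ?Y0\<^sup>\<bottom>) = dim (Z \<inter> X0\<^sup>\<bottom>)" using 1(2) ZA ZB by simp
  have lZ: "norm (orth_proj Z y) \<ge> (1/2) * norm y" if y: "y \<in> ?Y0" for y
  proof -
    obtain x where x: "x \<in> X0" "y = orth_proj Y x" using y by auto
    then show ?thesis using lB[OF x(1)] Y.norm_orth_proj_le[of x] by simp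
  qed
  have "rel_dim Y Z = int (dim (Y \<inter> ?Y0\<^sup>\<bottom>)) - int (dim (Z \<inter> ?Y0\<^sup>\<bottom>))"
    by (rule rel_dim_bounded_below[OF Y Z Y0 _ _ _ _ lZ]) (use Y.orth_proj F YY 1(1) ZB in auto)
  then show ?thesis using dim YY by simp
qed

lemma commensurable_iff:
  "commensurable X Y \<longleftrightarrow> closed_subspace X \<and> closed_subspace Y \<and> compact_operator (orth_proj X - orth_proj Y)"
  by (auto simp: commensurable_def closed_subspace_def)

lemma commensurable_sym:
  fixes X Y :: "'a::{real_inner, complete_space} set"
  shows "commensurable X Y \<Longrightarrow> commensurable Y X"
  using compact_operator_uminus[of "orth_proj X - orth_proj Y"] by (auto simp: commensurable_iff)

lemma commensurable_trans:
  fixes X Y :: "'a::{real_inner, complete_space} set"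
  shows "commensurable X Y \<Longrightarrow> commensurable Y Z \<Longrightarrow> commensurable X Z"
  using compact_operator_add[of "orth_proj X - orth_proj Y" "orth_proj Y - orth_proj Z"]
  by (auto simp: commensurable_iff)

lemma self_adjoint_diff: "self_adjoint A \<Longrightarrow> self_adjoint B \<Longrightarrow> self_adjoint (A - B)"
  by (simp add: self_adjoint_def blinfun.diff_left inner_diff)

lemma finite_dimensional_Un:
  assumes "finite_dimensional X" "finite_dimensional Y"
  shows "finite_dimensional (span (X \<union> Y))"
proof -
  obtain F G where "finite F" "X \<subseteq> span F" "finite G" "Y \<subseteq> span G"
    using assms by (auto simp: finite_dimensional_def)
  moreover have "span (X \<union> Y) \<subseteq> span (F \<union> G)" if "X \<subseteq> span F" "Y \<subseteq> span G" for F G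
    using that span_mono[of F "F \<union> G"] span_mono[of G "F \<union> G"] by (intro span_minimal) auto
  ultimately show ?thesis unfolding finite_dimensional_def by (intro exI[of _ "F \<union> G"]) simp
qed

lemma orthogonal_comp_span: "(span S)\<^sup>\<bottom> = S\<^sup>\<bottom>"
proof
  show "(span S)\<^sup>\<bottom> \<subseteq> S\<^sup>\<bottom>" by (rule orthogonal_comp_anti_mono) (rule span_superset)
  show "S\<^sup>\<bottom> \<subseteq> (span S)\<^sup>\<bottom>"
  proof
    fix x assume "x \<in> S\<^sup>\<bottom>"
    then have "orthogonal x y" if "y \<in> span S" for y
      using orthogonal_to_span[OF that] by (simp add: mem_orthogonal_comp_iff orthogonal_def)
    then show "x \<in> (span S)\<^sup>\<bottom>" by (simp add: mem_orthogonal_comp_iff orthogonal_def)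
  qed
qed

text \<open>
  The compact operator \<open>P\<^bsub>X\<^esub> - P\<^bsub>Y\<^esub>\<close> is the identity on \<open>X \<inter> Y\<^sup>\<bottom>\<close>.
\<close>

lemma finite_dimensional_Int_orthogonal_comp:
  fixes X Y :: "'a::{real_inner, complete_space} set"
  assumes "commensurable X Y"
  shows "finite_dimensional (X \<inter> Y\<^sup>\<bottom>)"
proof -
  interpret X: closed_subspace X using assms by (simp add: commensurable_iff)
  interpret Y: closed_subspace Y using assms by (simp add: commensurable_iff)
  have "compact_operator (orth_proj X - orth_proj Y)" using assms by (simp add: commensurable_iff)
  then obtain G where G: "subspace G" "finite_dimensional G"
      "\<And>x. x \<in> G\<^sup>\<bottom> \<Longrightarrow> norm ((orth_proj X - orth_proj Y) x) \<le> (1/2) * norm x"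
    using compact_self_adjoint_small[of "orth_proj X - orth_proj Y" "1/2"]
      self_adjoint_diff[OF X.self_adjoint_orth_proj Y.self_adjoint_orth_proj] by auto
  show ?thesis
  proof (rule finite_dimensional_transversal(1)[OF _ G(1,2)])
    show "subspace (X \<inter> Y\<^sup>\<bottom>)" using X.sub subspace_orthogonal_comp by (intro subspace_inter)
    show "x = 0" if "x \<in> X \<inter> Y\<^sup>\<bottom>" "x \<in> G\<^sup>\<bottom>" for x
      using that G(3)[of x] by (simp add: blinfun.diff_left X.orth_proj_id Y.orth_proj_zero)
  qed
qed

text \<open>
  The vectors of \<open>X\<close> orthogonal to a sufficiently large finite-dimensional space \<open>G\<close> form a space
  \<open>X0\<close> that is nearly contained in \<open>X\<close>, \<open>Y\<close> and \<open>Z\<close>, since \<open>P\<^bsub>X\<^esub> - P\<^bsub>Y\<^esub>\<close> and \<open>P\<^bsub>X\<^esub> - P\<^bsub>Z\<^esub>\<close> are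
  small on \<open>G\<^sup>\<bottom>\<close>. With this common hub the three relative dimensions become differences of three
  numbers, and the sum telescopes.
\<close>

theorem rel_dim_add:
  fixes X Y Z :: "'a::{real_inner, complete_space} set"
  assumes XY: "commensurable X Y" and YZ: "commensurable Y Z"
  shows "rel_dim X Y + rel_dim Y Z = rel_dim X Z"
proof -
  have XZ: "commensurable X Z" using commensurable_trans[OF XY YZ] .
  interpret X: closed_subspace X using XY by (simp add: commensurable_iff)
  have small: "\<exists>G. subspace G \<and> finite_dimensional G \<and>
      (\<forall>x\<in>G\<^sup>\<bottom>. norm (orth_proj X x - orth_proj Y x) \<le> (1/4) * norm x)"
    if XY: "commensurable X Y" for Y
  proof -
    interpret Y: closed_subspace Y using XY by (simp add: commensurable_iff)
    have "compact_operator (orth_proj X - orth_proj Y)" using XY by (simp add: commensurable_iff)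
    then obtain G where "subspace G" "finite_dimensional G"
        "\<And>x. x \<in> G\<^sup>\<bottom> \<Longrightarrow> norm ((orth_proj X - orth_proj Y) x) \<le> (1/4) * norm x"
      by (rule compact_self_adjoint_small[where e="1/4"])
        (simp_all add: self_adjoint_diff X.self_adjoint_orth_proj Y.self_adjoint_orth_proj)
    then show ?thesis by (intro exI[of _ G]) (simp add: blinfun.diff_left)
  qed
  obtain G1 where G1: "subspace G1" "finite_dimensional G1"
      "\<And>x. x \<in> G1\<^sup>\<bottom> \<Longrightarrow> norm (orth_proj X x - orth_proj Y x) \<le> (1/4) * norm x"
    using small[OF XY] by blast
  obtain G2 where G2: "subspace G2" "finite_dimensional G2"
      "\<And>x. x \<in> G2\<^sup>\<bottom> \<Longrightarrow> norm (orth_proj X x - orth_proj Z x) \<le> (1/4) * norm x"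
    using small[OF XZ] by blast
  define G where "G = span (G1 \<union> G2)"
  have G: "finite_dimensional G" "G\<^sup>\<bottom> \<subseteq> G1\<^sup>\<bottom>" "G\<^sup>\<bottom> \<subseteq> G2\<^sup>\<bottom>"
    using finite_dimensional_Un[OF G1(2) G2(2)] unfolding G_def orthogonal_comp_span
    by (simp_all add: orthogonal_comp_anti_mono)
  define X0 where "X0 = X \<inter> G\<^sup>\<bottom>"
  have X0: "closed_subspace X0" unfolding X0_def
    by (intro closed_subspace_Int closed_subspace_orthogonal_comp X.closed_subspace_axioms)
  have F: "finite_dimensional (X \<inter> X0\<^sup>\<bottom>)"
  proof (rule finite_dimensional_transversal(1)[OF _ _ G(1)])
    show "subspace (X \<inter> X0\<^sup>\<bottom>)" using X.sub subspace_orthogonal_comp by (intro subspace_inter)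
    show "subspace G" by (simp add: G_def)
    show "x = 0" if "x \<in> X \<inter> X0\<^sup>\<bottom>" "x \<in> G\<^sup>\<bottom>" for x
    proof -
      have "x \<in> X0" using that by (simp add: X0_def)
      then show ?thesis using that orthogonal_comp_Int_self[of x X0] by blast
    qed
  qed
  have fd: "finite_dimensional (Y \<inter> X0\<^sup>\<bottom>)"
    if Y: "closed_subspace Y" and near: "\<And>x. x \<in> G\<^sup>\<bottom> \<Longrightarrow> norm (orth_proj X x - orth_proj Y x) \<le> (1/4) * norm x" for Y
  proof -
    interpret Y: closed_subspace Y by fact
    let ?H = "G \<union> X \<inter> X0\<^sup>\<bottom>"
    show ?thesis
    proof (rule finite_dimensional_transversal(1)[OF _ _ finite_dimensional_Un[OF G(1) F]])
      show "subspace (Y \<inter> X0\<^sup>\<bottom>)" using Y.sub subspace_orthogonal_comp by (intro subspace_inter)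
      fix y assume y: "y \<in> Y \<inter> X0\<^sup>\<bottom>" "y \<in> (span ?H)\<^sup>\<bottom>"
      have p: "orth_proj X y \<in> X \<inter> X0\<^sup>\<bottom>"
      proof -
        have "orth_proj X y \<bullet> x = 0" if "x \<in> X0" for x
        proof -
          have "orth_proj X y \<bullet> x = y \<bullet> x" using that by (intro X.inner_orth_proj_right) (simp add: X0_def)
          then show ?thesis using y(1) that orthogonal_compD[of y X0 x] by simp
        qed
        then show ?thesis using X.orth_proj(1) by (simp add: mem_orthogonal_comp_iff)
      qed
      have yH: "y \<in> ?H\<^sup>\<bottom>" using y(2) by (simp add: orthogonal_comp_span)
      then have "y \<bullet> orth_proj X y = 0" using p orthogonal_compD[of y ?H] by blast
      then have "orth_proj X y \<bullet> orth_proj X y = 0" using X.orth_proj_sym[of y "orth_proj X y"] by simp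
      then have "orth_proj X y = 0" by simp
      moreover have "y \<in> G\<^sup>\<bottom>" using yH orthogonal_comp_anti_mono[of G ?H] by blast
      ultimately show "y = 0" using near[of y] y(1) by (simp add: Y.orth_proj_id)
    qed simp
  qed
  have nX: "norm (x - orth_proj X x) \<le> (1/4) * norm x" if "x \<in> X0" for x
    using that by (simp add: X0_def X.orth_proj_id)
  have nY: "norm (x - orth_proj Y x) \<le> (1/4) * norm x" and nZ: "norm (x - orth_proj Z x) \<le> (1/4) * norm x"
    if "x \<in> X0" for x
  proof -
    have "x \<in> G1\<^sup>\<bottom>" "x \<in> G2\<^sup>\<bottom>" "orth_proj X x = x"
      using that G(2,3) X.orth_proj_id by (auto simp: X0_def)
    then show "norm (x - orth_proj Y x) \<le> (1/4) * norm x" "norm (x - orth_proj Z x) \<le> (1/4) * norm x"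
      using G1(3)[of x] G2(3)[of x] by simp_all
  qed
  have cl: "closed_subspace X" "closed_subspace Y" "closed_subspace Z"
    using XY YZ by (simp_all add: commensurable_iff)
  have fdY: "finite_dimensional (Y \<inter> X0\<^sup>\<bottom>)" by (rule fd[OF cl(2) G1(3)]) (use G(2) in auto)
  have fdZ: "finite_dimensional (Z \<inter> X0\<^sup>\<bottom>)" by (rule fd[OF cl(3) G2(3)]) (use G(3) in auto)
  have "rel_dim X Y = int (dim (X \<inter> X0\<^sup>\<bottom>)) - int (dim (Y \<inter> X0\<^sup>\<bottom>))"
    by (rule rel_dim_hub[OF cl(1,2) X0 nX nY F fdY])
  moreover have "rel_dim Y Z = int (dim (Y \<inter> X0\<^sup>\<bottom>)) - int (dim (Z \<inter> X0\<^sup>\<bottom>))"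
    by (rule rel_dim_hub[OF cl(2,3) X0 nY nZ fdY fdZ])
  moreover have "rel_dim X Z = int (dim (X \<inter> X0\<^sup>\<bottom>)) - int (dim (Z \<inter> X0\<^sup>\<bottom>))"
    by (rule rel_dim_hub[OF cl(1,3) X0 nX nZ F fdZ])
  ultimately show ?thesis by simp
qed

lemma commensurable_finite_extension:
  fixes X Y :: "'a::{real_inner, complete_space} set"
  assumes X: "closed_subspace X" and Y: "closed_subspace Y" and "X \<subseteq> Y" and fd: "finite_dimensional (Y \<inter> X\<^sup>\<bottom>)"
  shows "commensurable Y X" "rel_dim Y X = int (dim (Y \<inter> X\<^sup>\<bottom>))"
proof -
  interpret X: closed_subspace X by fact
  interpret Y: closed_subspace Y by fact
  have s: "subspace (Y \<inter> X\<^sup>\<bottom>)" using Y.sub subspace_orthogonal_comp by (intro subspace_inter)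
  have "(orth_proj Y - orth_proj X) x \<in> Y \<inter> X\<^sup>\<bottom>" for x
  proof -
    have "orth_proj X x = orth_proj X (orth_proj Y x)"
    proof (rule X.orth_proj_eqI)
      have "orth_proj Y x - orth_proj X (orth_proj Y x) \<in> X\<^sup>\<bottom>" by (rule X.orth_proj)
      moreover have "x - orth_proj Y x \<in> X\<^sup>\<bottom>"
        using Y.orth_proj(2)[of x] assms(3) by (auto simp: mem_orthogonal_comp_iff)
      ultimately have "(x - orth_proj Y x) + (orth_proj Y x - orth_proj X (orth_proj Y x)) \<in> X\<^sup>\<bottom>"
        using subspace_add[OF subspace_orthogonal_comp] by blast
      then show "x - orth_proj X (orth_proj Y x) \<in> X\<^sup>\<bottom>" by simp
    qed (rule X.orth_proj)
    then show ?thesis using closed_subspace_orthogonal_decomp[OF X Y assms(3) Y.orth_proj(1)]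
      by (simp add: blinfun.diff_left)
  qed
  then have "compact_operator (orth_proj Y - orth_proj X)" by (rule compact_operator_finite_rank[OF s fd])
  then show "commensurable Y X" using X Y by (simp add: commensurable_iff)
  have "X \<inter> Y\<^sup>\<bottom> \<subseteq> {0}" using assms(3) orthogonal_comp_Int_self by blast
  then have "dim (X \<inter> Y\<^sup>\<bottom>) = 0" using dim_subset_finite[OF finite_dimensional_zero, of "X \<inter> Y\<^sup>\<bottom>"] 
    by (metis dim_le_card card.empty empty_subsetI finite.emptyI le_zero_eq span_empty)
  then show "rel_dim Y X = int (dim (Y \<inter> X\<^sup>\<bottom>))" by (simp add: rel_dim_def)
qed

text \<open>
  A nonzero vector common to the negative space of one form and the positive space of the other
  would make the forms differ by at least \<open>2 c \<parallel>x\<parallel>\<^sup>2\<close> there.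
\<close>

lemma rel_dim_zero_of_close_forms:
  fixes A B :: "'a::real_inner \<Rightarrow>\<^sub>L 'a"
  assumes XW: "X \<subseteq> W" and YW: "Y \<subseteq> W"
    and "\<And>x. x \<in> X \<Longrightarrow> A x \<bullet> x \<le> - c * (x \<bullet> x)" "\<And>x. x \<in> W \<Longrightarrow> x \<in> X\<^sup>\<bottom> \<Longrightarrow> A x \<bullet> x \<ge> c * (x \<bullet> x)"
    and "\<And>x. x \<in> Y \<Longrightarrow> B x \<bullet> x \<le> - c * (x \<bullet> x)" "\<And>x. x \<in> W \<Longrightarrow> x \<in> Y\<^sup>\<bottom> \<Longrightarrow> B x \<bullet> x \<ge> c * (x \<bullet> x)"
    and AB: "norm (A - B) < 2 * c"
  shows "rel_dim X Y = 0"
proof -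
  have D: "\<bar>(A - B) x \<bullet> x\<bar> < 2 * c * (x \<bullet> x)" if "x \<noteq> 0" for x
  proof -
    have "\<bar>(A - B) x \<bullet> x\<bar> \<le> norm ((A - B) x) * norm x" by (rule Cauchy_Schwarz_ineq2)
    also have "\<dots> \<le> norm (A - B) * norm x * norm x" by (intro mult_right_mono norm_blinfun) auto
    also have "\<dots> = norm (A - B) * (x \<bullet> x)" by (simp add: dot_square_norm power2_eq_square)
    also have "\<dots> < 2 * c * (x \<bullet> x)" using AB that by (intro mult_strict_right_mono) auto
    finally show ?thesis .
  qed
  have "x = 0" if "x \<in> X \<inter> Y\<^sup>\<bottom>" for x
  proof (rule ccontr)
    assume "x \<noteq> 0"
    with D[of x] assms(3)[of x] assms(6)[of x] that XW show False
      by (auto simp: blinfun.diff_left inner_diff_left)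
  qed
  moreover have "x = 0" if "x \<in> Y \<inter> X\<^sup>\<bottom>" for x
  proof (rule ccontr)
    assume "x \<noteq> 0"
    with D[of x] assms(4)[of x] assms(5)[of x] that YW show False
      by (auto simp: blinfun.diff_left inner_diff_left)
  qed
  ultimately have "X \<inter> Y\<^sup>\<bottom> \<subseteq> span {}" "Y \<inter> X\<^sup>\<bottom> \<subseteq> span {}" by auto
  then have "dim (X \<inter> Y\<^sup>\<bottom>) = 0" "dim (Y \<inter> X\<^sup>\<bottom>) = 0"
    by (metis dim_le_card card.empty finite.emptyI le_zero_eq)+
  then show ?thesis by (simp add: rel_dim_def)
qed

section \<open>The operator of a form\<close>

lemma riesz_representation:
  fixes f :: "'a::{real_inner, complete_space} \<Rightarrow>\<^sub>L real"
  obtains z where "\<And>x. f x = z \<bullet> x"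
proof (cases "\<forall>x. f x = 0")
  case True
  then show ?thesis using that[of 0] by simp
next
  case False
  then obtain u where u: "f u \<noteq> 0" by blast
  let ?N = "{x. f x = 0}"
  interpret closed_subspace ?N
  proof
    show "subspace ?N" by (auto simp: subspace_def blinfun.add_right blinfun.scaleR_right)
    show "closed ?N" by (intro closed_Collect_eq continuous_intros)
  qed
  \<comment> \<open>The representing vector is a multiple of any nonzero normal of the kernel.\<close>
  define v where "v = u - orth_proj ?N u"
  have v: "v \<in> ?N\<^sup>\<bottom>" "f v = f u" using orth_proj[of u] by (auto simp: v_def blinfun.diff_right)
  have v0: "v \<bullet> v \<noteq> 0" using v u by (metis blinfun.zero_right inner_eq_zero_iff)
  have "f x = ((f v / (v \<bullet> v)) *\<^sub>R v) \<bullet> x" for x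
  proof -
    have "x - (f x / f v) *\<^sub>R v \<in> ?N" using u v(2) by (simp add: blinfun.diff_right blinfun.scaleR_right)
    then have "v \<bullet> (x - (f x / f v) *\<^sub>R v) = 0" using v(1) by (auto simp: mem_orthogonal_comp_iff)
    then have "v \<bullet> x = f x / f v * (v \<bullet> v)" by (simp add: inner_diff_right)
    then show ?thesis using v0 u v(2) by simp
  qed
  then show ?thesis using that by blast
qed

lemma form_representation:
  fixes B :: "'a::{real_inner, complete_space} \<Rightarrow>\<^sub>L 'a \<Rightarrow>\<^sub>L real"
  obtains A :: "'a \<Rightarrow>\<^sub>L 'a" where "\<And>x y. A x \<bullet> y = B x y"
proof -
  have "\<exists>z. \<forall>y. B x y = z \<bullet> y" for x using riesz_representation[of "B x"] by metis
  then obtain a where a: "\<And>x y. B x y = a x \<bullet> y" by metis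
  have eqI: "u = v" if "\<And>y. u \<bullet> y = v \<bullet> y" for u v :: 'a
  proof -
    have "(u - v) \<bullet> (u - v) = 0" using that[of "u - v"] by (simp add: inner_diff_left)
    then show ?thesis by simp
  qed
  have "bounded_linear a"
  proof (rule bounded_linear_intro[where K="norm B"])
    show "a (x + y) = a x + a y" for x y
      by (rule eqI) (simp add: a[symmetric] inner_add_left blinfun.add_left blinfun.add_right)
    show "a (r *\<^sub>R x) = r *\<^sub>R a x" for r x
      by (rule eqI) (simp add: a[symmetric] blinfun.scaleR_left blinfun.scaleR_right)
    show "norm (a x) \<le> norm x * norm B" for x
    proof -
      have "norm (a x) * norm (a x) = B x (a x)" by (simp add: a dot_square_norm power2_eq_square)
      also have "\<dots> \<le> norm (B x) * norm (a x)" using norm_blinfun[of "B x" "a x"] by simp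
      also have "\<dots> \<le> norm B * norm x * norm (a x)" by (intro mult_right_mono norm_blinfun) auto
      finally show ?thesis by (cases "a x = 0") (auto simp: mult.commute)
    qed
  qed
  then show ?thesis using that[of "Blinfun a"] a by (simp add: bounded_linear_Blinfun_apply)
qed

context closed_subspace begin

lemma form_operator_eqI:
  fixes B :: "'a \<Rightarrow>\<^sub>L 'a \<Rightarrow>\<^sub>L real"
  assumes "operator_on W A" "\<And>x y. x \<in> W \<Longrightarrow> y \<in> W \<Longrightarrow> A x \<bullet> y = B x y"
  shows "form_operator W B = A"
  unfolding form_operator_def
proof (rule the_equality)
  show "operator_on W A \<and> (\<forall>x\<in>W. \<forall>y\<in>W. B x y = A x \<bullet> y)" using assms by simp
  fix A' :: "'a \<Rightarrow>\<^sub>L 'a" assume A': "operator_on W A' \<and> (\<forall>x\<in>W. \<forall>y\<in>W. B x y = A' x \<bullet> y)"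
  show "A' = A"
  proof (rule blinfun_eqI)
    fix x
    let ?p = "orth_proj W x"
    have z: "A' (x - ?p) = 0" "A (x - ?p) = 0"
      using A' assms(1) orth_proj(2)[of x] by (auto simp: operator_on_def)
    have W: "A' ?p \<in> W" "A ?p \<in> W" using A' assms(1) orth_proj(1)[of x] by (auto simp: operator_on_def)
    then have "A' ?p - A ?p \<in> W" using sub by (intro subspace_diff)
    then have "(A' ?p - A ?p) \<bullet> (A' ?p - A ?p) = 0"
      using A' assms(2)[OF orth_proj(1)] orth_proj(1)[of x] by (simp add: inner_diff_left)
    then show "A' x = A x" using z by (simp add: blinfun.diff_right)
  qed
qed

end

lemma form_operator_UNIV:
  fixes B :: "'a::{real_inner, complete_space} \<Rightarrow>\<^sub>L 'a \<Rightarrow>\<^sub>L real"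
  shows "form_operator UNIV B x \<bullet> y = B x y"
proof -
  interpret closed_subspace "UNIV :: 'a set" by (rule closed_subspace_UNIV)
  obtain A :: "'a \<Rightarrow>\<^sub>L 'a" where A: "\<And>x y. A x \<bullet> y = B x y" using form_representation by blast
  have "form_operator UNIV B = A" by (rule form_operator_eqI) (auto simp: operator_on_def A)
  then show ?thesis using A by simp
qed

lemma (in closed_subspace) form_operator_compression:
  "form_operator W B = orth_proj W o\<^sub>L form_operator UNIV B o\<^sub>L orth_proj W"
proof (rule form_operator_eqI)
  show "operator_on W (orth_proj W o\<^sub>L form_operator UNIV B o\<^sub>L orth_proj W)"
    by (simp add: operator_on_def orth_proj orth_proj_zero)
  show "(orth_proj W o\<^sub>L form_operator UNIV B o\<^sub>L orth_proj W) x \<bullet> y = B x y" if "x \<in> W" "y \<in> W" for x y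
    using that by (simp add: orth_proj_id inner_orth_proj_right form_operator_UNIV)
qed

lemma norm_form_operator_diff_le:
  fixes B C :: "'a::{real_inner, complete_space} \<Rightarrow>\<^sub>L 'a \<Rightarrow>\<^sub>L real"
  shows "norm (form_operator UNIV B - form_operator UNIV C) \<le> norm (B - C)"
proof (rule norm_blinfun_bound)
  fix x
  let ?d = "(form_operator UNIV B - form_operator UNIV C) x"
  have "norm ?d * norm ?d = ?d \<bullet> ?d" by (simp add: dot_square_norm power2_eq_square)
  also have "\<dots> = (B - C) x ?d" by (simp add: blinfun.diff_left inner_diff_left form_operator_UNIV)
  also have "\<dots> \<le> norm ((B - C) x) * norm ?d" using norm_blinfun[of "(B - C) x" ?d] by simp
  also have "\<dots> \<le> norm (B - C) * norm x * norm ?d" by (intro mult_right_mono norm_blinfun) auto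
  finally show "norm ?d \<le> norm (B - C) * norm x" by (cases "?d = 0") auto
qed simp



section \<open>Diagonalisation of essential symmetries\<close>

text \<open>
  Let \<open>M = \<parallel>D\<parallel>\<close>. Unit vectors \<open>y\<close> with \<open>\<parallel>D y\<parallel> \<rightarrow> M\<close> satisfy \<open>D\<^sup>2 y - M\<^sup>2 y \<rightarrow> 0\<close>. By compactness
  a subsequence converges, and its limit \<open>x\<close> is an eigenvector of \<open>D\<^sup>2\<close> for \<open>M\<^sup>2\<close>. Either \<open>x\<close> is
  an eigenvector of \<open>D\<close> for \<open>- M\<close>, or \<open>D x + M x\<close> is one for \<open>M\<close>.
\<close>

lemma compact_self_adjoint_eigenvector:
  fixes D :: "'a::{real_inner, complete_space} \<Rightarrow>\<^sub>L 'a"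
  assumes "compact_operator D" "self_adjoint D" "D \<noteq> 0"
  obtains x m where "x \<noteq> 0" "m \<noteq> 0" "D x = m *\<^sub>R x"
proof -
  define M where "M = norm D"
  have M: "M > 0" using assms(3) by (simp add: M_def)
  \<comment> \<open>Each \<open>b n\<close> is below the operator norm and so is exceeded by some unit vector.\<close>
  define b where "b n = M * (1 - inverse (real (Suc n)))" for n
  have b: "0 \<le> b n" "b n < M" for n
    using M by (auto simp: b_def field_simps)
  have blim: "b \<longlonglongrightarrow> M"
  proof -
    have "(\<lambda>n. M * (1 - inverse (real (Suc n)))) \<longlonglongrightarrow> M * (1 - 0)"
      by (intro tendsto_intros LIMSEQ_inverse_real_of_nat)
    then show ?thesis by (simp add: b_def[abs_def])
  qed
  have "\<exists>y. norm y = 1 \<and> b n \<le> norm (D y)" for n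
  proof -
    have "\<not> (\<forall>x. norm (D x) \<le> b n * norm x)"
    proof
      assume "\<forall>x. norm (D x) \<le> b n * norm x"
      then have "norm D \<le> b n" using b(1) by (intro norm_blinfun_bound) auto
      then show False using b(2)[of n] by (simp add: M_def)
    qed
    then obtain x where x: "norm (D x) > b n * norm x" by (auto simp: not_le)
    then have "x \<noteq> 0" by auto
    then show ?thesis using x
      by (intro exI[of _ "(1 / norm x) *\<^sub>R x"]) (auto simp: blinfun.scaleR_right field_simps)
  qed
  then obtain y where y: "\<And>n. norm (y n) = 1" "\<And>n. b n \<le> norm (D (y n))" by metis
  have Dle: "norm (D z) \<le> M * norm z" for z using norm_blinfun[of D z] by (simp add: M_def)
  have nlim: "(\<lambda>n. norm (D (y n))) \<longlonglongrightarrow> M"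
    by (rule tendsto_sandwich[OF _ _ blim tendsto_const])
      (use y Dle[of "y _"] in auto)
  have ineq: "(norm (D (D (y n)) - M\<^sup>2 *\<^sub>R y n))\<^sup>2 \<le> M\<^sup>2 * (M\<^sup>2 - (norm (D (y n)))\<^sup>2)" for n
  proof -
    have "(norm (D (D (y n)) - M\<^sup>2 *\<^sub>R y n))\<^sup>2
        = (norm (D (D (y n))))\<^sup>2 - 2 * M\<^sup>2 * (D (D (y n)) \<bullet> y n) + M\<^sup>2 * M\<^sup>2 * (norm (y n))\<^sup>2"
      unfolding power2_norm_eq_inner by (simp add: inner_diff inner_commute algebra_simps)
    also have "D (D (y n)) \<bullet> y n = (norm (D (y n)))\<^sup>2"
      using assms(2) by (simp add: self_adjoint_def power2_norm_eq_inner)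
    also have "(norm (D (D (y n))))\<^sup>2 \<le> M\<^sup>2 * (norm (D (y n)))\<^sup>2"
      using power_mono[OF Dle[of "D (y n)"], of 2] by (simp add: power_mult_distrib)
    finally show ?thesis using y(1)[of n] by (simp add: algebra_simps)
  qed
  have "(\<lambda>n. M\<^sup>2 * (M\<^sup>2 - (norm (D (y n)))\<^sup>2)) \<longlonglongrightarrow> M\<^sup>2 * (M\<^sup>2 - M\<^sup>2)" by (intro tendsto_intros nlim)
  then have "(\<lambda>n. M\<^sup>2 * (M\<^sup>2 - (norm (D (y n)))\<^sup>2)) \<longlonglongrightarrow> 0" by simp
  then have "(\<lambda>n. (norm (D (D (y n)) - M\<^sup>2 *\<^sub>R y n))\<^sup>2) \<longlonglongrightarrow> 0"
    by (rule Lim_null_comparison[rotated]) (use ineq in \<open>simp add: always_eventually\<close>)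
  then have "(\<lambda>n. sqrt ((norm (D (D (y n)) - M\<^sup>2 *\<^sub>R y n))\<^sup>2)) \<longlonglongrightarrow> sqrt 0"
    by (rule tendsto_real_sqrt)
  then have lim0: "(\<lambda>n. D (D (y n)) - M\<^sup>2 *\<^sub>R y n) \<longlonglongrightarrow> 0"
    by (simp add: tendsto_norm_zero_iff)
  have "norm (y n) \<le> 1" for n using y(1) by simp
  then obtain r where r: "strict_mono (r::nat\<Rightarrow>nat)" "convergent (\<lambda>n. D (y (r n)))"
    by (rule compact_operatorE[where x=y, OF assms(1)])
  then obtain z where z: "(\<lambda>n. D (y (r n))) \<longlonglongrightarrow> z" by (auto simp: convergent_def)
  have lim0r: "(\<lambda>n. D (D (y (r n))) - M\<^sup>2 *\<^sub>R y (r n)) \<longlonglongrightarrow> 0"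
    using LIMSEQ_subseq_LIMSEQ[OF lim0 r(1)] by (simp add: o_def)
  have Dz: "(\<lambda>n. D (D (y (r n)))) \<longlonglongrightarrow> D z" by (intro tendsto_intros z)
  have "(\<lambda>n. (1 / M\<^sup>2) *\<^sub>R (D (D (y (r n))) - (D (D (y (r n))) - M\<^sup>2 *\<^sub>R y (r n)))) \<longlonglongrightarrow> (1 / M\<^sup>2) *\<^sub>R (D z - 0)"
    by (intro tendsto_intros Dz lim0r)
  then have yl: "(\<lambda>n. y (r n)) \<longlonglongrightarrow> (1 / M\<^sup>2) *\<^sub>R D z" (is "_ \<longlonglongrightarrow> ?x") using M by simp
  have "(\<lambda>n. norm (y (r n))) \<longlonglongrightarrow> norm ?x" by (intro tendsto_intros yl)
  then have "(\<lambda>n. 1) \<longlonglongrightarrow> norm ?x" unfolding y(1) .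
  then have "norm ?x = 1" by (rule LIMSEQ_unique) (rule tendsto_const)
  then have x0: "?x \<noteq> 0" by auto
  have "(\<lambda>n. D (D (y (r n))) - M\<^sup>2 *\<^sub>R y (r n)) \<longlonglongrightarrow> D (D ?x) - M\<^sup>2 *\<^sub>R ?x" by (intro tendsto_intros yl)
  then have "D (D ?x) - M\<^sup>2 *\<^sub>R ?x = 0" using lim0r by (rule LIMSEQ_unique)
  then have DDx: "D (D ?x) = M\<^sup>2 *\<^sub>R ?x" by (simp only: right_minus_eq)
  show ?thesis
  proof (cases "D ?x = (- M) *\<^sub>R ?x")
    case True
    then show ?thesis using that[of ?x "- M"] x0 M by simp
  next
    case False
    let ?w = "D ?x + M *\<^sub>R ?x"
    have "?w \<noteq> 0" using False by (simp add: eq_neg_iff_add_eq_0)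
    moreover have "D ?w = M *\<^sub>R ?w"
      using DDx by (simp add: blinfun.add_right blinfun.scaleR_right scaleR_add_right power2_eq_square)
    ultimately show ?thesis using that[of ?w M] M by simp
  qed
qed

text \<open>
  Symmetries modulo compact operators. The operators \<open>\<JJ> + K\<close> are of this kind, and so are their
  compressions to closed subspaces of finite codimension, although a compression of \<open>\<JJ>\<close> itself
  need not be a symmetry.
\<close>

definition essential_symmetry :: "'a::{real_inner, complete_space} set \<Rightarrow> ('a \<Rightarrow>\<^sub>L 'a) \<Rightarrow> bool" where
  "essential_symmetry W A \<longleftrightarrow> closed_subspace W \<and> operator_on W A \<and> self_adjoint A \<and>
     compact_operator ((A o\<^sub>L A) - orth_proj W)"

text \<open>
  The eigenbasis is a sequence in which zero vectors may occur, so that finite and infinite bases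
  are treated alike. The number \<open>l n\<close> is meaningful only if \<open>e n \<noteq> 0\<close>, and statements about the
  eigenvalues are restricted accordingly.
\<close>

locale diagonal_operator = closed_subspace W for W :: "'a::{real_inner, complete_space} set" +
  fixes A :: "'a \<Rightarrow>\<^sub>L 'a" and e :: "nat \<Rightarrow> 'a" and l :: "nat \<Rightarrow> real"
  assumes on: "operator_on W A" and sa: "self_adjoint A"
    and eW: "\<And>n. e n \<in> W" and eig: "\<And>n. A (e n) = l n *\<^sub>R e n"
    and unit: "\<And>n. e n = 0 \<or> norm (e n) = 1"
    and ortho: "\<And>i j. i \<noteq> j \<Longrightarrow> e i \<bullet> e j = 0"
    and complete: "\<And>x. x \<in> W \<Longrightarrow> (\<And>n. x \<bullet> e n = 0) \<Longrightarrow> x = 0"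

text \<open>
  Orthonormal vectors have distance \<open>\<surd>2\<close>, so the balls of radius \<open>1/2\<close> around them contain
  different points of a countable dense set.
\<close>

lemma countable_orthonormal:
  fixes X :: "'a::{real_inner, second_countable_topology} set"
  assumes "pairwise orthogonal X" "\<And>x. x \<in> X \<Longrightarrow> norm x = 1"
  shows "countable X"
proof -
  obtain D :: "'a set" where D: "countable D" "\<And>U. open U \<Longrightarrow> U \<noteq> {} \<Longrightarrow> \<exists>d\<in>D. d \<in> U"
    using countable_dense_setE by blast
  have "\<exists>d\<in>D. d \<in> ball x (1/2)" for x :: 'a by (rule D(2)) auto
  then obtain f where f: "\<And>x. f x \<in> D" "\<And>x. dist x (f x) < 1/2" by (metis mem_ball)
  have "inj_on f X"
  proof (rule inj_onI, rule ccontr)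
    fix x y assume xy: "x \<in> X" "y \<in> X" "f x = f y" "x \<noteq> y"
    have "dist x y < 1" using f(2)[of x] f(2)[of y] xy(3) dist_triangle2[of x y "f x"] by simp
    then have "(norm (x - y))\<^sup>2 < 1" by (simp add: dist_norm power_less_one_iff)
    moreover have "(norm (x - y))\<^sup>2 = 2"
      using xy assms(1) assms(2)[OF xy(1)] assms(2)[OF xy(2)]
      by (auto simp: norm_eq_1 power2_norm_eq_inner inner_diff pairwise_def orthogonal_def inner_commute)
    ultimately show False by simp
  qed
  moreover have "f ` X \<subseteq> D" using f(1) by auto
  ultimately show ?thesis using D(1) countable_image_inj_on countable_subset by metis
qed

lemma self_adjointD: "self_adjoint A \<Longrightarrow> A x \<bullet> y = x \<bullet> A y"
  by (simp add: self_adjoint_def)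

text \<open>
  The operator \<open>A\<^sup>2\<close> has an eigenvector \<open>x\<close> in \<open>U\<close>: any vector if \<open>A\<^sup>2 - I\<close> vanishes on \<open>U\<close>, and
  an eigenvector of this compact operator otherwise. From \<open>A\<^sup>2 x = s\<^sup>2 x\<close> it follows that \<open>x\<close> or
  \<open>A x + s x\<close> is an eigenvector of \<open>A\<close>.
\<close>

lemma essential_symmetry_eigenvector:
  fixes A :: "'a::{real_inner, complete_space} \<Rightarrow>\<^sub>L 'a"
  assumes A: "essential_symmetry W A" and U: "closed_subspace U" "U \<subseteq> W" and inv: "\<And>x. x \<in> U \<Longrightarrow> A x \<in> U"
    and u: "u \<in> U" "u \<noteq> 0"
  obtains x s where "x \<in> U" "x \<noteq> 0" "A x = s *\<^sub>R x"
proof -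
  interpret W: closed_subspace W using A by (simp add: essential_symmetry_def)
  interpret U: closed_subspace U by fact
  have sa: "self_adjoint A" using A by (simp add: essential_symmetry_def)
  note found = that
  have key: thesis if x: "x \<in> U" "x \<noteq> 0" "A (A x) = (s * s) *\<^sub>R x" for x s
  proof (cases "A x = (- s) *\<^sub>R x")
    case True
    then show thesis using found[of x "- s"] x(1,2) by blast
  next
    case False
    let ?y = "A x + s *\<^sub>R x"
    have "?y \<in> U" using x(1) inv U.sub by (intro subspace_add subspace_scale) auto
    moreover have "?y \<noteq> 0" using False by (simp add: eq_neg_iff_add_eq_0)
    moreover have "A ?y = s *\<^sub>R ?y"
      using x(3) by (simp add: blinfun.add_right blinfun.scaleR_right scaleR_add_right)
    ultimately show thesis using found[of ?y s] by blast
  qed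
  define C where "C = (A o\<^sub>L A) - orth_proj W"
  define D where "D = C o\<^sub>L orth_proj U"
  have CU: "C x = A (A x) - x" if "x \<in> U" for x
    using that U(2) by (auto simp: C_def blinfun.diff_left W.orth_proj_id)
  show thesis
  proof (cases "D = 0")
    case True
    have "D u = A (A u) - u" using u CU by (simp add: D_def U.orth_proj_id)
    then show thesis using key[of u 1] u True by simp
  next
    case False
    have DU: "D x \<in> U" for x
      using CU[OF U.orth_proj(1)] inv U.orth_proj(1) U.sub by (simp add: D_def subspace_diff)
    have "self_adjoint D" unfolding self_adjoint_def
    proof (intro allI)
      fix x y
      have "D x \<bullet> y = D x \<bullet> orth_proj U y" using U.inner_orth_proj_left[OF DU] by simp
      also have "\<dots> = orth_proj U x \<bullet> (A (A (orth_proj U y)) - orth_proj U y)"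
        by (simp add: D_def CU U.orth_proj(1) self_adjointD[OF sa] inner_diff)
      also have "\<dots> = orth_proj U x \<bullet> D y" by (simp add: D_def CU U.orth_proj(1))
      also have "\<dots> = x \<bullet> D y" using U.inner_orth_proj_right[OF DU] by simp
      finally show "D x \<bullet> y = x \<bullet> D y" .
    qed
    moreover have "compact_operator D"
      using A unfolding D_def C_def essential_symmetry_def by (intro compact_operator_compose_right) simp
    ultimately obtain x m where x: "x \<noteq> 0" "m \<noteq> 0" "D x = m *\<^sub>R x"
      using compact_self_adjoint_eigenvector False by metis
    have "(1/m) *\<^sub>R D x \<in> U" using DU U.sub by (intro subspace_scale)
    then have xU: "x \<in> U" using x by simp
    then have AA: "A (A x) = (1 + m) *\<^sub>R x" using x CU by (simp add: D_def U.orth_proj_id algebra_simps)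
    have "(1 + m) * (x \<bullet> x) = A x \<bullet> A x" using AA self_adjointD[OF sa, of x "A x"]
      by (metis inner_commute inner_scaleR_left)
    then have "(1 + m) * (x \<bullet> x) \<ge> 0" by simp
    moreover have "x \<bullet> x > 0" using x(1) by simp
    ultimately have "1 + m \<ge> 0" using mult_neg_pos[of "1 + m" "x \<bullet> x"] by linarith
    then show thesis using key[of x "sqrt (1 + m)"] x(1) xU AA by simp
  qed
qed

text \<open>
  Take a maximal orthonormal set of eigenvectors. Its orthogonal complement in \<open>W\<close> is invariant
  under \<open>A\<close>, so if it were nonzero, it would contain a further eigenvector. Separability makes the
  set countable.
\<close>

theorem essential_symmetry_diagonal:
  fixes A :: "'a::{real_inner, complete_space, second_countable_topology} \<Rightarrow>\<^sub>L 'a"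
  assumes A: "essential_symmetry W A"
  obtains e l where "diagonal_operator W A e l"
proof -
  interpret W: closed_subspace W using A by (simp add: essential_symmetry_def)
  have sa: "self_adjoint A" and on: "operator_on W A" using A by (simp_all add: essential_symmetry_def)
  define \<A> where "\<A> = {X. X \<subseteq> {x \<in> W. norm x = 1 \<and> (\<exists>s. A x = s *\<^sub>R x)} \<and> pairwise orthogonal X}"
  have "\<exists>M\<in>\<A>. \<forall>X\<in>\<A>. M \<subseteq> X \<longrightarrow> X = M"
  proof (rule subset_Zorn')
    fix C assume C: "subset.chain \<A> C"
    have "pairwise orthogonal (\<Union>C)" unfolding pairwise_def
    proof (intro ballI impI)
      fix x y assume "x \<in> \<Union>C" "y \<in> \<Union>C" and ne: "x \<noteq> y"
      then obtain X Y where XY: "X \<in> C" "x \<in> X" "Y \<in> C" "y \<in> Y" by blast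
      then have "X \<subseteq> Y \<or> Y \<subseteq> X" using C by (auto simp: subset.chain_def)
      moreover have "pairwise orthogonal X" "pairwise orthogonal Y"
        using XY C by (auto simp: subset.chain_def \<A>_def)
      ultimately show "orthogonal x y" using XY ne by (auto simp: pairwise_def)
    qed
    then show "\<Union>C \<in> \<A>" using C by (auto simp: subset.chain_def \<A>_def)
  qed
  then obtain X where X: "X \<in> \<A>" "\<And>Y. Y \<in> \<A> \<Longrightarrow> X \<subseteq> Y \<Longrightarrow> Y = X" by blast
  have XW: "\<And>x. x \<in> X \<Longrightarrow> x \<in> W" "\<And>x. x \<in> X \<Longrightarrow> norm x = 1" "\<And>x. x \<in> X \<Longrightarrow> \<exists>s. A x = s *\<^sub>R x"
    and po: "pairwise orthogonal X" using X(1) by (auto simp: \<A>_def)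
  have cX: "countable X" using countable_orthonormal[OF po XW(2)] .
  have complete: "x = 0" if x: "x \<in> W" "\<And>y. y \<in> X \<Longrightarrow> x \<bullet> y = 0" for x
  proof (rule ccontr)
    assume "x \<noteq> 0"
    let ?U = "W \<inter> X\<^sup>\<bottom>"
    have U: "closed_subspace ?U"
      by (intro closed_subspace_Int W.closed_subspace_axioms closed_subspace_orthogonal_comp)
    have inv: "A y \<in> ?U" if y: "y \<in> ?U" for y
    proof -
      have "A y \<bullet> z = 0" if "z \<in> X" for z
        using XW(3)[OF that] y that self_adjointD[OF sa, of y z] orthogonal_compD[of y X z] by auto
      then show ?thesis using y on by (simp add: operator_on_def mem_orthogonal_comp_iff)
    qed
    have "x \<in> ?U" using x by (simp add: mem_orthogonal_comp_iff)
    then obtain v s where v: "v \<in> ?U" "v \<noteq> 0" "A v = s *\<^sub>R v"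
      using essential_symmetry_eigenvector[OF A U _ inv _ \<open>x \<noteq> 0\<close>] by blast
    let ?v = "(1 / norm v) *\<^sub>R v"
    have v': "?v \<in> ?U" using v(1) U by (metis closed_subspace_def subspace_scale)
    have nv: "norm ?v = 1" using v(2) by simp
    have "insert ?v X \<in> \<A>"
    proof -
      have "orthogonal ?v y" "orthogonal y ?v" if "y \<in> X" for y
        using orthogonal_compD[of ?v X y] v' that by (auto simp: orthogonal_def inner_commute)
      moreover have "A ?v = s *\<^sub>R ?v" using v(3) by (simp add: blinfun.scaleR_right)
      ultimately show ?thesis using X(1) v' nv by (auto simp: \<A>_def pairwise_insert)
    qed
    then have "?v \<in> X" using X(2)[of "insert ?v X"] by blast
    then have "?v \<bullet> ?v = 0" using v' orthogonal_compD[of ?v X ?v] by blast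
    then show False using nv by (simp add: norm_eq_1)
  qed
  \<comment> \<open>Indices outside the enumeration of \<open>X\<close> carry the zero vector.\<close>
  define e where "e n = (if n \<in> to_nat_on X ` X then from_nat_into X n else 0)" for n
  have e: "e n = 0 \<or> e n \<in> X" for n by (auto simp: e_def cX)
  have "\<exists>s. A (e n) = s *\<^sub>R e n" for n using e[of n] XW(3) by auto
  then obtain l where l: "\<And>n. A (e n) = l n *\<^sub>R e n" by metis
  have "diagonal_operator W A e l"
  proof
    show "operator_on W A" "self_adjoint A" by fact+
    show "e n \<in> W" for n using e[of n] XW(1) W.sub subspace_0 by auto
    show "A (e n) = l n *\<^sub>R e n" for n by (rule l)
    show "e n = 0 \<or> norm (e n) = 1" for n using e[of n] XW(2) by auto
    show "e i \<bullet> e j = 0" if "i \<noteq> j" for i j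
      using that po by (auto simp: e_def cX pairwise_def orthogonal_def)
    show "x = 0" if "x \<in> W" "\<And>n. x \<bullet> e n = 0" for x
    proof (rule complete[OF that(1)])
      fix y assume "y \<in> X"
      then have "e (to_nat_on X y) = y" by (simp add: e_def cX)
      then show "x \<bullet> y = 0" using that(2)[of "to_nat_on X y"] by simp
    qed
  qed
  then show ?thesis using that by blast
qed

section \<open>Spectral subspaces of a diagonal operator\<close>

context diagonal_operator begin

lemma op_mem: "x \<in> W \<Longrightarrow> A x \<in> W"
  using on by (simp add: operator_on_def)

lemma op_orth: "x \<in> W\<^sup>\<bottom> \<Longrightarrow> A x = 0"
  using on by (simp add: operator_on_def)

lemma coeff_op: "A x \<bullet> e n = l n * (x \<bullet> e n)"
  by (simp add: self_adjointD[OF sa] eig)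

lemma coeff_self: "(x \<bullet> e n) * (e n \<bullet> e n) = x \<bullet> e n"
  using unit[of n] by (auto simp: norm_eq_1)

lemma inner_partial_sum: "(\<Sum>n\<in>I. (x \<bullet> e n) *\<^sub>R e n) \<bullet> e k = (if k \<in> I then x \<bullet> e k else 0)" if "finite I"
proof -
  have "(\<Sum>n\<in>I. (x \<bullet> e n) *\<^sub>R e n) \<bullet> e k = (\<Sum>n\<in>I. if n = k then x \<bullet> e k else 0)"
    unfolding inner_sum_left by (intro sum.cong) (auto simp: ortho coeff_self)
  then show ?thesis using that by simp
qed

lemma norm_partial_sum: "(norm (\<Sum>n\<in>I. (x \<bullet> e n) *\<^sub>R e n))\<^sup>2 = (\<Sum>n\<in>I. (x \<bullet> e n)\<^sup>2)" if "finite I"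
proof -
  have "(\<Sum>n\<in>I. (x \<bullet> e n) *\<^sub>R e n) \<bullet> (\<Sum>n\<in>I. (x \<bullet> e n) *\<^sub>R e n) = (\<Sum>n\<in>I. (x \<bullet> e n)\<^sup>2)"
    by (subst inner_sum_right) (simp add: inner_partial_sum that power2_eq_square)
  then show ?thesis by (simp add: power2_norm_eq_inner)
qed

lemma bessel: "(\<Sum>n\<in>I. (x \<bullet> e n)\<^sup>2) \<le> x \<bullet> x" if "finite I"
proof -
  let ?s = "\<Sum>n\<in>I. (x \<bullet> e n) *\<^sub>R e n"
  have "x \<bullet> ?s = (\<Sum>n\<in>I. (x \<bullet> e n)\<^sup>2)" by (simp add: inner_sum_right power2_eq_square)
  moreover have "?s \<bullet> ?s = (\<Sum>n\<in>I. (x \<bullet> e n)\<^sup>2)"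
    using norm_partial_sum[OF that] by (simp add: power2_norm_eq_inner)
  moreover have "0 \<le> (x - ?s) \<bullet> (x - ?s)" by simp
  ultimately show ?thesis by (simp add: inner_diff inner_commute)
qed

lemma summable_coeff: "summable (\<lambda>n. (x \<bullet> e n)\<^sup>2)"
  by (rule bounded_imp_summable[where B="x \<bullet> x"]) (auto intro: bessel)

lemma expansion: "x \<in> W \<Longrightarrow> (\<lambda>n. (x \<bullet> e n) *\<^sub>R e n) sums x"
proof -
  assume x: "x \<in> W"
  define s where "s N = (\<Sum>n<N. (x \<bullet> e n) *\<^sub>R e n)" for N
  have sd: "s n - s m = (\<Sum>k\<in>{m..<n}. (x \<bullet> e k) *\<^sub>R e k)" if "m \<le> n" for m n
  proof -
    have "s n = s m + (\<Sum>k\<in>{m..<n}. (x \<bullet> e k) *\<^sub>R e k)" unfolding s_def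
      using sum.atLeastLessThan_concat[of 0 m n "\<lambda>k. (x \<bullet> e k) *\<^sub>R e k"] that
      by (simp add: lessThan_atLeast0)
    then show ?thesis by simp
  qed
  have "Cauchy s"
  proof (rule metric_CauchyI)
    fix d :: real assume d: "0 < d"
    obtain N where N: "\<And>m n. m \<ge> N \<Longrightarrow> norm (\<Sum>k\<in>{m..<n}. (x \<bullet> e k)\<^sup>2) < d\<^sup>2"
      using summable_coeff[of x] d unfolding summable_Cauchy by (meson zero_less_power)
    have *: "dist (s m) (s n) < d" if "N \<le> m" "m \<le> n" for m n
    proof -
      have "(norm (s n - s m))\<^sup>2 < d\<^sup>2"
        using N[OF that(1), of n] by (simp add: sd[OF that(2)] norm_partial_sum sum_nonneg)
      then show ?thesis using d by (simp add: dist_norm norm_minus_commute power_less_imp_less_base)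
    qed
    show "\<exists>M. \<forall>m\<ge>M. \<forall>n\<ge>M. dist (s m) (s n) < d"
      by (metis * dist_commute nle_le)
  qed
  then obtain y where y: "s \<longlonglongrightarrow> y" using Cauchy_convergent convergent_def by blast
  have sW: "s N \<in> W" for N unfolding s_def by (intro subspace_sum subspace_scale sub eW)
  have yW: "y \<in> W" using closed_sequentially[OF cl _ y] sW by blast
  have "(x - y) \<bullet> e k = 0" for k
  proof -
    have "(\<lambda>N. s N \<bullet> e k) \<longlonglongrightarrow> y \<bullet> e k" by (intro tendsto_intros y)
    moreover have "(\<lambda>N. s N \<bullet> e k) \<longlonglongrightarrow> x \<bullet> e k"
      by (rule tendsto_eventually) (auto simp: s_def inner_partial_sum eventually_sequentially intro!: exI[of _ "Suc k"])
    ultimately have "y \<bullet> e k = x \<bullet> e k" using LIMSEQ_unique by blast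
    then show ?thesis by (simp add: inner_diff_left)
  qed
  then have "x - y = 0" using x yW sub by (intro complete subspace_diff) auto
  then show ?thesis using y unfolding sums_def s_def by simp
qed

lemma expansion_inner: "x \<in> W \<Longrightarrow> (\<lambda>n. (x \<bullet> e n) * (e n \<bullet> y)) sums (x \<bullet> y)"
  using bounded_linear.sums[OF bounded_linear_inner_left[of y] expansion[of x]] by simp

lemma expansion_norm: "x \<in> W \<Longrightarrow> (\<lambda>n. (x \<bullet> e n)\<^sup>2) sums (x \<bullet> x)"
  using expansion_inner[of x x] by (simp add: inner_commute power2_eq_square)

lemma expansion_form: "x \<in> W \<Longrightarrow> (\<lambda>n. l n * (x \<bullet> e n)\<^sup>2) sums (A x \<bullet> x)"
  using expansion_inner[of x "A x"] coeff_op[of x]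
  by (simp add: inner_commute[of "e _"] inner_commute[of x "A x"] power2_eq_square mult_ac)

definition spectral_space :: "real set \<Rightarrow> 'a set" where
  "spectral_space S = {x \<in> W. \<forall>n. l n \<notin> S \<longrightarrow> x \<bullet> e n = 0}"

lemma spectral_space_subset: "spectral_space S \<subseteq> W"
  by (auto simp: spectral_space_def)

lemma spectral_space_mono: "S \<subseteq> S' \<Longrightarrow> spectral_space S \<subseteq> spectral_space S'"
  by (auto simp: spectral_space_def)

lemma spectral_space_UNIV: "spectral_space UNIV = W"
  by (simp add: spectral_space_def)

lemma spectral_space_Int: "spectral_space S \<inter> spectral_space S' = spectral_space (S \<inter> S')"
  by (auto simp: spectral_space_def)

lemma eigenvector_mem_spectral_space: "l n \<in> S \<Longrightarrow> e n \<in> spectral_space S"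
  by (auto simp: spectral_space_def eW) (metis ortho)

lemma closed_subspace_spectral_space: "closed_subspace (spectral_space S)"
proof -
  have "spectral_space S = W \<inter> (e ` {n. l n \<notin> S})\<^sup>\<bottom>"
    by (auto simp: spectral_space_def mem_orthogonal_comp_iff)
  then show ?thesis
    using closed_subspace_Int[OF closed_subspace_axioms closed_subspace_orthogonal_comp] by metis
qed

lemma spectral_space_orthogonal:
  assumes "x \<in> W"
  shows "x \<in> (spectral_space S)\<^sup>\<bottom> \<longleftrightarrow> x \<in> spectral_space (- S)"
proof
  assume x: "x \<in> (spectral_space S)\<^sup>\<bottom>"
  have "x \<bullet> e n = 0" if "l n \<in> S" for n
    using orthogonal_compD[OF x eigenvector_mem_spectral_space[OF that]] .
  then show "x \<in> spectral_space (- S)" using assms by (simp add: spectral_space_def)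
next
  assume x: "x \<in> spectral_space (- S)"
  have "x \<bullet> y = 0" if y: "y \<in> spectral_space S" for y
  proof -
    have "(\<lambda>n. (x \<bullet> e n) * (e n \<bullet> y)) = (\<lambda>n. 0)"
    proof
      show "(x \<bullet> e n) * (e n \<bullet> y) = 0" for n
        using x y by (cases "l n \<in> S") (auto simp: spectral_space_def inner_commute)
    qed
    then have "(\<lambda>n. 0) sums (x \<bullet> y)" using expansion_inner[OF assms, of y] by simp
    then show ?thesis using sums_unique2[OF sums_zero] by metis
  qed
  then show "x \<in> (spectral_space S)\<^sup>\<bottom>" by (simp add: mem_orthogonal_comp_iff)
qed

lemma spectral_space_complement: "W \<inter> (spectral_space S)\<^sup>\<bottom> = spectral_space (- S)"
  using spectral_space_orthogonal spectral_space_subset by blast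

lemma spectral_space_diff:
  "spectral_space S' \<inter> (spectral_space S)\<^sup>\<bottom> = spectral_space (S' - S)"
proof -
  have "spectral_space S' \<inter> (spectral_space S)\<^sup>\<bottom> = spectral_space S' \<inter> spectral_space (- S)"
    using spectral_space_orthogonal spectral_space_subset by blast
  then show ?thesis by (simp add: spectral_space_Int Diff_eq)
qed

lemma spectral_space_invariant: "x \<in> spectral_space S \<Longrightarrow> A x \<in> spectral_space S"
  by (auto simp: spectral_space_def op_mem coeff_op)

lemma spectral_space_zero: "spectral_space {0} = {x \<in> W. A x = 0}"
proof -
  have "A x = 0" if "x \<in> spectral_space {0}" for x
  proof (rule complete)
    show "A x \<in> W" using that op_mem by (simp add: spectral_space_def)
    show "A x \<bullet> e n = 0" for n using that by (auto simp: spectral_space_def coeff_op)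
  qed
  moreover have "x \<bullet> e n = 0" if "A x = 0" "l n \<noteq> 0" for x n
    using coeff_op[of x n] that by simp
  ultimately show ?thesis by (auto simp: spectral_space_def)
qed

lemma form_le:
  assumes x: "x \<in> spectral_space S" and c: "\<And>s. s \<in> S \<Longrightarrow> s \<le> c"
  shows "A x \<bullet> x \<le> c * (x \<bullet> x)"
proof -
  have xW: "x \<in> W" using x spectral_space_subset by auto
  have "l n * (x \<bullet> e n)\<^sup>2 \<le> c * (x \<bullet> e n)\<^sup>2" for n
    using x c by (cases "l n \<in> S") (auto simp: spectral_space_def intro: mult_right_mono)
  from sums_le[OF this expansion_form[OF xW] sums_mult[OF expansion_norm[OF xW]]] show ?thesis .
qed

lemma form_ge:
  assumes x: "x \<in> spectral_space S" and c: "\<And>s. s \<in> S \<Longrightarrow> c \<le> s"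
  shows "A x \<bullet> x \<ge> c * (x \<bullet> x)"
proof -
  have xW: "x \<in> W" using x spectral_space_subset by auto
  have "c * (x \<bullet> e n)\<^sup>2 \<le> l n * (x \<bullet> e n)\<^sup>2" for n
    using x c by (cases "l n \<in> S") (auto simp: spectral_space_def intro: mult_right_mono)
  from sums_le[OF this sums_mult[OF expansion_norm[OF xW]] expansion_form[OF xW]] show ?thesis .
qed

lemma expansion_norm_shifted:
  assumes xW: "x \<in> W"
  shows "(\<lambda>n. (l n - k)\<^sup>2 * (x \<bullet> e n)\<^sup>2) sums (norm (A x - k *\<^sub>R x))\<^sup>2"
proof -
  have "A x - k *\<^sub>R x \<in> W" using xW op_mem sub by (intro subspace_diff subspace_scale)
  from expansion_norm[OF this] show ?thesis
    by (simp add: inner_diff_left coeff_op power2_norm_eq_inner left_diff_distrib[symmetric] power_mult_distrib)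
qed

lemma norm_shifted_ge:
  assumes x: "x \<in> spectral_space S" and c: "\<And>s. s \<in> S \<Longrightarrow> c \<le> \<bar>s - k\<bar>" "c \<ge> 0"
  shows "norm (A x - k *\<^sub>R x) \<ge> c * norm x"
proof -
  have xW: "x \<in> W" using x spectral_space_subset by auto
  have "c\<^sup>2 * (x \<bullet> e n)\<^sup>2 \<le> (l n - k)\<^sup>2 * (x \<bullet> e n)\<^sup>2" for n
  proof (cases "l n \<in> S")
    case True
    then have "c\<^sup>2 \<le> \<bar>l n - k\<bar>\<^sup>2" using c by (intro power_mono) auto
    then show ?thesis by (intro mult_right_mono) auto
  qed (use x in \<open>simp add: spectral_space_def\<close>)
  from sums_le[OF this sums_mult[OF expansion_norm[OF xW]] expansion_norm_shifted[OF xW]]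
  have "(c * norm x)\<^sup>2 \<le> (norm (A x - k *\<^sub>R x))\<^sup>2" by (simp add: power_mult_distrib power2_norm_eq_inner)
  then show ?thesis by (rule power2_le_imp_le) simp
qed

lemma norm_op_ge:
  assumes "x \<in> spectral_space S" "\<And>s. s \<in> S \<Longrightarrow> c \<le> \<bar>s\<bar>" "c \<ge> 0"
  shows "norm (A x) \<ge> c * norm x"
  using norm_shifted_ge[OF assms(1), of c 0] assms(2,3) by simp

lemma norm_op_le:
  assumes x: "x \<in> spectral_space S" and c: "\<And>s. s \<in> S \<Longrightarrow> \<bar>s\<bar> \<le> c" "c \<ge> 0"
  shows "norm (A x) \<le> c * norm x"
proof -
  have xW: "x \<in> W" using x spectral_space_subset by auto
  have "(l n - 0)\<^sup>2 * (x \<bullet> e n)\<^sup>2 \<le> c\<^sup>2 * (x \<bullet> e n)\<^sup>2" for n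
  proof (cases "l n \<in> S")
    case True
    then have "\<bar>l n\<bar>\<^sup>2 \<le> c\<^sup>2" using c by (intro power_mono) auto
    then show ?thesis by (intro mult_right_mono) auto
  qed (use x in \<open>simp add: spectral_space_def\<close>)
  from sums_le[OF this expansion_norm_shifted[OF xW] sums_mult[OF expansion_norm[OF xW]]]
  have "(norm (A x))\<^sup>2 \<le> (c * norm x)\<^sup>2" by (simp add: power_mult_distrib power2_norm_eq_inner)
  then show ?thesis by (rule power2_le_imp_le) (simp add: c)
qed

lemma orth_proj_spectral_eigenvector: "orth_proj (spectral_space S) (e n) = (if l n \<in> S then e n else 0)"
proof -
  interpret S: closed_subspace "spectral_space S" by (rule closed_subspace_spectral_space)
  show ?thesis
  proof (cases "l n \<in> S")
    case True
    then show ?thesis using S.orth_proj_id[OF eigenvector_mem_spectral_space] by simp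
  next
    case False
    then have "e n \<in> spectral_space (- S)" by (intro eigenvector_mem_spectral_space) simp
    then show ?thesis using spectral_space_orthogonal[OF eW] S.orth_proj_zero False by simp
  qed
qed

lemma blinfun_eqI_eigenvectors:
  fixes P Q :: "'a \<Rightarrow>\<^sub>L 'b::real_normed_vector"
  assumes "\<And>n. P (e n) = Q (e n)" "\<And>x. x \<in> W\<^sup>\<bottom> \<Longrightarrow> P x = Q x"
  shows "P = Q"
proof (rule blinfun_eqI)
  fix x
  let ?p = "orth_proj W x"
  have "(\<lambda>n. P ((?p \<bullet> e n) *\<^sub>R e n)) sums P ?p" "(\<lambda>n. Q ((?p \<bullet> e n) *\<^sub>R e n)) sums Q ?p"
    using expansion[OF orth_proj(1)] by (auto intro: bounded_linear.sums blinfun.bounded_linear_right)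
  then have "P ?p = Q ?p" using assms(1) sums_unique2 by (simp add: blinfun.scaleR_right) blast
  moreover have "P (x - ?p) = Q (x - ?p)" using assms(2) orth_proj(2) by blast
  ultimately show "P x = Q x" by (simp add: blinfun.diff_right)
qed

lemma orth_proj_spectral_orthogonal: "x \<in> W\<^sup>\<bottom> \<Longrightarrow> orth_proj (spectral_space S) x = 0"
  using closed_subspace.orth_proj_zero[OF closed_subspace_spectral_space]
    orthogonal_comp_anti_mono[OF spectral_space_subset] by blast

end



section \<open>The spectral measure of a diagonal operator\<close>

context diagonal_operator begin

lemma norm_proj_spectral_le: "norm (orth_proj (spectral_space S) x) \<le> norm x"
  by (rule closed_subspace.norm_orth_proj_le[OF closed_subspace_spectral_space])

lemma orth_proj_spectral_compose:
  "orth_proj (spectral_space (S \<inter> S')) = orth_proj (spectral_space S) o\<^sub>L orth_proj (spectral_space S')"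
  by (rule blinfun_eqI_eigenvectors)
    (auto simp: orth_proj_spectral_eigenvector orth_proj_spectral_orthogonal)

lemma orth_proj_spectral_Un:
  assumes "S \<inter> S' = {}"
  shows "orth_proj (spectral_space (S \<union> S')) = orth_proj (spectral_space S) + orth_proj (spectral_space S')"
  using assms by (intro blinfun_eqI_eigenvectors)
    (auto simp: orth_proj_spectral_eigenvector orth_proj_spectral_orthogonal blinfun.add_left)

lemma orth_proj_spectral_UN:
  assumes "finite I" "disjoint_family_on S I"
  shows "orth_proj (spectral_space (\<Union>i\<in>I. S i)) = (\<Sum>i\<in>I. orth_proj (spectral_space (S i)))"
  using assms
proof (induction I rule: finite_induct)
  case empty
  have "orth_proj (spectral_space {}) = 0"
    by (rule blinfun_eqI_eigenvectors) (auto simp: orth_proj_spectral_eigenvector orth_proj_spectral_orthogonal)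
  then show ?case by simp
next
  case (insert i I)
  have "disjoint_family_on S I" using insert.prems by (auto simp: disjoint_family_on_def)
  moreover have "S i \<inter> (\<Union>j\<in>I. S j) = {}" using insert by (auto simp: disjoint_family_on_def)
  ultimately show ?case using insert by (simp add: orth_proj_spectral_Un)
qed

text \<open>
  The remainder of the series is the projection belonging to a set \<open>R k\<close> from which every
  eigenvalue drops out eventually. These projections are contractions that eventually vanish on
  each finite combination of eigenvectors, so they tend to \<open>0\<close> pointwise.
\<close>

lemma orth_proj_spectral_sums:
  fixes S :: "nat \<Rightarrow> real set"
  assumes dis: "disjoint_family S"
  shows "(\<lambda>n. orth_proj (spectral_space (S n)) x) sums orth_proj (spectral_space (\<Union>n. S n)) x"
proof -
  let ?U = "\<Union>n. S n"
  define R where "R k = ?U - (\<Union>i<k. S i)" for k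
  have split: "orth_proj (spectral_space ?U) x = (\<Sum>i<k. orth_proj (spectral_space (S i)) x) + orth_proj (spectral_space (R k)) x" for k
  proof -
    have "?U = (\<Union>i<k. S i) \<union> R k" "(\<Union>i<k. S i) \<inter> R k = {}" by (auto simp: R_def)
    then have "orth_proj (spectral_space ?U) = orth_proj (spectral_space (\<Union>i<k. S i)) + orth_proj (spectral_space (R k))"
      using orth_proj_spectral_Un by metis
    moreover have "orth_proj (spectral_space (\<Union>i<k. S i)) = (\<Sum>i<k. orth_proj (spectral_space (S i)))"
      by (rule orth_proj_spectral_UN) (use dis in \<open>auto simp: disjoint_family_on_def\<close>)
    ultimately show ?thesis by (simp add: blinfun.add_left blinfun.sum_left)
  qed
  have ev: "\<forall>\<^sub>F k in sequentially. l n \<notin> R k" for n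
  proof (cases "l n \<in> ?U")
    case True
    then obtain i where "l n \<in> S i" by blast
    then show ?thesis by (auto simp: R_def eventually_sequentially intro!: exI[of _ "Suc i"])
  qed (auto simp: R_def)
  have lim: "(\<lambda>k. orth_proj (spectral_space (R k)) x) \<longlonglongrightarrow> 0"
  proof (rule metric_LIMSEQ_I)
    fix d :: real assume d: "0 < d"
    let ?p = "orth_proj W x"
    define s where "s N = (\<Sum>n<N. (?p \<bullet> e n) *\<^sub>R e n)" for N
    have "s \<longlonglongrightarrow> ?p" using expansion[OF orth_proj(1)[of x]] by (simp add: sums_def s_def[abs_def])
    then obtain N where N: "norm (s N - ?p) < d" using d
      by (auto dest!: LIMSEQ_D[of s ?p d])
    have "\<forall>\<^sub>F k in sequentially. \<forall>n\<in>{..<N}. l n \<notin> R k" using ev by (intro eventually_ball_finite) auto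
    then obtain k0 where k0: "\<And>k n. k \<ge> k0 \<Longrightarrow> n < N \<Longrightarrow> l n \<notin> R k" by (auto simp: eventually_sequentially)
    show "\<exists>k0. \<forall>k\<ge>k0. dist (orth_proj (spectral_space (R k)) x) 0 < d"
    proof (intro exI allI impI)
      fix k assume k: "k0 \<le> k"
      let ?E = "orth_proj (spectral_space (R k))"
      have "?E (s N) = 0" unfolding s_def
        using k0[OF k] by (simp add: blinfun.sum_right blinfun.scaleR_right orth_proj_spectral_eigenvector)
      moreover have "?E (x - ?p) = 0" by (rule orth_proj_spectral_orthogonal) (rule orth_proj)
      ultimately have "?E x = ?E (?p - s N)" by (simp add: blinfun.diff_right)
      then have "norm (?E x) \<le> norm (?p - s N)" using norm_proj_spectral_le by metis
      then show "dist (?E x) 0 < d" using N by (simp add: norm_minus_commute)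
    qed
  qed
  have "(\<lambda>k. orth_proj (spectral_space ?U) x - orth_proj (spectral_space (R k)) x) \<longlonglongrightarrow> orth_proj (spectral_space ?U) x - 0"
    by (intro tendsto_intros lim)
  moreover have "(\<Sum>i<k. orth_proj (spectral_space (S i)) x)
      = orth_proj (spectral_space ?U) x - orth_proj (spectral_space (R k)) x" for k
    by (subst split[of k]) simp
  ultimately show ?thesis unfolding sums_def by simp
qed

lemma projection_valued_measure_spectral: "projection_valued_measure W (\<lambda>S. orth_proj (spectral_space S))"
  unfolding projection_valued_measure_def
  using closed_subspace.self_adjoint_orth_proj[OF closed_subspace_spectral_space]
  by (simp add: spectral_space_UNIV orth_proj_spectral_compose orth_proj_spectral_sums)

lemma form_proj_spectral_sums:
  assumes "x \<in> W"
  shows "(\<lambda>n. if l n \<in> S then (x \<bullet> e n)\<^sup>2 else 0) sums (orth_proj (spectral_space S) x \<bullet> x)"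
proof -
  let ?E = "orth_proj (spectral_space S)"
  have "?E x \<bullet> x = x \<bullet> ?E x" by (rule inner_commute)
  moreover have "(\<lambda>n. (x \<bullet> e n) * (e n \<bullet> ?E x)) sums (x \<bullet> ?E x)" by (rule expansion_inner[OF assms])
  moreover have "(x \<bullet> e n) * (e n \<bullet> ?E x) = (if l n \<in> S then (x \<bullet> e n)\<^sup>2 else 0)" for n
  proof -
    have "e n \<bullet> ?E x = ?E (e n) \<bullet> x"
      by (rule closed_subspace.orth_proj_sym[OF closed_subspace_spectral_space, symmetric])
    also have "\<dots> = (if l n \<in> S then x \<bullet> e n else 0)"
      by (simp add: orth_proj_spectral_eigenvector inner_commute)
    finally show ?thesis by (simp add: power2_eq_square)
  qed
  ultimately show ?thesis by simp
qed

text \<open>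
  As an image of a weighted counting measure, the scalar measure turns integrals into series over
  the eigenbasis.
\<close>

lemma scalar_spectral_measure_eq:
  assumes "x \<in> W"
  shows "scalar_spectral_measure (\<lambda>S. orth_proj (spectral_space S)) x =
    distr (density (count_space UNIV) (\<lambda>n. ennreal ((x \<bullet> e n)\<^sup>2))) borel l" (is "_ = ?M")
proof -
  have "?M = measure_of (space ?M) (sets ?M) (emeasure ?M)" by (rule measure_of_of_measure[symmetric])
  also have "\<dots> = measure_of UNIV (sets borel) (emeasure ?M)" by simp
  also have "\<dots> = scalar_spectral_measure (\<lambda>S. orth_proj (spectral_space S)) x"
    unfolding scalar_spectral_measure_def
  proof (rule measure_of_eq)
    fix S :: "real set" assume "S \<in> sigma_sets UNIV (sets borel)"
    then have S: "S \<in> sets borel" using sets.sigma_sets_eq[of "borel :: real measure"] by simp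
    have "emeasure ?M S = (\<Sum>n. ennreal ((x \<bullet> e n)\<^sup>2) * indicator (l -` S) n)"
      using S by (simp add: emeasure_distr emeasure_density nn_integral_count_space_nat)
    also have "\<dots> = (\<Sum>n. ennreal (if l n \<in> S then (x \<bullet> e n)\<^sup>2 else 0))"
      by (intro suminf_cong) (simp add: indicator_def)
    also have "\<dots> = ennreal (orth_proj (spectral_space S) x \<bullet> x)"
      by (intro suminf_ennreal_eq form_proj_spectral_sums[OF assms]) simp
    finally show "emeasure ?M S = ennreal (orth_proj (spectral_space S) x \<bullet> x)" .
  qed simp
  finally show ?thesis by simp
qed

lemma spectral_measure_spectral: "spectral_measure W A (\<lambda>S. orth_proj (spectral_space S))"
  unfolding spectral_measure_def
proof (intro conjI ballI sa projection_valued_measure_spectral)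
  fix x assume x: "x \<in> W"
  have le: "\<bar>l n\<bar> * (x \<bullet> e n)\<^sup>2 \<le> norm A * (x \<bullet> e n)\<^sup>2" for n
  proof (cases "e n = 0")
    case False
    then have "norm (e n) = 1" using unit[of n] by simp
    then have "\<bar>l n\<bar> \<le> norm A" using norm_blinfun[of A "e n"] by (simp add: eig)
    then show ?thesis by (intro mult_right_mono) auto
  qed simp
  have "summable (\<lambda>n. norm ((x \<bullet> e n)\<^sup>2 *\<^sub>R l n))"
    by (rule summable_comparison_test'[OF summable_mult[OF summable_coeff[of x], of "norm A"], of 0])
      (use le in \<open>simp add: abs_mult mult.commute\<close>)
  then have i: "integrable (count_space UNIV) (\<lambda>n. (x \<bullet> e n)\<^sup>2 *\<^sub>R l n)"
    by (simp add: integrable_count_space_nat_iff)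
  have "(\<lambda>n. (x \<bullet> e n)\<^sup>2 *\<^sub>R l n) sums (A x \<bullet> x)" using expansion_form[OF x] by (simp add: mult.commute)
  then have "has_bochner_integral (count_space UNIV) (\<lambda>n. (x \<bullet> e n)\<^sup>2 *\<^sub>R l n) (A x \<bullet> x)"
    using i sums_integral_count_space_nat[OF i] sums_unique2 by (simp add: has_bochner_integral_iff) blast
  then show "has_bochner_integral (scalar_spectral_measure (\<lambda>S. orth_proj (spectral_space S)) x) (\<lambda>s. s) (A x \<bullet> x)"
    unfolding scalar_spectral_measure_eq[OF x]
    by (intro has_bochner_integral_distr has_bochner_integral_density) auto
qed

end

text \<open>
  The functional calculus is defined through an arbitrary spectral measure, so uniqueness is needed.
  It comes from two facts: a spectral measure commutes with its operator, and the form of the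
  operator on the range of \<open>E S\<close> is bounded by the bounds of \<open>S\<close>. Together they force \<open>E S\<close> to act
  on an eigenvector as the indicator function of \<open>S\<close> at the eigenvalue.
\<close>

locale spectral_measure_of = closed_subspace W for W :: "'a::{real_inner, complete_space} set" +
  fixes A :: "'a \<Rightarrow>\<^sub>L 'a" and E :: "real set \<Rightarrow> 'a \<Rightarrow>\<^sub>L 'a"
  assumes on: "operator_on W A" and sm: "spectral_measure W A E"
begin

lemma E_UNIV: "E UNIV = orth_proj W"
  and E_sa: "S \<in> sets borel \<Longrightarrow> E S x \<bullet> y = x \<bullet> E S y"
  and E_Int: "S \<in> sets borel \<Longrightarrow> S' \<in> sets borel \<Longrightarrow> E S (E S' x) = E (S \<inter> S') x"
  and E_sums: "range F \<subseteq> sets borel \<Longrightarrow> disjoint_family F \<Longrightarrow> (\<lambda>n::nat. E (F n) x) sums E (\<Union>n. F n) x"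
  and A_sa: "self_adjoint A"
  and E_integral: "x \<in> W \<Longrightarrow> has_bochner_integral (scalar_spectral_measure E x) (\<lambda>s. s) (A x \<bullet> x)"
  using sm by (auto simp: spectral_measure_def projection_valued_measure_def self_adjoint_def)

lemma E_empty: "E {} x = 0"
proof -
  have "(\<lambda>n::nat. E {} x) sums E (\<Union>n::nat. {}) x" by (rule E_sums) (auto simp: disjoint_family_on_def)
  then have "(\<lambda>n::nat. E {} x) \<longlonglongrightarrow> 0" by (intro summable_LIMSEQ_zero) (rule sums_summable)
  then show ?thesis using LIMSEQ_unique[OF tendsto_const] by blast
qed

lemma E_mem: "S \<in> sets borel \<Longrightarrow> E S x \<in> W"
  using E_Int[of UNIV S x] orth_proj(1)[of "E S x"] by (simp add: E_UNIV)

lemma E_orth: "S \<in> sets borel \<Longrightarrow> x \<in> W\<^sup>\<bottom> \<Longrightarrow> E S x = 0"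
  using E_Int[of S UNIV x] orth_proj_zero[of x] by (simp add: E_UNIV)

lemma E_form: "S \<in> sets borel \<Longrightarrow> E S x \<bullet> x = (norm (E S x))\<^sup>2"
  using E_sa[of S "E S x" x] E_Int[of S S x] by (simp add: power2_norm_eq_inner)

lemma E_Compl: 
  assumes "S \<in> sets borel" "x \<in> W"
  shows "x = E S x + E (- S) x"
proof -
  define F where "F n = (if n = (0::nat) then S else if n = 1 then - S else {})" for n
  have "- S \<in> sets borel" using assms(1) by (simp add: borel_comp)
  then have "(\<lambda>n. E (F n) x) sums E (\<Union>n. F n) x"
    using assms(1) by (intro E_sums) (auto simp: F_def disjoint_family_on_def)
  moreover have "(\<Union>n. F n) = UNIV"
  proof -
    have "S \<subseteq> F 0" "- S \<subseteq> F 1" by (auto simp: F_def)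
    then show ?thesis by blast
  qed
  moreover have "(\<lambda>n. E (F n) x) sums (\<Sum>n\<in>{0,1}. E (F n) x)"
    by (rule sums_finite) (auto simp: F_def E_empty)
  ultimately have "E UNIV x = E S x + E (- S) x" using sums_unique2 by (fastforce simp: F_def)
  then show ?thesis using assms(2) by (simp add: E_UNIV orth_proj_id)
qed

abbreviation "\<mu> \<equiv> scalar_spectral_measure E"

lemma sets_\<mu> [simp]: "sets (\<mu> x) = sets borel" "space (\<mu> x) = UNIV"
  using sets.sigma_sets_eq[of "borel :: real measure"] by (simp_all add: scalar_spectral_measure_def)

lemma emeasure_\<mu>: "S \<in> sets borel \<Longrightarrow> emeasure (\<mu> x) S = ennreal ((norm (E S x))\<^sup>2)"
proof -
  assume S: "S \<in> sets borel"
  have "emeasure (\<mu> x) S = ennreal (E S x \<bullet> x)"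
    unfolding scalar_spectral_measure_def
  proof (rule emeasure_measure_of_sigma)
    show "sigma_algebra UNIV (sets (borel :: real measure))" using sets.sigma_algebra_axioms[of borel] by simp
    show "positive (sets borel) (\<lambda>S. ennreal (E S x \<bullet> x))" by (simp add: positive_def E_empty)
    show "countably_additive (sets borel) (\<lambda>S. ennreal (E S x \<bullet> x))"
    proof (rule countably_additiveI)
      fix F :: "nat \<Rightarrow> real set"
      assume F: "range F \<subseteq> sets borel" "disjoint_family F"
      have "(\<lambda>n. E (F n) x \<bullet> x) sums (E (\<Union>n. F n) x \<bullet> x)"
        by (rule bounded_linear.sums[OF bounded_linear_inner_left E_sums[OF F]])
      then show "(\<Sum>i. ennreal (E (F i) x \<bullet> x)) = ennreal (E (\<Union> (range F)) x \<bullet> x)"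
        using F(1) by (intro suminf_ennreal_eq) (auto simp: E_form)
    qed
  qed (rule S)
  then show ?thesis using S by (simp add: E_form)
qed

lemma finite_measure_\<mu>: "finite_measure (\<mu> x)"
  by (rule finite_measureI) (simp add: emeasure_\<mu>)

lemma measure_\<mu>: "x \<in> W \<Longrightarrow> measure (\<mu> x) UNIV = x \<bullet> x"
  by (simp add: measure_def emeasure_\<mu> E_UNIV orth_proj_id power2_norm_eq_inner)

lemma AE_\<mu>:
  assumes S: "S \<in> sets borel" and x: "x \<in> W" "E S x = x"
  shows "AE s in \<mu> x. s \<in> S"
proof (rule AE_I)
  show "{s \<in> space (\<mu> x). s \<notin> S} \<subseteq> - S" by auto
  show "- S \<in> sets (\<mu> x)" using S by (simp add: borel_comp)
  have "E (- S) x = 0" using E_Compl[OF S x(1)] x(2) by simp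
  then show "emeasure (\<mu> x) (- S) = 0" using S by (simp add: emeasure_\<mu> borel_comp)
qed

lemma form_\<mu>: "x \<in> W \<Longrightarrow> A x \<bullet> x = (\<integral>s. s \<partial>\<mu> x)" "x \<in> W \<Longrightarrow> integrable (\<mu> x) (\<lambda>s. s)"
  using E_integral by (auto simp: has_bochner_integral_iff)

lemma form_ge_E:
  assumes "x \<in> W" "E {c..} x = x"
  shows "A x \<bullet> x \<ge> c * (x \<bullet> x)"
proof -
  interpret finite_measure "\<mu> x" by (rule finite_measure_\<mu>)
  have "(\<integral>s. c \<partial>\<mu> x) \<le> (\<integral>s. s \<partial>\<mu> x)"
    using AE_\<mu>[OF _ assms] by (intro integral_mono_AE form_\<mu> assms) auto
  then show ?thesis by (simp add: form_\<mu> assms measure_\<mu> mult.commute)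
qed

lemma form_le_E:
  assumes "x \<in> W" "E {..c} x = x"
  shows "A x \<bullet> x \<le> c * (x \<bullet> x)"
proof -
  interpret finite_measure "\<mu> x" by (rule finite_measure_\<mu>)
  have "(\<integral>s. s \<partial>\<mu> x) \<le> (\<integral>s. c \<partial>\<mu> x)"
    using AE_\<mu>[OF _ assms] by (intro integral_mono_AE form_\<mu> assms) auto
  then show ?thesis by (simp add: form_\<mu> assms measure_\<mu> mult.commute)
qed

lemma density_\<mu>:
  assumes S: "S \<in> sets borel"
  shows "\<mu> (E S z) = density (\<mu> z) (\<lambda>s. ennreal (indicator S s))"
proof (rule measure_eqI)
  fix X assume "X \<in> sets (\<mu> (E S z))"
  then have X: "X \<in> sets borel" by simp
  have "emeasure (density (\<mu> z) (\<lambda>s. ennreal (indicator S s))) X = emeasure (\<mu> z) (S \<inter> X)"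
    using emeasure_restricted[of S "\<mu> z" X] S X by (simp add: ennreal_indicator)
  also have "\<dots> = emeasure (\<mu> (E S z)) X" using S X by (simp add: emeasure_\<mu> E_Int Int_commute)
  finally show "emeasure (\<mu> (E S z)) X = emeasure (density (\<mu> z) (\<lambda>s. ennreal (indicator S s))) X" by simp
qed simp

lemma form_E:
  assumes S: "S \<in> sets borel" and z: "z \<in> W"
  shows "A (E S z) \<bullet> E S z = (\<integral>s. indicator S s * s \<partial>\<mu> z)"
proof -
  have "A (E S z) \<bullet> E S z = (\<integral>s. s \<partial>\<mu> (E S z))" by (rule form_\<mu>) (rule E_mem[OF S])
  also have "\<dots> = (\<integral>s. indicator S s *\<^sub>R s \<partial>\<mu> z)"
  proof -
    have "f \<in> borel_measurable (\<mu> z)" if "f \<in> borel_measurable borel" for f :: "real \<Rightarrow> real"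
      using that measurable_cong_sets[OF sets_\<mu>(1) refl] by blast
    note meas = this
    show ?thesis unfolding density_\<mu>[OF S]
    proof (rule integral_density)
      show "(\<lambda>s. s) \<in> borel_measurable (\<mu> z)" by (rule meas) simp
      show "indicat_real S \<in> borel_measurable (\<mu> z)" by (rule meas) (rule borel_measurable_indicator[OF S])
    qed simp
  qed
  finally show ?thesis by simp
qed

text \<open>
  For \<open>z = E S x + E (- S) y\<close> the integral that computes the form splits into the integrals over \<open>S\<close>
  and its complement, which are the forms of the two summands. So the mixed terms vanish.
\<close>

lemma form_off_diagonal:
  assumes S: "S \<in> sets borel" and x: "x \<in> W" and y: "y \<in> W"
  shows "A (E S x) \<bullet> E (- S) y = 0"
proof -
  have S': "- S \<in> sets borel" using S by (simp add: borel_comp)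
  let ?u = "E S x" and ?v = "E (- S) y"
  define z where "z = ?u + ?v"
  have z: "z \<in> W" unfolding z_def using E_mem[OF S] E_mem[OF S'] sub by (intro subspace_add)
  have Ez: "E S z = ?u" "E (- S) z = ?v"
    using S S' by (simp_all add: z_def blinfun.add_right E_Int E_empty)
  have int: "integrable (\<mu> z) (\<lambda>s. indicator T s * s)" if "T \<in> sets borel" for T
    using integrable_real_mult_indicator[OF _ form_\<mu>(2)[OF z], of T] that by (simp add: mult.commute)
  have "A z \<bullet> z = (\<integral>s. indicator S s * s + indicator (- S) s * s \<partial>\<mu> z)"
    unfolding form_\<mu>(1)[OF z] by (intro Bochner_Integration.integral_cong) (auto simp: indicator_def)
  also have "\<dots> = A ?u \<bullet> ?u + A ?v \<bullet> ?v"
    using form_E[OF S z] form_E[OF S' z] int[OF S] int[OF S'] by (simp add: Ez)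
  finally have "A ?u \<bullet> ?v + A ?v \<bullet> ?u = 0"
    by (simp add: z_def blinfun.add_right inner_add)
  moreover have "A ?v \<bullet> ?u = A ?u \<bullet> ?v" using self_adjointD[OF A_sa, of ?u ?v] by (simp add: inner_commute)
  ultimately show ?thesis by simp
qed

lemma E_commute:
  assumes S: "S \<in> sets borel" and x: "x \<in> W"
  shows "A (E S x) = E S (A x)"
proof -
  have S': "- S \<in> sets borel" using S by (simp add: borel_comp)
  have AW: "A y \<in> W" if "y \<in> W" for y using on that by (simp add: operator_on_def)
  have inv: "E (- T) (A (E T x)) = 0" if T: "T \<in> sets borel" for T
  proof -
    have T': "- T \<in> sets borel" using T by (simp add: borel_comp)
    let ?w = "E (- T) (A (E T x))"
    have "?w \<bullet> ?w = A (E T x) \<bullet> E (- T) ?w" by (rule E_sa[OF T'])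
    also have "\<dots> = 0" by (rule form_off_diagonal[OF T x E_mem[OF T']])
    finally show ?thesis by simp
  qed
  have 1: "E S (A (E S x)) = A (E S x)"
    using E_Compl[OF S AW[OF E_mem[OF S]], of x] inv[OF S] by simp
  have 2: "E S (A (E (- S) x)) = 0" using inv[OF S'] by simp
  have "A x = A (E S x) + A (E (- S) x)" using E_Compl[OF S x] by (metis blinfun.add_right)
  then show ?thesis using 1 2 by (simp add: blinfun.add_right)
qed

text \<open>
  The component \<open>u\<close> of \<open>x\<close> with spectrum in \<open>[c + 1/n, \<infinity>)\<close> is again an eigenvector for \<open>c\<close>,
  because \<open>E\<close> commutes with \<open>A\<close>. Its form is then both equal to \<open>c \<parallel>u\<parallel>\<^sup>2\<close> and at least
  \<open>(c + 1/n) \<parallel>u\<parallel>\<^sup>2\<close>, so \<open>u = 0\<close>. The same holds below \<open>c\<close>, and the scalar measure of \<open>x\<close> is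
  concentrated at \<open>c\<close>.
\<close>

lemma E_eigenvector:
  assumes S: "S \<in> sets borel" and x: "x \<in> W" "A x = c *\<^sub>R x"
  shows "E S x = (if c \<in> S then x else 0)"
proof -
  have up: "E {c + inverse (real (Suc n))..} x = 0" (is "?u = 0") for n
  proof -
    have u: "?u \<in> W" "A ?u = c *\<^sub>R ?u" "E {c + inverse (real (Suc n))..} ?u = ?u"
      using E_commute[OF _ x(1), of "{c + inverse (real (Suc n))..}"] x(2)
      by (simp_all add: E_mem E_Int blinfun.scaleR_right)
    have "(c + inverse (real (Suc n))) * (?u \<bullet> ?u) \<le> c * (?u \<bullet> ?u)" using form_ge_E[OF u(1,3)] u(2) by simp
    then have "inverse (real (Suc n)) * (?u \<bullet> ?u) \<le> 0" by (simp add: algebra_simps)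
    moreover have "inverse (real (Suc n)) > 0" by simp
    ultimately have "?u \<bullet> ?u \<le> 0" by (simp add: mult_le_0_iff)
    then have "?u \<bullet> ?u = 0" using inner_ge_zero[of ?u] by linarith
    then show ?thesis by simp
  qed
  have down: "E {..c - inverse (real (Suc n))} x = 0" (is "?u = 0") for n
  proof -
    have u: "?u \<in> W" "A ?u = c *\<^sub>R ?u" "E {..c - inverse (real (Suc n))} ?u = ?u"
      using E_commute[OF _ x(1), of "{..c - inverse (real (Suc n))}"] x(2)
      by (simp_all add: E_mem E_Int blinfun.scaleR_right)
    have "c * (?u \<bullet> ?u) \<le> (c - inverse (real (Suc n))) * (?u \<bullet> ?u)" using form_le_E[OF u(1,3)] u(2) by simp
    then have "inverse (real (Suc n)) * (?u \<bullet> ?u) \<le> 0" by (simp add: algebra_simps)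
    moreover have "inverse (real (Suc n)) > 0" by simp
    ultimately have "?u \<bullet> ?u \<le> 0" by (simp add: mult_le_0_iff)
    then have "?u \<bullet> ?u = 0" using inner_ge_zero[of ?u] by linarith
    then show ?thesis by simp
  qed
  let ?N = "(\<Union>n::nat. {c + inverse (real (Suc n))..}) \<union> (\<Union>n::nat. {..c - inverse (real (Suc n))})"
  have "emeasure (\<mu> x) (\<Union>n::nat. {c + inverse (real (Suc n))..}) = 0"
    by (rule emeasure_UN_eq_0) (auto simp: emeasure_\<mu> up simp del: of_nat_Suc)
  moreover have "emeasure (\<mu> x) (\<Union>n::nat. {..c - inverse (real (Suc n))}) = 0"
    by (rule emeasure_UN_eq_0) (auto simp: emeasure_\<mu> down simp del: of_nat_Suc)
  ultimately have "?N \<in> null_sets (\<mu> x)" by (intro null_sets.Un) (auto simp: null_sets_def)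
  moreover have "?N = - {c}"
  proof (rule antisym)
    show "?N \<subseteq> - {c}"
    proof -
      have "inverse (real (Suc n)) > 0" for n by simp
      then show ?thesis by (auto simp: not_le)
    qed
    show "- {c} \<subseteq> ?N"
    proof
      fix s assume "s \<in> - {c}"
      then have "0 < \<bar>s - c\<bar>" by simp
      then obtain n where n: "inverse (real (Suc n)) < \<bar>s - c\<bar>" using reals_Archimedean by blast
      then have "s \<ge> c + inverse (real (Suc n)) \<or> s \<le> c - inverse (real (Suc n))" by linarith
      then show "s \<in> ?N" by auto
    qed
  qed
  ultimately have "emeasure (\<mu> x) (- {c}) = 0" by auto
  then have "E (- {c}) x = 0" by (simp add: emeasure_\<mu> borel_comp)
  then have 1: "E {c} x = x" using E_Compl[of "{c}" x] x(1) by simp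
  then have "E S x = E (S \<inter> {c}) x" using E_Int[OF S, of "{c}" x] by simp
  then show ?thesis using 1 by (cases "c \<in> S") (simp_all add: E_empty)
qed

end

lemma orthogonal_sum_zero:
  fixes u v w :: "'a::real_inner"
  assumes "u \<bullet> v = 0" "u \<bullet> w = 0" "v \<bullet> w = 0" "u + v - w = 0"
  shows "u = 0 \<and> v = 0 \<and> w = 0"
proof -
  have "u \<bullet> (u + v - w) = 0" "v \<bullet> (u + v - w) = 0" using assms(4) by simp_all
  then have "u \<bullet> u = 0" "v \<bullet> v = 0"
    using assms(1-3) by (simp_all add: inner_add_right inner_diff_right inner_commute[of v u])
  then show ?thesis using assms(4) by simp
qed

context diagonal_operator begin

theorem spectral_proj_eq:
  assumes S: "S \<in> sets borel"
  shows "spectral_proj W A S = orth_proj (spectral_space S)"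
  unfolding spectral_proj_def
proof (rule the_equality)
  show "\<exists>E. spectral_measure W A E \<and> orth_proj (spectral_space S) = E S"
    using spectral_measure_spectral by blast
next
  fix Q assume "\<exists>E. spectral_measure W A E \<and> Q = E S"
  then obtain E where E: "spectral_measure W A E" "Q = E S" by blast
  interpret E: spectral_measure_of W A E by unfold_locales (rule on, rule E)
  have "E S = orth_proj (spectral_space S)"
  proof (rule blinfun_eqI_eigenvectors)
    show "E S (e n) = orth_proj (spectral_space S) (e n)" for n
      using E.E_eigenvector[OF S eW eig] by (simp add: orth_proj_spectral_eigenvector)
    show "E S x = orth_proj (spectral_space S) x" if "x \<in> W\<^sup>\<bottom>" for x
      using E.E_orth[OF S that] orth_proj_spectral_orthogonal[OF that] by simp
  qed
  then show "Q = orth_proj (spectral_space S)" using E(2) by simp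
qed

lemma range_spectral_proj: "S \<in> sets borel \<Longrightarrow> range (spectral_proj W A S) = spectral_space S"
  by (simp add: spectral_proj_eq closed_subspace.range_orth_proj[OF closed_subspace_spectral_space])

theorem sign_splitting_spectral: "sign_splitting W A (spectral_space {..<0}) (spectral_space {0<..})"
proof -
  interpret M: closed_subspace "spectral_space {..<0}" by (rule closed_subspace_spectral_space)
  interpret P: closed_subspace "spectral_space {0<..}" by (rule closed_subspace_spectral_space)
  let ?M = "spectral_space {..<0}" and ?P = "spectral_space {0<..}" and ?N = "spectral_space {0}"
  have orth: "spectral_space S \<subseteq> (spectral_space S')\<^sup>\<bottom>" if "S \<inter> S' = {}" for S S'
  proof -
    have "spectral_space S \<subseteq> spectral_space (- S')" using that by (intro spectral_space_mono) auto
    then show ?thesis using spectral_space_complement by blast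
  qed
  have W: "W = {m + p + k | m p k. m \<in> ?M \<and> p \<in> ?P \<and> k \<in> ?N}"
  proof
    show "{m + p + k | m p k. m \<in> ?M \<and> p \<in> ?P \<and> k \<in> ?N} \<subseteq> W"
      using spectral_space_subset sub by (auto intro!: subspace_add)
    show "W \<subseteq> {m + p + k | m p k. m \<in> ?M \<and> p \<in> ?P \<and> k \<in> ?N}"
    proof
      fix x assume x: "x \<in> W"
      define y where "y = x - orth_proj ?M x"
      have y: "y \<in> W" "y \<in> ?M\<^sup>\<bottom>"
        using closed_subspace_orthogonal_decomp[OF M.closed_subspace_axioms closed_subspace_axioms spectral_space_subset x]
        by (auto simp: y_def)
      then have y1: "y \<in> spectral_space (- {..<0})" using spectral_space_orthogonal by blast
      define k where "k = y - orth_proj ?P y"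
      have "k \<in> spectral_space (- {..<0}) \<inter> ?P\<^sup>\<bottom>" unfolding k_def
        by (rule closed_subspace_orthogonal_decomp[OF P.closed_subspace_axioms closed_subspace_spectral_space _ y1])
          (rule spectral_space_mono, auto)
      then have "k \<in> spectral_space (- {..<0} - {0<..})" using spectral_space_diff by blast
      moreover have "- {..<0} - {0<..} = {0::real}" by auto
      ultimately have "k \<in> ?N" by simp
      moreover have "x = orth_proj ?M x + orth_proj ?P y + k" by (simp add: k_def y_def)
      ultimately show "x \<in> {m + p + k | m p k. m \<in> ?M \<and> p \<in> ?P \<and> k \<in> ?N}"
        using M.orth_proj(1) P.orth_proj(1) by blast
    qed
  qed
  have neg: "A x \<bullet> x < 0" if x: "x \<in> ?M" "x \<noteq> 0" for x
  proof -
    have xW: "x \<in> W" using x spectral_space_subset by blast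
    obtain n where n: "x \<bullet> e n \<noteq> 0" using complete[OF xW] x(2) by blast
    have ln: "l n < 0" using n x(1) by (auto simp: spectral_space_def)
    have le: "l k * (x \<bullet> e k)\<^sup>2 \<le> 0" for k
      using x(1) by (cases "l k < 0") (auto simp: spectral_space_def mult_nonpos_nonneg)
    have "0 < (\<Sum>k. - (l k * (x \<bullet> e k)\<^sup>2))"
      using suminf_pos2[of "\<lambda>k. - (l k * (x \<bullet> e k)\<^sup>2)" n] sums_summable[OF sums_minus[OF expansion_form[OF xW]]] le n ln
      by (simp add: mult_neg_pos)
    then show ?thesis using sums_unique[OF sums_minus[OF expansion_form[OF xW]]] by simp
  qed
  have pos: "A x \<bullet> x > 0" if x: "x \<in> ?P" "x \<noteq> 0" for x
  proof -
    have xW: "x \<in> W" using x spectral_space_subset by blast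
    obtain n where n: "x \<bullet> e n \<noteq> 0" using complete[OF xW] x(2) by blast
    have ln: "l n > 0" using n x(1) by (auto simp: spectral_space_def)
    have ge: "0 \<le> l k * (x \<bullet> e k)\<^sup>2" for k
      using x(1) by (cases "l k > 0") (auto simp: spectral_space_def)
    have "0 < (\<Sum>k. l k * (x \<bullet> e k)\<^sup>2)"
      using suminf_pos2[of "\<lambda>k. l k * (x \<bullet> e k)\<^sup>2" n] sums_summable[OF expansion_form[OF xW]] ge n ln
      by simp
    then show ?thesis using sums_unique[OF expansion_form[OF xW]] by simp
  qed
  have o: "?M \<subseteq> ?P\<^sup>\<bottom>" "?M \<subseteq> ?N\<^sup>\<bottom>" "?P \<subseteq> ?N\<^sup>\<bottom>" by (rule orth, force)+
  have inv: "A ` ?M \<subseteq> ?M" "A ` ?P \<subseteq> ?P" using spectral_space_invariant by blast+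
  show ?thesis
    unfolding sign_splitting_def Let_def spectral_space_zero[symmetric]
    by (intro conjI M.sub M.cl P.sub P.cl o W inv ballI impI neg pos)
qed

text \<open>
  The components of an eigenvector in \<open>M\<close>, \<open>P\<close> and the kernel are eigenvectors for the same
  eigenvalue, whose sign allows only one of them to be nonzero. So every eigenvector lies in one of
  the three spaces, and \<open>M\<close> is spanned by those with negative eigenvalue.
\<close>

lemma sign_splitting_unique:
  assumes "sign_splitting W A M P"
  shows "M = spectral_space {..<0}"
proof -
  let ?N = "{x \<in> W. A x = 0}"
  from assms have M: "subspace M" "closed M" and P: "subspace P" and MP: "M \<subseteq> P\<^sup>\<bottom>" and MN: "M \<subseteq> ?N\<^sup>\<bottom>" and PN: "P \<subseteq> ?N\<^sup>\<bottom>"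
    and W: "W = {m + p + k | m p k. m \<in> M \<and> p \<in> P \<and> k \<in> ?N}" and AM: "A ` M \<subseteq> M" and AP: "A ` P \<subseteq> P"
    and neg: "\<And>x. x \<in> M \<Longrightarrow> x \<noteq> 0 \<Longrightarrow> A x \<bullet> x < 0" and pos: "\<And>x. x \<in> P \<Longrightarrow> x \<noteq> 0 \<Longrightarrow> A x \<bullet> x > 0"
    by (auto simp: sign_splitting_def Let_def)
  have sN: "subspace ?N" using sub by (auto simp: subspace_def blinfun.add_right blinfun.scaleR_right)
  have split: "\<exists>m p k. e n = m + p + k \<and> m \<in> M \<and> p \<in> P \<and> k \<in> ?N \<and>
      A m = l n *\<^sub>R m \<and> A p = l n *\<^sub>R p \<and> l n *\<^sub>R k = 0" for n
  proof -
    obtain m p k where mpk: "e n = m + p + k" "m \<in> M" "p \<in> P" "k \<in> ?N" using eW[of n] W by blast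
    let ?m = "A m - l n *\<^sub>R m" and ?p = "A p - l n *\<^sub>R p" and ?k = "l n *\<^sub>R k"
    have mem: "?m \<in> M" "?p \<in> P"
      using mpk(2,3) AM AP M(1) P by (auto intro!: subspace_diff subspace_scale)
    have mem3: "?k \<in> ?N" using subspace_scale[OF sN mpk(4)] .
    have sum: "?m + ?p - ?k = 0" using eig[of n] mpk(1,4)
      by (simp add: blinfun.add_right algebra_simps)
    have o: "?m \<bullet> ?p = 0" "?m \<bullet> ?k = 0" "?p \<bullet> ?k = 0"
      using orthogonal_compD[OF subsetD[OF MP mem(1)] mem(2)]
        orthogonal_compD[OF subsetD[OF MN mem(1)] mem3] orthogonal_compD[OF subsetD[OF PN mem(2)] mem3] by auto
    have "?m = 0" "?p = 0" "?k = 0" using orthogonal_sum_zero[OF o sum] by blast+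
    then show ?thesis using mpk by (intro exI[of _ m] exI[of _ p] exI[of _ k]) simp
  qed
  have negM: "e n \<in> M" if ln: "l n < 0" for n
  proof -
    obtain m p k where mpk: "e n = m + p + k" "m \<in> M" "p \<in> P" "A p = l n *\<^sub>R p" "l n *\<^sub>R k = 0"
      using split[of n] by blast
    have "A p \<bullet> p \<le> 0" using mpk(4) ln by (simp add: mult_nonpos_nonneg)
    then have "p = 0" using pos[OF mpk(3)] by force
    then show ?thesis using mpk ln by simp
  qed
  have orthM: "x \<bullet> e n = 0" if x: "x \<in> M" and ln: "\<not> l n < 0" for x n
  proof -
    obtain m p k where mpk: "e n = m + p + k" "m \<in> M" "p \<in> P" "k \<in> ?N" "A m = l n *\<^sub>R m"
      using split[of n] by blast
    have "A m \<bullet> m \<ge> 0" using mpk(5) ln by simp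
    then have "m = 0" using neg[OF mpk(2)] by force
    moreover have "x \<bullet> p = 0" "x \<bullet> k = 0"
      using orthogonal_compD[OF subsetD[OF MP x] mpk(3)] orthogonal_compD[OF subsetD[OF MN x] mpk(4)] by auto
    ultimately show ?thesis using mpk(1) by (simp add: inner_add_right)
  qed
  show ?thesis
  proof
    have "M \<subseteq> W"
    proof
      fix m assume "m \<in> M"
      then have "m + 0 + 0 \<in> {m + p + k | m p k. m \<in> M \<and> p \<in> P \<and> k \<in> ?N}"
        using subspace_0[OF P] subspace_0[OF sN] by blast
      then have "m + 0 + 0 \<in> W" by (subst W)
      then show "m \<in> W" by simp
    qed
    then show "M \<subseteq> spectral_space {..<0}" using orthM by (auto simp: spectral_space_def)
    show "spectral_space {..<0} \<subseteq> M"
    proof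
      fix x assume x: "x \<in> spectral_space {..<0}"
      then have xW: "x \<in> W" using spectral_space_subset by blast
      have "(x \<bullet> e n) *\<^sub>R e n \<in> M" for n
        using x negM M(1) subspace_0[OF M(1)] by (cases "l n < 0") (auto simp: spectral_space_def subspace_scale)
      then have "(\<Sum>n<k. (x \<bullet> e n) *\<^sub>R e n) \<in> M" for k by (intro subspace_sum M(1))
      then show "x \<in> M" by (rule closed_sequentially[OF M(2) _ expansion[OF xW, unfolded sums_def]])
    qed
  qed
qed

lemma neg_space_eq: "neg_space W A = spectral_space {..<0}"
  unfolding neg_space_def using sign_splitting_spectral sign_splitting_unique by (intro the_equality) blast+

end



section \<open>Negative spaces of essential symmetries\<close>

lemma finite_dimensional_bounded_below:
  fixes D :: "'a::{real_inner, complete_space} \<Rightarrow>\<^sub>L 'a"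
  assumes "compact_operator D" "self_adjoint D" "subspace L" "d > 0" "\<And>x. x \<in> L \<Longrightarrow> d * norm x \<le> norm (D x)"
  shows "finite_dimensional L"
proof -
  obtain G where G: "subspace G" "finite_dimensional G" "\<And>x. x \<in> G\<^sup>\<bottom> \<Longrightarrow> norm (D x) \<le> (d/2) * norm x"
    using compact_self_adjoint_small[OF assms(1,2), of "d/2"] assms(4) by auto
  show ?thesis
  proof (rule finite_dimensional_transversal(1)[OF assms(3) G(1,2)])
    fix x assume "x \<in> L" "x \<in> G\<^sup>\<bottom>"
    then have "d * norm x \<le> (d/2) * norm x" using assms(5) G(3) by fastforce
    then show "x = 0" using assms(4) by simp
  qed
qed

locale diagonal_symmetry = diagonal_operator +
  assumes comp: "compact_operator ((A o\<^sub>L A) - orth_proj W)"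
begin

text \<open>
  On this space \<open>A\<^sup>2 - I\<close> is bounded below by \<open>1 - c\<^sup>2\<close>, and it is compact.
\<close>

lemma finite_dimensional_spectral_space:
  assumes S: "\<And>s. s \<in> S \<Longrightarrow> \<bar>s\<bar> \<le> c" and c: "0 \<le> c" "c < 1"
  shows "finite_dimensional (spectral_space S)"
proof (rule finite_dimensional_bounded_below[OF comp])
  show "self_adjoint ((A o\<^sub>L A) - orth_proj W)"
    by (intro self_adjoint_diff self_adjoint_orth_proj) (simp add: self_adjoint_def self_adjointD[OF sa])
  show "subspace (spectral_space S)" using closed_subspace_spectral_space by (simp add: closed_subspace_def)
  show "1 - c\<^sup>2 > 0" using c by (simp add: power_less_one_iff)
  fix x assume x: "x \<in> spectral_space S"
  then have "orth_proj W x = x" using spectral_space_subset orth_proj_id by blast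
  moreover have "norm (A (A x)) \<le> c * norm (A x)" "norm (A x) \<le> c * norm x"
    using norm_op_le[OF spectral_space_invariant[OF x] S] norm_op_le[OF x S] c by blast+
  then have "norm (A (A x)) \<le> c\<^sup>2 * norm x"
    using mult_left_mono[of "norm (A x)" "c * norm x" c] c by (simp add: power2_eq_square)
  moreover have "norm x - norm (A (A x)) \<le> norm (A (A x) - x)" using norm_triangle_ineq2[of x "A (A x)"]
    by (simp add: norm_minus_commute)
  ultimately show "(1 - c\<^sup>2) * norm x \<le> norm (((A o\<^sub>L A) - orth_proj W) x)"
    by (simp add: blinfun.diff_left algebra_simps)
qed

lemma finite_eigenvalues:
  assumes "0 \<le> c" "c < 1"
  shows "finite {n. e n \<noteq> 0 \<and> \<bar>l n\<bar> \<le> c}" (is "finite ?I")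
proof -
  have fd: "finite_dimensional (spectral_space {-c..c})"
    using assms by (intro finite_dimensional_spectral_space[where c=c]) auto
  have inj: "inj_on e ?I"
  proof (rule inj_onI, rule ccontr)
    fix i j assume "i \<in> ?I" "j \<in> ?I" "e i = e j" "i \<noteq> j"
    then have "e i \<bullet> e i = 0" using ortho[of i j] by simp
    then show False using \<open>i \<in> ?I\<close> by simp
  qed
  have "pairwise orthogonal (e ` ?I)" by (auto simp: pairwise_def orthogonal_def) (metis ortho)
  then have ind: "independent (e ` ?I)" by (rule pairwise_orthogonal_independent) auto
  obtain F where F: "finite F" "spectral_space {-c..c} \<subseteq> span F" using fd by (auto simp: finite_dimensional_def)
  have "e ` ?I \<subseteq> span F" using F(2) eigenvector_mem_spectral_space[of _ "{-c..c}"] by (auto simp: abs_le_iff)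
  then have "finite (e ` ?I)" using independent_span_bound[OF F(1) ind] by blast
  then show ?thesis using finite_imageD inj by blast
qed

lemma eigenvalue_gap:
  assumes "\<bar>a\<bar> < 1"
  obtains d where "d > 0" "\<And>n. e n \<noteq> 0 \<Longrightarrow> l n \<noteq> a \<Longrightarrow> d \<le> \<bar>l n - a\<bar>"
proof -
  define c where "c = (1 + \<bar>a\<bar>) / 2"
  have c: "0 \<le> c" "c < 1" "\<bar>a\<bar> < c" using assms by (auto simp: c_def)
  have fin: "finite (l ` {n. e n \<noteq> 0 \<and> \<bar>l n\<bar> \<le> c})" using finite_eigenvalues[OF c(1,2)] by simp
  obtain d where d: "d > 0" "\<forall>s\<in>l ` {n. e n \<noteq> 0 \<and> \<bar>l n\<bar> \<le> c}. s \<noteq> a \<longrightarrow> d \<le> dist a s"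
    using finite_set_avoid[OF fin, of a] by (elim exE conjE)
  have "min d (c - \<bar>a\<bar>) \<le> \<bar>l n - a\<bar>" if "e n \<noteq> 0" "l n \<noteq> a" for n
  proof (cases "\<bar>l n\<bar> \<le> c")
    case True
    then have "d \<le> dist a (l n)" using that d(2) by auto
    then show ?thesis by (simp add: dist_real_def)
  qed linarith
  then show ?thesis using that[of "min d (c - \<bar>a\<bar>)"] d(1) c(3) by simp
qed

text \<open>
  Only finitely many eigenvalues lie in \<open>[-3/4, 3/4]\<close>, so some \<open>\<alpha>\<close> between \<open>1/4\<close> and \<open>1/2\<close> is
  not the absolute value of an eigenvalue. The factor \<open>2\<close> leaves room for perturbation.
\<close>

lemma symmetric_gap:
  obtains \<alpha> \<eta> where "0 < \<eta>" "\<eta> \<le> \<alpha>" "\<alpha> < 1" "\<And>n. e n \<noteq> 0 \<Longrightarrow> 2 * \<eta> \<le> \<bar>\<bar>l n\<bar> - \<alpha>\<bar>"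
proof -
  let ?L = "(\<lambda>n. \<bar>l n\<bar>) ` {n. e n \<noteq> 0 \<and> \<bar>l n\<bar> \<le> 3/4}"
  have "finite ?L" using finite_eigenvalues[of "3/4"] by simp
  then have "infinite ({1/4<..<1/2} - ?L)" by (intro Diff_infinite_finite) auto
  then have "{1/4<..<1/2} - ?L \<noteq> {}" by (rule infinite_imp_nonempty)
  then obtain \<alpha> where \<alpha>: "\<alpha> \<in> {1/4<..<1/2} - ?L" by blast
  have ne: "\<bar>l n\<bar> \<noteq> \<alpha>" if "e n \<noteq> 0" for n
  proof
    assume "\<bar>l n\<bar> = \<alpha>"
    then have "\<alpha> \<in> ?L" using \<alpha> that by (intro image_eqI[of _ _ n]) auto
    then show False using \<alpha> by blast
  qed
  obtain d1 where d1: "d1 > 0" "\<And>n. e n \<noteq> 0 \<Longrightarrow> l n \<noteq> \<alpha> \<Longrightarrow> d1 \<le> \<bar>l n - \<alpha>\<bar>"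
    using eigenvalue_gap[of \<alpha>] \<alpha> by auto
  obtain d2 where d2: "d2 > 0" "\<And>n. e n \<noteq> 0 \<Longrightarrow> l n \<noteq> - \<alpha> \<Longrightarrow> d2 \<le> \<bar>l n - (- \<alpha>)\<bar>"
    using eigenvalue_gap[of "- \<alpha>"] \<alpha> by auto
  define \<eta> where "\<eta> = min (min (d1/2) (d2/2)) \<alpha>"
  have "2 * \<eta> \<le> \<bar>\<bar>l n\<bar> - \<alpha>\<bar>" if "e n \<noteq> 0" for n
  proof -
    have "l n \<noteq> \<alpha>" "l n \<noteq> - \<alpha>" using ne[OF that] \<alpha> by auto
    then have "d1 \<le> \<bar>l n - \<alpha>\<bar>" "d2 \<le> \<bar>l n + \<alpha>\<bar>" using d1(2)[OF that] d2(2)[OF that] by auto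
    then show ?thesis unfolding \<eta>_def by (simp add: min_def abs_if split: if_splits)
  qed
  moreover have "0 < \<eta>" "\<eta> \<le> \<alpha>" "\<alpha> < 1" using d1(1) d2(1) \<alpha> by (auto simp: \<eta>_def)
  ultimately show ?thesis using that by blast
qed

lemma spectral_space_cong:
  assumes "\<And>n. e n \<noteq> 0 \<Longrightarrow> l n \<in> S \<longleftrightarrow> l n \<in> S'"
  shows "spectral_space S = spectral_space S'"
  using assms by (auto simp: spectral_space_def) (metis inner_zero_right)+

text \<open>
  Let \<open>S = I - 2 P\<^sub>-\<close> with \<open>P\<^sub>-\<close> the projection onto the negative space. Then
  \<open>A\<^sup>2 - I = (A + S) (A - S)\<close>, and \<open>A + S\<close> is bounded below by \<open>1\<close> because \<open>A\<close> and \<open>S\<close>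
  never have opposite signs on an eigenvector. So the compact operator \<open>A\<^sup>2 - I\<close> dominates \<open>A - S\<close>.
\<close>

lemma compact_operator_minus_sign:
  "compact_operator (A - orth_proj W + 2 *\<^sub>R orth_proj (spectral_space {..<0}))"
proof (rule compact_operator_dominated[OF comp, where c=1])
  fix z
  let ?N = "spectral_space {..<0}"
  let ?B = "A - orth_proj W + 2 *\<^sub>R orth_proj ?N" and ?C = "(A o\<^sub>L A) - orth_proj W"
  interpret N: closed_subspace ?N by (rule closed_subspace_spectral_space)
  have AW: "A z \<in> W" for z
  proof -
    have "A z = A (orth_proj W z)" using op_orth[OF orth_proj(2)[of z]] by (simp add: blinfun.diff_right)
    then show ?thesis using op_mem[OF orth_proj(1)] by simp
  qed
  have BW: "?B z \<in> W"
    using AW orth_proj(1) subsetD[OF spectral_space_subset N.orth_proj(1)] sub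
    by (auto simp: blinfun.add_left blinfun.diff_left blinfun.scaleR_left intro!: subspace_add subspace_diff subspace_scale)
  have CW: "?C z \<in> W"
    using AW orth_proj(1) sub by (auto simp: blinfun.diff_left intro!: subspace_diff)
  have pe: "orth_proj W z \<bullet> e n = z \<bullet> e n" for n using inner_orth_proj_right[OF eW] .
  have ne: "orth_proj ?N z \<bullet> e n = (if l n < 0 then z \<bullet> e n else 0)" for n
    using N.orth_proj_sym[of z "e n"] by (simp add: orth_proj_spectral_eigenvector)
  define s where "s n = (if l n < 0 then -1 else 1 :: real)" for n
  have B: "?B z \<bullet> e n = (l n - s n) * (z \<bullet> e n)" for n
    by (simp add: blinfun.add_left blinfun.diff_left blinfun.scaleR_left inner_add_left inner_diff_left coeff_op pe ne s_def algebra_simps)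
  have C: "?C z \<bullet> e n = (l n - s n) * (l n + s n) * (z \<bullet> e n)" for n
    by (simp add: blinfun.diff_left inner_diff_left coeff_op pe s_def algebra_simps)
  have "(?B z \<bullet> e n)\<^sup>2 \<le> (?C z \<bullet> e n)\<^sup>2" for n
  proof -
    have "1 \<le> \<bar>l n + s n\<bar>" by (simp add: s_def)
    then have "\<bar>?B z \<bullet> e n\<bar> * 1 \<le> \<bar>?B z \<bullet> e n\<bar> * \<bar>l n + s n\<bar>" by (rule mult_left_mono) simp
    then have "\<bar>?B z \<bullet> e n\<bar> \<le> \<bar>?C z \<bullet> e n\<bar>" unfolding B C by (simp add: abs_mult mult_ac)
    then show ?thesis by (simp add: abs_le_square_iff)
  qed
  from sums_le[OF this expansion_norm[OF BW] expansion_norm[OF CW]]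
  have "(norm (?B z))\<^sup>2 \<le> (norm (?C z))\<^sup>2" by (simp add: power2_norm_eq_inner)
  then show "norm (?B z) \<le> 1 * norm (?C z)" by (simp add: power_mono_iff)
qed

end

lemma essential_symmetry_diagonal_symmetry:
  fixes A :: "'a::{real_inner, complete_space, second_countable_topology} \<Rightarrow>\<^sub>L 'a"
  assumes "essential_symmetry W A"
  obtains e l where "diagonal_symmetry W A e l"
proof -
  obtain e l where "diagonal_operator W A e l" using essential_symmetry_diagonal[OF assms] by blast
  then have "diagonal_symmetry W A e l" using assms
    by (simp add: diagonal_symmetry_def diagonal_symmetry_axioms_def essential_symmetry_def)
  then show ?thesis using that by blast
qed

text \<open>
  Modulo compact operators the projections onto the negative spaces are \<open>(P\<^bsub>W\<^esub> - A) / 2\<close> and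
  \<open>(P\<^bsub>W'\<^esub> - A') / 2\<close>.
\<close>

theorem commensurable_neg_space:
  fixes A A' :: "'a::{real_inner, complete_space, second_countable_topology} \<Rightarrow>\<^sub>L 'a"
  assumes A: "essential_symmetry W A" and A': "essential_symmetry W' A'"
    and "compact_operator (A - A')" "compact_operator (orth_proj W - orth_proj W')"
  shows "commensurable (neg_space W A) (neg_space W' A')"
proof -
  obtain e l where "diagonal_symmetry W A e l" using essential_symmetry_diagonal_symmetry[OF A] by blast
  then interpret d: diagonal_symmetry W A e l .
  obtain e' l' where "diagonal_symmetry W' A' e' l'" using essential_symmetry_diagonal_symmetry[OF A'] by blast
  then interpret d': diagonal_symmetry W' A' e' l' .
  let ?P = "orth_proj (d.spectral_space {..<0})" and ?P' = "orth_proj (d'.spectral_space {..<0})"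
  have "compact_operator ((1/2) *\<^sub>R ((((A - orth_proj W + 2 *\<^sub>R ?P) - (A' - orth_proj W' + 2 *\<^sub>R ?P')) - (A - A'))
      + (orth_proj W - orth_proj W')))"
    by (intro compact_operator_scaleR compact_operator_add compact_operator_diff assms
        d.compact_operator_minus_sign d'.compact_operator_minus_sign)
  also have "(1/2) *\<^sub>R ((((A - orth_proj W + 2 *\<^sub>R ?P) - (A' - orth_proj W' + 2 *\<^sub>R ?P')) - (A - A'))
      + (orth_proj W - orth_proj W')) = (1/2) *\<^sub>R (2 *\<^sub>R ?P - 2 *\<^sub>R ?P')" by simp
  also have "\<dots> = ?P - ?P'" by (simp add: scaleR_diff_right)
  finally show ?thesis
    using d.closed_subspace_spectral_space d'.closed_subspace_spectral_space
    by (simp add: commensurable_iff d.neg_space_eq d'.neg_space_eq)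
qed

section \<open>Perturbation of spectral projections\<close>

locale two_diagonal = d: diagonal_operator W A e l + d': diagonal_operator W A' e' l'
  for W :: "'a::{real_inner, complete_space} set" and A e l A' e' l'
begin

text \<open>
  An eigenvector of \<open>A'\<close> for an eigenvalue \<open>s\<close> with \<open>\<bar>s\<bar>\<close> closer than \<open>\<eta>\<close> to \<open>\<alpha>\<close> is an
  approximate eigenvector of \<open>A\<close> with error less than \<open>\<eta>\<close>. But every eigenvalue of \<open>A\<close> has
  distance at least \<open>\<eta>\<close> from \<open>s\<close>.
\<close>

lemma gap_persists:
  assumes gap: "\<And>n. e n \<noteq> 0 \<Longrightarrow> 2 * \<eta> \<le> \<bar>\<bar>l n\<bar> - \<alpha>\<bar>" and close: "norm (A - A') < \<eta>" and m: "e' m \<noteq> 0"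
  shows "\<eta> \<le> \<bar>\<bar>l' m\<bar> - \<alpha>\<bar>"
proof (rule ccontr)
  assume "\<not> ?thesis"
  then have lt: "\<bar>\<bar>l' m\<bar> - \<alpha>\<bar> < \<eta>" by simp
  have \<eta>: "\<eta> \<ge> 0" using close norm_ge_zero[of "A - A'"] by linarith
  let ?S = "{s. \<eta> \<le> \<bar>s - l' m\<bar>}"
  have "\<eta> \<le> \<bar>l n - l' m\<bar>" if "e n \<noteq> 0" for n using gap[OF that] lt by linarith
  then have "e' m \<in> d.spectral_space ?S"
    by (auto simp: d.spectral_space_def d'.eW) (metis inner_zero_right)
  then have "\<eta> * norm (e' m) \<le> norm (A (e' m) - l' m *\<^sub>R e' m)"
    by (rule d.norm_shifted_ge) (auto simp: \<eta>)
  also have "A (e' m) - l' m *\<^sub>R e' m = (A - A') (e' m)" by (simp add: blinfun.diff_left d'.eig)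
  also have "norm \<dots> \<le> norm (A - A') * norm (e' m)" by (rule norm_blinfun)
  also have "\<dots> < \<eta> * norm (e' m)" using close m by simp
  finally show False by simp
qed

text \<open>
  Let \<open>Q\<close> and \<open>Q'\<close> be the two spectral projections and \<open>X = (I - Q) Q'\<close>. Then
  \<open>A X - X A' = (I - Q) (A - A') Q'\<close>, where \<open>A\<close> is bounded below by \<open>\<alpha> + \<eta>\<close> on the range of \<open>X\<close>
  and \<open>A'\<close> is bounded by \<open>\<alpha> - \<eta>\<close> on the range of \<open>Q'\<close>. Taking norms,
  \<open>(\<alpha> + \<eta>) \<parallel>X\<parallel> \<le> (\<alpha> - \<eta>) \<parallel>X\<parallel> + \<parallel>A - A'\<parallel>\<close>.
\<close>

lemma spectral_projection_off_diagonal: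
  assumes \<eta>: "0 < \<eta>" "\<eta> \<le> \<alpha>"
    and gap: "\<And>n. e n \<noteq> 0 \<Longrightarrow> \<eta> \<le> \<bar>\<bar>l n\<bar> - \<alpha>\<bar>" and gap': "\<And>n. e' n \<noteq> 0 \<Longrightarrow> \<eta> \<le> \<bar>\<bar>l' n\<bar> - \<alpha>\<bar>"
  shows "norm ((orth_proj W - orth_proj (d.spectral_space {-\<alpha>..\<alpha>})) o\<^sub>L orth_proj (d'.spectral_space {-\<alpha>..\<alpha>}))
    \<le> norm (A - A') / (2 * \<eta>)" (is "norm ?X \<le> _")
proof -
  let ?Q = "d.spectral_space {-\<alpha>..\<alpha>}" and ?Q' = "d'.spectral_space {-\<alpha>..\<alpha>}"
  interpret Q: closed_subspace ?Q by (rule d.closed_subspace_spectral_space)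
  interpret Q': closed_subspace ?Q' by (rule d'.closed_subspace_spectral_space)
  let ?R = "orth_proj W - orth_proj ?Q"
  have R: "?R x \<in> d.spectral_space {s. \<alpha> + \<eta> \<le> \<bar>s\<bar>}" for x
  proof -
    have "?R x \<in> W" using d.orth_proj(1) Q.orth_proj(1) d.spectral_space_subset d.sub
      by (auto simp: blinfun.diff_left intro!: subspace_diff)
    moreover have "?R x \<bullet> e n = 0" if n: "\<not> \<alpha> + \<eta> \<le> \<bar>l n\<bar>" for n
    proof (cases "e n = 0")
      case False
      then have "l n \<in> {-\<alpha>..\<alpha>}" using gap[of n] n \<eta> by (auto simp: abs_if split: if_splits)
      then have "e n \<in> ?Q" by (rule d.eigenvector_mem_spectral_space)
      then show ?thesis
        using d.inner_orth_proj_right[OF d.eW] Q.inner_orth_proj_right by (simp add: blinfun.diff_left inner_diff_left)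
    qed simp
    ultimately show ?thesis by (auto simp: d.spectral_space_def)
  qed
  have Rle: "norm (?R x) \<le> norm x" for x
  proof -
    have "orth_proj ?Q x = orth_proj ?Q (orth_proj W x)"
      using d.orth_proj_spectral_orthogonal[OF d.orth_proj(2)[of x]] by (simp add: blinfun.diff_right)
    then have "norm (?R x) \<le> norm (orth_proj W x)"
      using Q.norm_diff_orth_proj_le[of "orth_proj W x"] by (simp add: blinfun.diff_left)
    then show ?thesis using d.norm_orth_proj_le[of x] by simp
  qed
  have AR: "A (?R x) = ?R (A x)" for x
  proof -
    have "A o\<^sub>L ?R = ?R o\<^sub>L A"
      by (rule d.blinfun_eqI_eigenvectors)
        (auto simp: blinfun.diff_left blinfun.diff_right d.eig blinfun.scaleR_right d.orth_proj_spectral_eigenvector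
          d.orth_proj_id d.eW d.orth_proj_zero d.orth_proj_spectral_orthogonal d.op_orth)
    then show ?thesis by (metis blinfun_apply_blinfun_compose)
  qed
  let ?D = "norm (A - A')"
  have "(\<alpha> + \<eta>) * norm (?X x) \<le> (norm ?X * (\<alpha> - \<eta>) + ?D) * norm x" for x
  proof -
    let ?y = "orth_proj ?Q' x"
    have y: "?y \<in> d'.spectral_space {s. \<bar>s\<bar> \<le> \<alpha> - \<eta>}"
    proof -
      have "?y \<bullet> e' n = 0" if n: "\<not> \<bar>l' n\<bar> \<le> \<alpha> - \<eta>" for n
      proof (cases "e' n = 0")
        case False
        then have "l' n \<notin> {-\<alpha>..\<alpha>}" using gap'[of n] n \<eta> by (auto simp: abs_if split: if_splits)
        then show ?thesis using Q'.orth_proj(1)[of x] by (auto simp: d'.spectral_space_def)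
      qed simp
      then show ?thesis using Q'.orth_proj(1)[of x] by (auto simp: d'.spectral_space_def)
    qed
    have ny: "norm ?y \<le> norm x" by (rule Q'.norm_orth_proj_le)
    have nA: "norm (A' ?y) \<le> (\<alpha> - \<eta>) * norm x"
      using d'.norm_op_le[OF y, of "\<alpha> - \<eta>"] \<eta> mult_left_mono[OF ny, of "\<alpha> - \<eta>"] by simp
    have "A' ?y \<in> ?Q'" by (rule d'.spectral_space_invariant) (rule Q'.orth_proj)
    then have XA: "?X (A' ?y) = ?R (A' ?y)" by (simp add: Q'.orth_proj_id)
    have "(\<alpha> + \<eta>) * norm (?X x) \<le> norm (A (?R ?y))"
      using d.norm_op_ge[OF R[of ?y], of "\<alpha> + \<eta>"] \<eta> by simp
    also have "A (?R ?y) = ?X (A' ?y) + ?R ((A - A') ?y)"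
      unfolding XA AR by (simp only: blinfun.diff_left[of A A'] blinfun.diff_right[of ?R]) simp
    also have "norm \<dots> \<le> norm (?X (A' ?y)) + norm (?R ((A - A') ?y))" by (rule norm_triangle_ineq)
    also have "\<dots> \<le> norm ?X * norm (A' ?y) + ?D * norm ?y"
      using order_trans[OF Rle norm_blinfun[of "A - A'" ?y]] by (intro add_mono norm_blinfun)
    also have "\<dots> \<le> norm ?X * ((\<alpha> - \<eta>) * norm x) + ?D * norm x"
      by (intro add_mono mult_left_mono nA ny) auto
    finally show ?thesis by (simp add: algebra_simps)
  qed
  then have "norm (?X x) \<le> (norm ?X * (\<alpha> - \<eta>) + ?D) / (\<alpha> + \<eta>) * norm x" for x
    using \<eta> by (simp add: field_simps)
  moreover have "0 \<le> (norm ?X * (\<alpha> - \<eta>) + ?D) / (\<alpha> + \<eta>)" using \<eta> by auto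
  ultimately have "norm ?X \<le> (norm ?X * (\<alpha> - \<eta>) + ?D) / (\<alpha> + \<eta>)" by (intro norm_blinfun_bound)
  then show ?thesis using \<eta> by (simp add: field_simps)
qed

end

text \<open>
  In \<open>Q - Q' = Q (I - Q') - (I - Q) Q'\<close> the first term is the adjoint of the off-diagonal term with
  the roles of the two operators exchanged.
\<close>

lemma spectral_projection_close:
  fixes W :: "'a::{real_inner, complete_space} set"
  assumes d: "diagonal_operator W A e l" and d': "diagonal_operator W A' e' l'"
    and \<eta>: "0 < \<eta>" "\<eta> \<le> \<alpha>"
    and gap: "\<And>n. e n \<noteq> 0 \<Longrightarrow> \<eta> \<le> \<bar>\<bar>l n\<bar> - \<alpha>\<bar>" and gap': "\<And>n. e' n \<noteq> 0 \<Longrightarrow> \<eta> \<le> \<bar>\<bar>l' n\<bar> - \<alpha>\<bar>"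
  shows "norm (spectral_proj W A {-\<alpha>..\<alpha>} - spectral_proj W A' {-\<alpha>..\<alpha>}) \<le> norm (A - A') / \<eta>"
proof -
  interpret d: diagonal_operator W A e l by fact
  interpret d': diagonal_operator W A' e' l' by fact
  interpret t: two_diagonal W A e l A' e' l' ..
  interpret t': two_diagonal W A' e' l' A e l ..
  let ?Q = "d.spectral_space {-\<alpha>..\<alpha>}" and ?Q' = "d'.spectral_space {-\<alpha>..\<alpha>}"
  interpret Q: closed_subspace ?Q by (rule d.closed_subspace_spectral_space)
  interpret Q': closed_subspace ?Q' by (rule d'.closed_subspace_spectral_space)
  let ?X = "(orth_proj W - orth_proj ?Q) o\<^sub>L orth_proj ?Q'" and ?X' = "(orth_proj W - orth_proj ?Q') o\<^sub>L orth_proj ?Q"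
  have X: "norm ?X \<le> norm (A - A') / (2 * \<eta>)" by (rule t.spectral_projection_off_diagonal[OF \<eta> gap gap'])
  have X': "norm ?X' \<le> norm (A - A') / (2 * \<eta>)"
    using t'.spectral_projection_off_diagonal[OF \<eta> gap' gap] by (simp add: norm_minus_commute)
  have "norm (orth_proj ?Q - orth_proj ?Q') \<le> norm ?X + norm ?X'"
  proof (rule norm_blinfun_bound)
    fix x
    define y where "y = orth_proj ?Q x - orth_proj ?Q (orth_proj ?Q' x)"
    have "orth_proj W (orth_proj ?Q' x) = orth_proj ?Q' x"
      using Q'.orth_proj(1) d'.spectral_space_subset d.orth_proj_id by blast
    then have 1: "orth_proj ?Q x - orth_proj ?Q' x = y - ?X x" by (simp add: blinfun.diff_left y_def)
    have yQ: "y \<in> ?Q" unfolding y_def using Q.orth_proj(1) Q.sub by (intro subspace_diff)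
    have yW: "y \<in> W" using yQ d.spectral_space_subset by blast
    have "y \<bullet> y = y \<bullet> (x - orth_proj ?Q' x)"
      using Q.inner_orth_proj_left[OF yQ, of "x - orth_proj ?Q' x"] by (simp add: blinfun.diff_right y_def)
    also have "\<dots> = (y - orth_proj ?Q' y) \<bullet> x"
      using Q'.orth_proj_sym[of y x] by (simp add: inner_diff_left inner_diff_right)
    also have "\<dots> = ?X' y \<bullet> x"
      using yW yQ by (simp add: blinfun.diff_left d.orth_proj_id Q.orth_proj_id)
    also have "\<dots> \<le> norm (?X' y) * norm x" by (rule norm_cauchy_schwarz)
    also have "\<dots> \<le> norm ?X' * norm y * norm x" by (intro mult_right_mono norm_blinfun) simp
    finally have "norm y * norm y \<le> norm y * (norm ?X' * norm x)"
      by (simp add: dot_square_norm power2_eq_square mult_ac)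
    then have "norm y \<le> norm ?X' * norm x" by (cases "y = 0") simp_all
    then have "norm (orth_proj ?Q x - orth_proj ?Q' x) \<le> norm ?X' * norm x + norm ?X * norm x"
      unfolding 1 using norm_triangle_ineq4[of y "?X x"] norm_blinfun[of ?X x] by linarith
    then show "norm ((orth_proj ?Q - orth_proj ?Q') x) \<le> (norm ?X + norm ?X') * norm x"
      by (simp add: blinfun.diff_left algebra_simps)
  qed simp
  also have "\<dots> \<le> norm (A - A') / \<eta>" using X X' by (simp add: field_simps)
  finally show ?thesis by (simp add: d.spectral_proj_eq d'.spectral_proj_eq)
qed

lemma dim_eq_of_close_projections:
  fixes F G :: "'a::{real_inner, complete_space} set"
  assumes F: "subspace F" "finite_dimensional F" and G: "subspace G" "finite_dimensional G"
    and close: "norm (orth_proj F - orth_proj G) < 1"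
  shows "dim F = dim G"
proof -
  have *: "dim F \<le> dim G"
    if F: "subspace F" "finite_dimensional F" and G: "subspace G" "finite_dimensional G"
      and close: "norm (orth_proj F - orth_proj G) < 1" for F G :: "'a set"
  proof -
    interpret F: closed_subspace F using closed_subspace_finite_dimensional F by blast
    interpret G: closed_subspace G using closed_subspace_finite_dimensional G by blast
    show ?thesis
    proof (rule finite_dimensional_injective(2)[OF linear_blinfun_apply F(1) _ G.orth_proj(1) G(2)])
      fix x assume x: "x \<in> F" "orth_proj G x = 0"
      then have "norm x \<le> norm (orth_proj F - orth_proj G) * norm x"
        using norm_blinfun[of "orth_proj F - orth_proj G" x] by (simp add: blinfun.diff_left F.orth_proj_id)
      then show "x = 0" using close by (metis mult_less_cancel_right2 norm_ge_zero norm_le_zero_iff not_le)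
    qed
  qed
  show ?thesis using *[OF F G close] *[OF G F] close by (simp add: norm_minus_commute)
qed



section \<open>Spectral flow as a relative dimension\<close>

definition spectral_window ::
    "'a::real_inner set \<Rightarrow> (real \<Rightarrow> 'a \<Rightarrow>\<^sub>L 'a) \<Rightarrow> real \<Rightarrow> real \<Rightarrow> real \<Rightarrow> bool" where
  "spectral_window W T s t \<alpha> \<longleftrightarrow> s < t \<and> \<alpha> > 0 \<and>
     continuous_on {s..t} (\<lambda>u. spectral_proj W (T u) {- \<alpha>..\<alpha>}) \<and>
     (\<forall>u\<in>{s..t}. finite_dimensional (range (spectral_proj W (T u) {- \<alpha>..\<alpha>})))"

definition spectral_partition ::
    "'a::real_inner set \<Rightarrow> (real \<Rightarrow> 'a \<Rightarrow>\<^sub>L 'a) \<Rightarrow> real \<Rightarrow> real \<Rightarrow> nat \<Rightarrow> (nat \<Rightarrow> real) \<Rightarrow> (nat \<Rightarrow> real) \<Rightarrow> bool" where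
  "spectral_partition W T a b N \<tau> \<alpha> \<longleftrightarrow> \<tau> 0 = a \<and> \<tau> N = b \<and>
     (\<forall>i\<in>{1..N}. spectral_window W T (\<tau> (i - 1)) (\<tau> i) (\<alpha> i))"

lemma has_spectral_flow_iff:
  "has_spectral_flow W T a b n \<longleftrightarrow> (\<exists>N \<tau> \<alpha>. spectral_partition W T a b N \<tau> \<alpha> \<and>
     n = (\<Sum>i=1..N. int (dim (range (spectral_proj W (T (\<tau> i)) {0..\<alpha> i})))
                     - int (dim (range (spectral_proj W (T (\<tau> (i - 1))) {0..\<alpha> i})))))"
  unfolding has_spectral_flow_def spectral_partition_def spectral_window_def by (simp add: conj_assoc)

lemma spectral_partition_append:
  assumes 1: "spectral_partition W T a b N \<tau> \<alpha>" and 2: "spectral_partition W T b c N' \<tau>' \<alpha>'"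
  shows "spectral_partition W T a c (N + N') (\<lambda>i. if i \<le> N then \<tau> i else \<tau>' (i - N)) (\<lambda>i. if i \<le> N then \<alpha> i else \<alpha>' (i - N))"
    (is "spectral_partition W T a c _ ?\<tau> ?\<alpha>")
  unfolding spectral_partition_def
proof (intro conjI ballI)
  show "?\<tau> 0 = a" "?\<tau> (N + N') = c" using 1 2 by (auto simp: spectral_partition_def)
  fix i assume i: "i \<in> {1..N + N'}"
  show "spectral_window W T (?\<tau> (i - 1)) (?\<tau> i) (?\<alpha> i)"
  proof (cases "i \<le> N")
    case True
    then have "spectral_window W T (\<tau> (i - 1)) (\<tau> i) (\<alpha> i)" using 1 i by (simp add: spectral_partition_def)
    moreover have "i - 1 \<le> N" using True by simp
    ultimately show ?thesis using True by simp
  next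
    case False
    define j where "j = i - N"
    have j: "j \<in> {1..N'}" "i = N + j" using False i by (auto simp: j_def)
    have w: "spectral_window W T (\<tau>' (j - 1)) (\<tau>' j) (\<alpha>' j)" using 2 j by (simp add: spectral_partition_def)
    have "\<tau> N = \<tau>' 0" using 1 2 by (simp add: spectral_partition_def)
    then have "?\<tau> (i - 1) = \<tau>' (j - 1)" using j by (cases "j = 1") auto
    moreover have "?\<tau> i = \<tau>' j" "?\<alpha> i = \<alpha>' j" using j by auto
    ultimately show ?thesis using w by simp
  qed
qed

locale symmetry_path =
  fixes W :: "'a::{real_inner, complete_space, second_countable_topology} set"
    and T :: "real \<Rightarrow> 'a \<Rightarrow>\<^sub>L 'a" and a b :: real
  assumes es: "t \<in> {a..b} \<Longrightarrow> essential_symmetry W (T t)"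
    and diff: "s \<in> {a..b} \<Longrightarrow> t \<in> {a..b} \<Longrightarrow> compact_operator (T s - T t)"
    and cont: "continuous_on {a..b} T"
begin

text \<open>
  An eigenbasis is fixed for every \<open>t\<close>. The choice is not continuous in \<open>t\<close>; only the spectral
  projections built from it are compared for different parameters.
\<close>

definition ebasis :: "real \<Rightarrow> (nat \<Rightarrow> 'a) \<times> (nat \<Rightarrow> real)" where
  "ebasis t = (SOME p. diagonal_symmetry W (T t) (fst p) (snd p))"

abbreviation "e t \<equiv> fst (ebasis t)"
abbreviation "l t \<equiv> snd (ebasis t)"
abbreviation "R t \<equiv> diagonal_operator.spectral_space W (e t) (l t)"
abbreviation "N t \<equiv> neg_space W (T t)"

lemma diag: "t \<in> {a..b} \<Longrightarrow> diagonal_symmetry W (T t) (e t) (l t)"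
proof -
  assume "t \<in> {a..b}"
  then obtain e l where "diagonal_symmetry W (T t) e l"
    using essential_symmetry_diagonal_symmetry[OF es] by blast
  then have "\<exists>p. diagonal_symmetry W (T t) (fst p) (snd p)" by (intro exI[of _ "(e, l)"]) simp
  then show ?thesis unfolding ebasis_def by (rule someI_ex)
qed

lemma diag': "t \<in> {a..b} \<Longrightarrow> diagonal_operator W (T t) (e t) (l t)"
  using diag by (simp add: diagonal_symmetry_def)

lemma commensurable_N: "s \<in> {a..b} \<Longrightarrow> t \<in> {a..b} \<Longrightarrow> commensurable (N s) (N t)"
  using es diff by (intro commensurable_neg_space) (auto simp: compact_operator_zero)

lemma cont_at:
  assumes "t \<in> {a..b}" "d > 0"
  obtains \<delta> where "\<delta> > 0" "\<And>s. s \<in> {a..b} \<Longrightarrow> \<bar>s - t\<bar> < \<delta> \<Longrightarrow> norm (T s - T t) < d"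
proof -
  have "\<exists>\<delta>>0. \<forall>s\<in>{a..b}. dist s t < \<delta> \<longrightarrow> dist (T s) (T t) < d"
    using cont assms unfolding continuous_on_iff by blast
  then show ?thesis using that by (auto simp: dist_norm)
qed

text \<open>
  A gap of \<open>T\<^sub>t\<close> around \<open>\<plusminus>\<alpha>\<close> persists near \<open>t\<close>, where the projections \<open>\<chi>\<^bsub>[-\<alpha>,\<alpha>]\<^esub>\<close> then
  depend Lipschitz-continuously on the operator.
\<close>

lemma local_spectral_window:
  assumes t: "t \<in> {a..b}"
  obtains \<delta> \<alpha> where "\<delta> > 0" "\<alpha> > 0"
    "continuous_on {s \<in> {a..b}. \<bar>s - t\<bar> < \<delta>} (\<lambda>s. spectral_proj W (T s) {-\<alpha>..\<alpha>})"
    "\<And>s. s \<in> {a..b} \<Longrightarrow> finite_dimensional (range (spectral_proj W (T s) {-\<alpha>..\<alpha>}))"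
proof -
  interpret d: diagonal_symmetry W "T t" "e t" "l t" using diag[OF t] .
  obtain \<alpha> \<eta> where \<alpha>: "0 < \<eta>" "\<eta> \<le> \<alpha>" "\<alpha> < 1"
    and gap: "\<And>n. e t n \<noteq> 0 \<Longrightarrow> 2 * \<eta> \<le> \<bar>\<bar>l t n\<bar> - \<alpha>\<bar>"
    by (rule d.symmetric_gap) (rule that)
  obtain \<delta> where \<delta>: "\<delta> > 0" "\<And>s. s \<in> {a..b} \<Longrightarrow> \<bar>s - t\<bar> < \<delta> \<Longrightarrow> norm (T s - T t) < \<eta>"
    by (rule cont_at[OF t \<alpha>(1)]) (rule that)
  let ?U = "{s \<in> {a..b}. \<bar>s - t\<bar> < \<delta>}"
  have gap': "\<eta> \<le> \<bar>\<bar>l s n\<bar> - \<alpha>\<bar>" if s: "s \<in> ?U" and n: "e s n \<noteq> 0" for s n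
  proof -
    interpret two_diagonal W "T t" "e t" "l t" "T s" "e s" "l s"
      using diag'[of s] diag'[OF t] s by (simp add: two_diagonal_def)
    have close: "norm (T t - T s) < \<eta>" using \<delta>(2)[of s] s by (simp add: norm_minus_commute)
    show ?thesis by (rule gap_persists[where \<eta>=\<eta> and \<alpha>=\<alpha>, OF gap close n])
  qed
  have lip: "norm (spectral_proj W (T s) {-\<alpha>..\<alpha>} - spectral_proj W (T s') {-\<alpha>..\<alpha>}) \<le> norm (T s - T s') / \<eta>"
    if "s \<in> ?U" "s' \<in> ?U" for s s'
    by (rule spectral_projection_close[OF diag' diag' \<alpha>(1,2) gap' gap']) (use that in auto)
  have "continuous_on ?U (\<lambda>s. spectral_proj W (T s) {-\<alpha>..\<alpha>})"
    unfolding continuous_on_iff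
  proof (intro ballI allI impI)
    fix s and d :: real assume s: "s \<in> ?U" and d: "0 < d"
    then have "s \<in> {a..b}" "0 < d * \<eta>" using \<alpha>(1) by auto
    then obtain \<epsilon> where \<epsilon>: "\<epsilon> > 0" "\<And>s'. s' \<in> {a..b} \<Longrightarrow> \<bar>s' - s\<bar> < \<epsilon> \<Longrightarrow> norm (T s' - T s) < d * \<eta>"
      by (rule cont_at) (rule that)
    show "\<exists>\<epsilon>>0. \<forall>s'\<in>?U. dist s' s < \<epsilon> \<longrightarrow> dist (spectral_proj W (T s') {-\<alpha>..\<alpha>}) (spectral_proj W (T s) {-\<alpha>..\<alpha>}) < d"
    proof (intro exI conjI ballI impI)
      fix s' assume s': "s' \<in> ?U" "dist s' s < \<epsilon>"
      have "norm (T s' - T s) / \<eta> < d" using \<epsilon>(2)[of s'] s' \<alpha>(1) by (simp add: dist_real_def field_simps)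
      then show "dist (spectral_proj W (T s') {-\<alpha>..\<alpha>}) (spectral_proj W (T s) {-\<alpha>..\<alpha>}) < d"
        using lip[OF s'(1) s] by (simp add: dist_norm)
    qed (rule \<epsilon>(1))
  qed
  moreover have "finite_dimensional (range (spectral_proj W (T s) {-\<alpha>..\<alpha>}))" if s: "s \<in> {a..b}" for s
  proof -
    interpret s: diagonal_symmetry W "T s" "e s" "l s" using diag[OF s] .
    show ?thesis using s.finite_dimensional_spectral_space[of "{-\<alpha>..\<alpha>}" \<alpha>] \<alpha> by (simp add: s.range_spectral_proj abs_le_iff)
  qed
  moreover have "\<alpha> > 0" using \<alpha> by simp
  ultimately show ?thesis using that[OF \<delta>(1)] by blast
qed

text \<open>
  Partitions of adjacent intervals can be joined, and a short interval is a single window, so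
  bisection applies.
\<close>

lemma spectral_partition_exists:
  assumes "a \<le> b"
  shows "\<exists>N \<tau> \<alpha>. spectral_partition W T a b N \<tau> \<alpha>"
proof -
  define P where "P s t \<longleftrightarrow> (s \<in> {a..b} \<longrightarrow> t \<in> {a..b} \<longrightarrow> s \<le> t \<longrightarrow> (\<exists>N \<tau> \<alpha>. spectral_partition W T s t N \<tau> \<alpha>))" for s t
  have "P a b" using assms
  proof (induction rule: Bolzano)
    case (trans s t u)
    show ?case unfolding P_def
    proof (intro impI)
      assume "s \<in> {a..b}" "u \<in> {a..b}"
      then have "t \<in> {a..b}" using trans(3,4) by auto
      then obtain N \<tau> \<alpha> N' \<tau>' \<alpha>' where "spectral_partition W T s t N \<tau> \<alpha>" "spectral_partition W T t u N' \<tau>' \<alpha>'"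
        using trans \<open>s \<in> {a..b}\<close> \<open>u \<in> {a..b}\<close> unfolding P_def by blast
      from spectral_partition_append[OF this]
      show "\<exists>N \<tau> \<alpha>. spectral_partition W T s u N \<tau> \<alpha>" by (intro exI)
    qed
  next
    case (local t)
    then have "t \<in> {a..b}" by simp
    then obtain \<delta> \<alpha> where \<delta>: "\<delta> > 0" "\<alpha> > 0"
      "continuous_on {s \<in> {a..b}. \<bar>s - t\<bar> < \<delta>} (\<lambda>s. spectral_proj W (T s) {-\<alpha>..\<alpha>})"
      "\<And>s. s \<in> {a..b} \<Longrightarrow> finite_dimensional (range (spectral_proj W (T s) {-\<alpha>..\<alpha>}))"
      by (rule local_spectral_window) (rule that)
    show ?case
    proof (intro exI conjI allI impI)
      show "\<delta> > 0" by fact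
      fix s u assume su: "s \<le> t \<and> t \<le> u \<and> u - s < \<delta>"
      show "P s u" unfolding P_def
      proof (intro impI)
        assume ab: "s \<in> {a..b}" "u \<in> {a..b}"
        show "\<exists>N \<tau> \<alpha>. spectral_partition W T s u N \<tau> \<alpha>"
        proof (cases "s = u")
          case True
          then have "spectral_partition W T s u 0 (\<lambda>_. s) (\<lambda>_. 1)" by (simp add: spectral_partition_def)
          then show ?thesis by blast
        next
          case False
          have sub: "{s..u} \<subseteq> {s \<in> {a..b}. \<bar>s - t\<bar> < \<delta>}" using su ab by auto
          have "spectral_partition W T s u 1 (\<lambda>i. if i = 0 then s else u) (\<lambda>_. \<alpha>)"
            using False su \<delta>(2) continuous_on_subset[OF \<delta>(3) sub] \<delta>(4) sub
            by (auto simp: spectral_partition_def spectral_window_def)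
          then show ?thesis by blast
        qed
      qed
    qed
  qed
  then show ?thesis using assms by (simp add: P_def)
qed

lemma neg_space_spectral: "t \<in> {a..b} \<Longrightarrow> N t = R t {..<0}"
  using diagonal_operator.neg_space_eq[OF diag'] .

text \<open>
  On the range of \<open>\<chi>\<^bsub>[-\<alpha>,\<alpha>]\<^esub>(T\<^sub>u)\<close> the operator \<open>T\<^sub>u\<close> is replaced by multiplication by \<open>\<alpha>\<close>. The
  result is continuous in \<open>u\<close> wherever the projection is, has no spectrum in \<open>(-\<alpha>,\<alpha>)\<close>, and its
  negative space is the part of \<open>V\<^sup>-(T\<^sub>u)\<close> below \<open>-\<alpha>\<close>. The spectral flow is defined without a gap
  of \<open>T\<^sub>u\<close> at the ends of the window; the replacement creates one around \<open>0\<close>.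
\<close>

lemma rel_dim_below_window:
  assumes u: "u \<in> {a..b}" and v: "v \<in> {a..b}" and \<alpha>: "\<alpha> > 0"
    and close: "norm ((T u - (T u o\<^sub>L spectral_proj W (T u) {-\<alpha>..\<alpha>}) + \<alpha> *\<^sub>R spectral_proj W (T u) {-\<alpha>..\<alpha>})
       - (T v - (T v o\<^sub>L spectral_proj W (T v) {-\<alpha>..\<alpha>}) + \<alpha> *\<^sub>R spectral_proj W (T v) {-\<alpha>..\<alpha>})) < 2 * \<alpha>"
  shows "rel_dim (R u {..<-\<alpha>}) (R v {..<-\<alpha>}) = 0"
proof -
  define A where "A u = T u - (T u o\<^sub>L spectral_proj W (T u) {-\<alpha>..\<alpha>}) + \<alpha> *\<^sub>R spectral_proj W (T u) {-\<alpha>..\<alpha>}" for u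
  have neg: "A u x \<bullet> x \<le> - \<alpha> * (x \<bullet> x)" if u: "u \<in> {a..b}" and x: "x \<in> R u {..<-\<alpha>}" for u x
  proof -
    interpret d: diagonal_operator W "T u" "e u" "l u" using diag'[OF u] .
    interpret Q: closed_subspace "R u {-\<alpha>..\<alpha>}" by (rule d.closed_subspace_spectral_space)
    have "R u {..<-\<alpha>} \<subseteq> R u (- {-\<alpha>..\<alpha>})" by (rule d.spectral_space_mono) auto
    then have "x \<in> (R u {-\<alpha>..\<alpha>})\<^sup>\<bottom>" using x d.spectral_space_complement by blast
    then have "A u x = T u x"
      by (simp add: A_def d.spectral_proj_eq Q.orth_proj_zero blinfun.diff_left blinfun.add_left blinfun.scaleR_left)
    then show ?thesis using d.form_le[OF x, of "-\<alpha>"] by simp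
  qed
  have pos: "A u x \<bullet> x \<ge> \<alpha> * (x \<bullet> x)" if u: "u \<in> {a..b}" and x: "x \<in> W" "x \<in> (R u {..<-\<alpha>})\<^sup>\<bottom>" for u x
  proof -
    interpret d: diagonal_operator W "T u" "e u" "l u" using diag'[OF u] .
    interpret Q: closed_subspace "R u {-\<alpha>..\<alpha>}" by (rule d.closed_subspace_spectral_space)
    have x': "x \<in> R u (- {..<-\<alpha>})" using x d.spectral_space_orthogonal by blast
    define p where "p = orth_proj (R u {-\<alpha>..\<alpha>}) x"
    define q where "q = x - p"
    have p: "p \<in> R u {-\<alpha>..\<alpha>}" unfolding p_def by (rule Q.orth_proj)
    have "R u {-\<alpha>..\<alpha>} \<subseteq> R u (- {..<-\<alpha>})" by (rule d.spectral_space_mono) auto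
    then have "q \<in> R u (- {..<-\<alpha>}) \<inter> (R u {-\<alpha>..\<alpha>})\<^sup>\<bottom>" unfolding q_def p_def
      by (intro closed_subspace_orthogonal_decomp[OF Q.closed_subspace_axioms d.closed_subspace_spectral_space _ x'])
    then have "q \<in> R u (- {..<-\<alpha>} - {-\<alpha>..\<alpha>})" using d.spectral_space_diff by blast
    also have "- {..<-\<alpha>} - {-\<alpha>..\<alpha>} = {\<alpha><..}" using \<alpha> by auto
    finally have q: "q \<in> R u {\<alpha><..}" .
    have orth: "y \<bullet> p = 0" if "y \<in> R u {\<alpha><..}" for y
    proof -
      have "R u {\<alpha><..} \<subseteq> R u (- {-\<alpha>..\<alpha>})" by (rule d.spectral_space_mono) auto
      then have "y \<in> (R u {-\<alpha>..\<alpha>})\<^sup>\<bottom>" using that d.spectral_space_complement by blast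
      then show ?thesis using p orthogonal_compD by blast
    qed
    have Tq: "T u q \<bullet> p = 0" "q \<bullet> p = 0" using orth[OF d.spectral_space_invariant[OF q]] orth[OF q] by auto
    have "A u x = T u q + \<alpha> *\<^sub>R p"
      by (simp add: A_def d.spectral_proj_eq p_def[symmetric] q_def blinfun.diff_left blinfun.diff_right
          blinfun.add_left blinfun.scaleR_left)
    moreover have x: "x = p + q" by (simp add: q_def)
    ultimately have "A u x \<bullet> x = T u q \<bullet> q + \<alpha> * (p \<bullet> p)"
      using Tq by (simp add: inner_add_left inner_add_right inner_commute[of p q])
    moreover have "T u q \<bullet> q \<ge> \<alpha> * (q \<bullet> q)" using d.form_ge[OF q, of \<alpha>] by simp
    moreover have "x \<bullet> x = p \<bullet> p + q \<bullet> q" using Tq x by (simp add: inner_add inner_commute[of p q])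
    ultimately show ?thesis by (simp add: distrib_left)
  qed
  show ?thesis
  proof (rule rel_dim_zero_of_close_forms[where A="A u" and B="A v" and c=\<alpha> and W=W])
    show "R u {..<-\<alpha>} \<subseteq> W" "R v {..<-\<alpha>} \<subseteq> W"
      using diagonal_operator.spectral_space_subset[OF diag'] u v by blast+
    show "norm (A u - A v) < 2 * \<alpha>" using close by (simp add: A_def)
  qed (use neg pos u v in auto)
qed

lemma window_decomposition:
  assumes t: "t \<in> {a..b}" and \<alpha>: "\<alpha> > 0" and fd: "finite_dimensional (R t {-\<alpha>..\<alpha>})"
  shows "commensurable (N t) (R t {..<-\<alpha>})"
    "rel_dim (N t) (R t {..<-\<alpha>}) = int (dim (R t {-\<alpha>..\<alpha>})) - int (dim (R t {0..\<alpha>}))"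
proof -
  interpret d: diagonal_operator W "T t" "e t" "l t" using diag'[OF t] .
  have sub: "subspace (R t S)" for S using d.closed_subspace_spectral_space[of S] by (simp add: closed_subspace_def)
  have "R t {..<0} \<inter> (R t {..<-\<alpha>})\<^sup>\<bottom> = R t ({..<0} - {..<-\<alpha>})" by (rule d.spectral_space_diff)
  also have "{..<0} - {..<-\<alpha>} = {-\<alpha>..<0}" using \<alpha> by auto
  finally have 1: "N t \<inter> (R t {..<-\<alpha>})\<^sup>\<bottom> = R t {-\<alpha>..<0}" using neg_space_spectral[OF t] by simp
  have "R t {-\<alpha>..\<alpha>} \<inter> (R t {0..\<alpha>})\<^sup>\<bottom> = R t ({-\<alpha>..\<alpha>} - {0..\<alpha>})" by (rule d.spectral_space_diff)
  also have "{-\<alpha>..\<alpha>} - {0..\<alpha>} = {-\<alpha>..<0}" using \<alpha> by auto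
  finally have 2: "R t {-\<alpha>..\<alpha>} \<inter> (R t {0..\<alpha>})\<^sup>\<bottom> = R t {-\<alpha>..<0}" .
  have "R t {0..\<alpha>} \<subseteq> R t {-\<alpha>..\<alpha>}" using \<alpha> by (intro d.spectral_space_mono) auto
  from dim_orthogonal_split[OF sub fd sub this]
  have dims: "dim (R t {-\<alpha>..\<alpha>}) = dim (R t {0..\<alpha>}) + dim (R t {-\<alpha>..<0})" using 2 by simp
  have "R t {-\<alpha>..<0} \<subseteq> R t {-\<alpha>..\<alpha>}" using \<alpha> by (intro d.spectral_space_mono) auto
  then have fd': "finite_dimensional (N t \<inter> (R t {..<-\<alpha>})\<^sup>\<bottom>)" using fd finite_dimensional_subset 1 by metis
  have sub': "R t {..<-\<alpha>} \<subseteq> N t" unfolding neg_space_spectral[OF t] using \<alpha> by (intro d.spectral_space_mono) auto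
  have cl: "closed_subspace (N t)" unfolding neg_space_spectral[OF t] by (rule d.closed_subspace_spectral_space)
  show "commensurable (N t) (R t {..<-\<alpha>})"
    "rel_dim (N t) (R t {..<-\<alpha>}) = int (dim (R t {-\<alpha>..\<alpha>})) - int (dim (R t {0..\<alpha>}))"
    using commensurable_finite_extension[OF d.closed_subspace_spectral_space cl sub' fd'] dims 1 by simp_all
qed

text \<open>
  For nearby parameters the windows have the same rank, and the parts of the negative spaces below
  the window have relative dimension \<open>0\<close>. So what the window gains in \<open>[0,\<alpha>]\<close> it loses in
  \<open>[-\<alpha>,0)\<close>, and this is the change of the negative space. Both sides are additive over adjacent
  intervals, so the local statement suffices.
\<close>

lemma rel_dim_window:
  assumes st: "a \<le> s" "s \<le> t" "t \<le> b" and \<alpha>: "\<alpha> > 0"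
    and contP: "continuous_on {s..t} (\<lambda>u. spectral_proj W (T u) {-\<alpha>..\<alpha>})"
    and fdP: "\<And>u. u \<in> {s..t} \<Longrightarrow> finite_dimensional (range (spectral_proj W (T u) {-\<alpha>..\<alpha>}))"
  shows "int (dim (range (spectral_proj W (T t) {0..\<alpha>}))) - int (dim (range (spectral_proj W (T s) {0..\<alpha>})))
    = rel_dim (N s) (N t)"
proof -
  let ?P = "\<lambda>u. spectral_proj W (T u) {-\<alpha>..\<alpha>}"
  have rng: "range (spectral_proj W (T u) S) = R u S" if "u \<in> {a..b}" "S \<in> sets borel" for u S
    using diagonal_operator.range_spectral_proj[OF diag'] that by blast
  have sub: "{s..t} \<subseteq> {a..b}" using st by auto
  define A where "A u = T u - (T u o\<^sub>L ?P u) + \<alpha> *\<^sub>R ?P u" for u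
  have contA: "continuous_on {s..t} A" unfolding A_def
    by (intro continuous_intros bounded_bilinear.continuous_on[OF bounded_bilinear_blinfun_compose]
        continuous_on_subset[OF cont sub] contP)
  define Q where "Q u v \<longleftrightarrow> (u \<in> {s..t} \<longrightarrow> v \<in> {s..t} \<longrightarrow>
     int (dim (R v {0..\<alpha>})) - int (dim (R u {0..\<alpha>})) = rel_dim (N u) (N v))" for u v
  have "Q s t" using st(2)
  proof (induction rule: Bolzano)
    case (trans u v w)
    show ?case unfolding Q_def
    proof (intro impI)
      assume uw: "u \<in> {s..t}" "w \<in> {s..t}"
      then have v: "v \<in> {s..t}" using trans(3,4) by auto
      have "rel_dim (N u) (N v) + rel_dim (N v) (N w) = rel_dim (N u) (N w)"
        using uw v sub by (intro rel_dim_add commensurable_N) auto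
      then show "int (dim (R w {0..\<alpha>})) - int (dim (R u {0..\<alpha>})) = rel_dim (N u) (N w)"
        using trans(1,2) uw v by (simp add: Q_def)
    qed
  next
    case (local x)
    then have x: "x \<in> {s..t}" by simp
    obtain d1 where d1: "d1 > 0" "\<And>u. u \<in> {s..t} \<Longrightarrow> dist u x < d1 \<Longrightarrow> dist (A u) (A x) < \<alpha>"
      using contA x \<alpha> unfolding continuous_on_iff by metis
    obtain d2 where d2: "d2 > 0" "\<And>u. u \<in> {s..t} \<Longrightarrow> dist u x < d2 \<Longrightarrow> dist (?P u) (?P x) < 1/2"
      using contP x unfolding continuous_on_iff by (metis half_gt_zero zero_less_one)
    show ?case
    proof (intro exI conjI allI impI)
      show "min d1 d2 > 0" using d1 d2 by simp
      fix u v assume uv: "u \<le> x \<and> x \<le> v \<and> v - u < min d1 d2"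
      show "Q u v" unfolding Q_def
      proof (intro impI)
        assume u: "u \<in> {s..t}" and v: "v \<in> {s..t}"
        have u': "u \<in> {a..b}" and v': "v \<in> {a..b}" using u v sub by auto
        have "dist u x < d1" "dist u x < d2" "dist v x < d1" "dist v x < d2"
          using uv by (auto simp: dist_real_def)
        then have dA: "dist (A u) (A x) < \<alpha>" "dist (A v) (A x) < \<alpha>"
          and dP: "dist (?P u) (?P x) < 1/2" "dist (?P v) (?P x) < 1/2" using d1(2) d2(2) u v by auto
        have "norm (A u - A v) < 2 * \<alpha>"
          using dA dist_triangle2[of "A u" "A v" "A x"] by (simp add: dist_norm)
        then have 0: "rel_dim (R u {..<-\<alpha>}) (R v {..<-\<alpha>}) = 0"
          unfolding A_def by (rule rel_dim_below_window[OF u' v' \<alpha>])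
        have fd: "finite_dimensional (R u {-\<alpha>..\<alpha>})" "finite_dimensional (R v {-\<alpha>..\<alpha>})"
          using fdP[OF u] fdP[OF v] rng u' v' by auto
        note wu = window_decomposition[OF u' \<alpha> fd(1)] and wv = window_decomposition[OF v' \<alpha> fd(2)]
        have PR: "?P w = orth_proj (R w {-\<alpha>..\<alpha>})" if "w \<in> {a..b}" for w
          using diagonal_operator.spectral_proj_eq[OF diag'[OF that]] by simp
        have sR: "subspace (R w {-\<alpha>..\<alpha>})" if "w \<in> {a..b}" for w
          using diagonal_operator.closed_subspace_spectral_space[OF diag'[OF that]] by (simp add: closed_subspace_def)
        have "norm (?P u - ?P v) < 1"
          using dP dist_triangle2[of "?P u" "?P v" "?P x"] by (simp add: dist_norm)
        then have dim: "dim (R u {-\<alpha>..\<alpha>}) = dim (R v {-\<alpha>..\<alpha>})"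
          using dim_eq_of_close_projections[OF sR[OF u'] fd(1) sR[OF v'] fd(2)] PR u' v' by simp
        have "commensurable (R u {..<-\<alpha>}) (N v)"
          using commensurable_trans[OF commensurable_sym[OF wu(1)] commensurable_N[OF u' v']] .
        then have "rel_dim (R u {..<-\<alpha>}) (N v) + rel_dim (N v) (R v {..<-\<alpha>}) = 0"
          using rel_dim_add[OF _ wv(1)] 0 by metis
        moreover have "rel_dim (N u) (R u {..<-\<alpha>}) + rel_dim (R u {..<-\<alpha>}) (N v) = rel_dim (N u) (N v)"
          using rel_dim_add[OF wu(1)] \<open>commensurable (R u {..<-\<alpha>}) (N v)\<close> by blast
        ultimately show "int (dim (R v {0..\<alpha>})) - int (dim (R u {0..\<alpha>})) = rel_dim (N u) (N v)"
          using wu(2) wv(2) dim by linarith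
      qed
    qed
  qed
  then show ?thesis using st rng by (simp add: Q_def)
qed

text \<open>
  By additivity of the relative dimension the sum over any partition telescopes. In particular it
  does not depend on the partition.
\<close>

theorem spectral_flow_eq_rel_dim:
  assumes "a \<le> b"
  shows "spectral_flow W T a b = rel_dim (N a) (N b)"
proof -
  let ?sum = "\<lambda>N \<tau> \<alpha>. \<Sum>i=1..N. int (dim (range (spectral_proj W (T (\<tau> i)) {0..\<alpha> i})))
                     - int (dim (range (spectral_proj W (T (\<tau> (i - 1))) {0..\<alpha> i})))"
  have sum: "?sum M \<tau> \<alpha> = rel_dim (N a) (N b)" if sp: "spectral_partition W T a b M \<tau> \<alpha>" for M \<tau> \<alpha>
  proof -
    have p: "\<tau> 0 = a" "\<tau> M = b" "\<And>i. i \<in> {1..M} \<Longrightarrow> \<tau> (i - 1) < \<tau> i" "\<And>i. i \<in> {1..M} \<Longrightarrow> \<alpha> i > 0"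
      "\<And>i. i \<in> {1..M} \<Longrightarrow> continuous_on {\<tau> (i - 1)..\<tau> i} (\<lambda>t. spectral_proj W (T t) {- \<alpha> i..\<alpha> i})"
      "\<And>i t. i \<in> {1..M} \<Longrightarrow> t \<in> {\<tau> (i - 1)..\<tau> i} \<Longrightarrow> finite_dimensional (range (spectral_proj W (T t) {- \<alpha> i..\<alpha> i}))"
      using sp unfolding spectral_partition_def spectral_window_def by blast+
    have ge: "k \<le> M \<Longrightarrow> a \<le> \<tau> k" for k
    proof (induction k)
      case (Suc k)
      then show ?case using p(3)[of "Suc k"] by simp
    qed (simp add: p(1))
    have le: "k \<le> M \<Longrightarrow> \<tau> (M - k) \<le> b" for k
    proof (induction k)
      case (Suc k)
      then have "M - Suc k = (M - k) - 1" "M - k \<in> {1..M}" by auto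
      then show ?case using p(3)[of "M - k"] Suc by simp
    qed (simp add: p(2))
    have le': "k \<le> M \<Longrightarrow> \<tau> k \<le> b" for k using le[of "M - k"] by simp
    have "k \<le> M \<Longrightarrow> ?sum k \<tau> \<alpha> = rel_dim (N a) (N (\<tau> k))" for k
    proof (induction k)
      case 0
      then show ?case by (simp add: p(1) rel_dim_def)
    next
      case (Suc k)
      have i: "Suc k \<in> {1..M}" using Suc.prems by simp
      have "int (dim (range (spectral_proj W (T (\<tau> (Suc k))) {0..\<alpha> (Suc k)})))
                     - int (dim (range (spectral_proj W (T (\<tau> (Suc k - 1))) {0..\<alpha> (Suc k)})))
          = rel_dim (N (\<tau> (Suc k - 1))) (N (\<tau> (Suc k)))"
        using ge[of k] le'[of "Suc k"] Suc.prems p(3)[OF i]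
        by (intro rel_dim_window p(4,5,6)[OF i]) auto
      moreover have "rel_dim (N a) (N (\<tau> k)) + rel_dim (N (\<tau> k)) (N (\<tau> (Suc k))) = rel_dim (N a) (N (\<tau> (Suc k)))"
        using ge[of k] ge[of "Suc k"] le'[of k] le'[of "Suc k"] Suc.prems assms
        by (intro rel_dim_add commensurable_N) auto
      ultimately show ?case using Suc by simp
    qed
    then show ?thesis using p(2) by blast
  qed
  show ?thesis unfolding spectral_flow_def
  proof (rule the_equality)
    obtain M \<tau> \<alpha> where sp: "spectral_partition W T a b M \<tau> \<alpha>"
      using spectral_partition_exists[OF assms] by blast
    show "has_spectral_flow W T a b (rel_dim (N a) (N b))"
      unfolding has_spectral_flow_iff
      by (intro exI[of _ M] exI[of _ \<tau>] exI[of _ \<alpha>] conjI sp sum[OF sp, symmetric])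
    show "n = rel_dim (N a) (N b)" if "has_spectral_flow W T a b n" for n
    proof -
      obtain M \<tau> \<alpha> where sp: "spectral_partition W T a b M \<tau> \<alpha>" and n: "n = ?sum M \<tau> \<alpha>"
        using \<open>has_spectral_flow W T a b n\<close> unfolding has_spectral_flow_iff by (elim exE conjE)
      show ?thesis unfolding n by (rule sum[OF sp])
    qed
  qed
qed

end



section \<open>The negative space of a form and of its restriction\<close>

lemma rank_nullity:
  fixes D :: "'a::{real_inner, complete_space} set" and f :: "'a \<Rightarrow> 'a"
  assumes f: "linear f" and D: "subspace D" "finite_dimensional D"
  shows "dim D = dim {x \<in> D. f x = 0} + dim (f ` D)"
proof -
  let ?K = "{x \<in> D. f x = 0}"
  let ?C = "D \<inter> ?K\<^sup>\<bottom>"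
  have sK: "subspace ?K"
    using D(1) by (auto simp: subspace_def linear_0[OF f] linear_add[OF f] linear_cmul[OF f])
  have KD: "?K \<subseteq> D" by blast
  interpret K: closed_subspace ?K
    by (rule closed_subspace_finite_dimensional[OF sK finite_dimensional_subset[OF D(2) KD]])
  have sC: "subspace ?C" using D(1) subspace_orthogonal_comp by (intro subspace_inter)
  have inj: "x = 0" if "x \<in> ?C" "f x = 0" for x
    using that orthogonal_comp_Int_self[of x ?K] by blast
  have "f ` ?C = f ` D"
  proof
    show "f ` D \<subseteq> f ` ?C"
    proof
      fix y assume "y \<in> f ` D"
      then obtain x where x: "x \<in> D" "y = f x" by blast
      have p: "orth_proj ?K x \<in> ?K" by (rule K.orth_proj)
      then have "x - orth_proj ?K x \<in> ?C" using K.orth_proj(2)[of x] x(1) D(1) by (auto intro: subspace_diff)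
      moreover have "f (x - orth_proj ?K x) = y" using p x(2) by (simp add: linear_diff[OF f])
      ultimately show "y \<in> f ` ?C" by blast
    qed
  qed blast
  moreover have "dim (f ` ?C) = dim ?C"
    by (rule dim_injective_image[OF f sC _ inj]) (use finite_dimensional_subset[OF D(2)] in blast)
  ultimately show ?thesis using dim_orthogonal_split[OF D sK KD] by simp
qed

lemma dim_direct_sum:
  fixes L M :: "'a::{real_inner, complete_space} set"
  assumes L: "subspace L" "finite_dimensional L" and M: "subspace M" "finite_dimensional M"
    and LM: "L \<inter> M \<subseteq> {0}"
  shows "finite_dimensional {x + y | x y. x \<in> L \<and> y \<in> M}" (is "finite_dimensional ?D")
    "dim {x + y | x y. x \<in> L \<and> y \<in> M} = dim L + dim M"
proof -
  have "?D \<subseteq> span (L \<union> M)" by (auto intro!: span_add intro: span_base)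
  then show fd: "finite_dimensional ?D"
    using finite_dimensional_subset[OF finite_dimensional_Un[OF L(2) M(2)]] by blast
  interpret M: closed_subspace M by (rule closed_subspace_finite_dimensional[OF M])
  define f where "f = blinfun_apply (id_blinfun - orth_proj M)"
  have f: "linear f" "\<And>x. f x = x - orth_proj M x"
    by (simp_all add: f_def linear_blinfun_apply blinfun.diff_left)
  have sD: "subspace ?D" by (rule subspace_sums[OF L(1) M(1)])
  have fM: "f x = 0 \<longleftrightarrow> x \<in> M" for x
    using M.orth_proj_id[of x] M.orth_proj(1)[of x] by (auto simp: f(2))
  have "M \<subseteq> ?D" using subspace_0[OF L(1)] by force
  then have ker: "{x \<in> ?D. f x = 0} = M" using fM by blast
  have "f ` ?D = f ` L"
  proof
    show "f ` L \<subseteq> f ` ?D" using subspace_0[OF M(1)] by force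
    show "f ` ?D \<subseteq> f ` L"
    proof
      fix z assume "z \<in> f ` ?D"
      then obtain x y where "x \<in> L" "y \<in> M" "z = f (x + y)" by blast
      then have "z = f x" using fM[of y] by (simp add: linear_add[OF f(1)])
      then show "z \<in> f ` L" using \<open>x \<in> L\<close> by blast
    qed
  qed
  moreover have "dim (f ` L) = dim L"
    by (rule dim_injective_image[OF f(1) L]) (use fM LM in blast)
  ultimately show "dim ?D = dim L + dim M" using rank_nullity[OF f(1) sD fd] ker by simp
qed

text \<open>
  The image is closed, and a vector of \<open>X\<close> orthogonal to it is annihilated by \<open>A\<close>.
\<close>

lemma self_adjoint_bounded_below_surj:
  fixes A :: "'a::{real_inner, complete_space} \<Rightarrow>\<^sub>L 'a"
  assumes sa: "self_adjoint A" and X: "closed_subspace X" and inv: "\<And>x. x \<in> X \<Longrightarrow> A x \<in> X"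
    and c: "c > 0" "\<And>x. x \<in> X \<Longrightarrow> c * norm x \<le> norm (A x)"
  shows "A ` X = X"
proof
  show "A ` X \<subseteq> X" using inv by blast
  interpret AX: closed_subspace "A ` X" by (rule closed_subspace_image[OF X c])
  show "X \<subseteq> A ` X"
  proof
    fix z assume z: "z \<in> X"
    define w where "w = z - orth_proj (A ` X) z"
    have w: "w \<in> X" "w \<in> (A ` X)\<^sup>\<bottom>"
      using closed_subspace_orthogonal_decomp[OF AX.closed_subspace_axioms X \<open>A ` X \<subseteq> X\<close> z] by (auto simp: w_def)
    have "w \<bullet> A (A w) = 0" using orthogonal_compD[OF w(2)] inv[OF w(1)] by blast
    then have "A w \<bullet> A w = 0" using self_adjointD[OF sa, of w "A w"] by simp
    then have "w = 0" using c(2)[OF w(1)] c(1) by (simp add: mult_le_0_iff)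
    then show "z \<in> A ` X" using AX.orth_proj(1)[of z] by (simp add: w_def)
  qed
qed

context diagonal_symmetry begin

lemma spectral_space_nonzero_bounded_below:
  assumes "0 \<notin> S"
  obtains c where "c > 0" "\<And>x. x \<in> spectral_space S \<Longrightarrow> c * norm x \<le> norm (A x)"
proof -
  obtain d where d: "d > 0" "\<And>n. e n \<noteq> 0 \<Longrightarrow> l n \<noteq> 0 \<Longrightarrow> d \<le> \<bar>l n - 0\<bar>"
    by (rule eigenvalue_gap[of 0]) (simp, rule that)
  have S: "spectral_space S = spectral_space (S \<inter> {s. d \<le> \<bar>s\<bar>})"
    by (rule spectral_space_cong) (use d(2) assms in fastforce)
  have "d * norm x \<le> norm (A x)" if "x \<in> spectral_space S" for x
  proof -
    have "x \<in> spectral_space (S \<inter> {s. d \<le> \<bar>s\<bar>})" using that S by blast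
    then show ?thesis by (rule norm_op_ge) (use d(1) in auto)
  qed
  then show ?thesis using that[OF d(1)] by blast
qed

lemma spectral_space_nonzero_surj:
  assumes "0 \<notin> S"
  shows "A ` spectral_space S = spectral_space S"
proof -
  obtain c where c: "c > 0" "\<And>x. x \<in> spectral_space S \<Longrightarrow> c * norm x \<le> norm (A x)"
    by (rule spectral_space_nonzero_bounded_below[OF assms]) (rule that)
  show ?thesis
    by (rule self_adjoint_bounded_below_surj[OF sa closed_subspace_spectral_space spectral_space_invariant c])
qed

lemma negative_gap:
  obtains c where "c > 0" "\<And>x. x \<in> spectral_space {..<0} \<Longrightarrow> A x \<bullet> x \<le> - c * (x \<bullet> x)"
proof -
  obtain d where d: "d > 0" "\<And>n. e n \<noteq> 0 \<Longrightarrow> l n \<noteq> 0 \<Longrightarrow> d \<le> \<bar>l n - 0\<bar>"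
    by (rule eigenvalue_gap[of 0]) (simp, rule that)
  have S: "spectral_space {..<0} = spectral_space {..-d}"
    by (rule spectral_space_cong) (use d in fastforce)
  have "A x \<bullet> x \<le> - d * (x \<bullet> x)" if "x \<in> spectral_space {..<0}" for x
  proof -
    have "x \<in> spectral_space {..-d}" using that S by blast
    then show ?thesis by (rule form_le) simp
  qed
  then show ?thesis using that[OF d(1)] by blast
qed

end

lemma (in diagonal_operator) form_zero_imp_kernel:
  assumes x: "x \<in> spectral_space S" and S: "\<And>s. s \<in> S \<Longrightarrow> 0 \<le> s" and z: "A x \<bullet> x = 0"
  shows "A x = 0"
proof -
  have xW: "x \<in> W" using x spectral_space_subset by blast
  have nonneg: "0 \<le> l n * (x \<bullet> e n)\<^sup>2" for n
    using x S by (cases "l n \<in> S") (auto simp: spectral_space_def)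
  have "(\<Sum>n. l n * (x \<bullet> e n)\<^sup>2) = 0" using sums_unique[OF expansion_form[OF xW]] z by simp
  then have "l n * (x \<bullet> e n)\<^sup>2 = 0" for n
    using suminf_eq_zero_iff[OF sums_summable[OF expansion_form[OF xW]] nonneg] by blast
  then have "A x \<bullet> e n = 0" for n by (auto simp: coeff_op)
  then show ?thesis using complete[OF op_mem[OF xW]] by blast
qed

locale restricted_form =
  d: diagonal_symmetry UNIV "form_operator UNIV B" e l +
  d': diagonal_symmetry V "form_operator V B" e' l'
  for B :: "'a::{real_inner, complete_space} \<Rightarrow>\<^sub>L 'a \<Rightarrow>\<^sub>L real" and V e l e' l' +
  assumes comm: "commensurable (neg_space UNIV (form_operator UNIV B)) (neg_space V (form_operator V B))"
begin

abbreviation "T \<equiv> form_operator UNIV B"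
abbreviation "T' \<equiv> form_operator V B"
abbreviation "X \<equiv> d.spectral_space {..<0}"
abbreviation "N \<equiv> d'.spectral_space {..<0}"
abbreviation "P \<equiv> d'.spectral_space {0<..}"
abbreviation "C \<equiv> form_orth B V"

lemma B_eq: "B x y = T x \<bullet> y"
  by (simp add: form_operator_UNIV)

lemma T_sym: "T x \<bullet> y = T y \<bullet> x"
  using self_adjointD[OF d.sa, of x y] by (simp add: inner_commute)

lemma T'_eq: "x \<in> V \<Longrightarrow> y \<in> V \<Longrightarrow> T' x \<bullet> y = T x \<bullet> y"
  by (simp add: d'.form_operator_compression d'.orth_proj_id d'.inner_orth_proj_right)

lemma mem_C: "x \<in> C \<longleftrightarrow> (\<forall>v\<in>V. T x \<bullet> v = 0)"
  by (simp add: form_orth_def B_eq)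

lemma form_kernel_eq: "form_kernel B = {x. T x = 0}"
proof -
  have "T x = 0" if "\<forall>y. T x \<bullet> y = 0" for x using that[rule_format, of "T x"] by simp
  then show ?thesis by (auto simp: form_kernel_def B_eq)
qed

lemma kernel_restriction: "V \<inter> C = d'.spectral_space {0}"
proof -
  have "T' x = 0 \<longleftrightarrow> x \<in> C" if x: "x \<in> V" for x
  proof
    assume "T' x = 0"
    then show "x \<in> C" using T'_eq[OF x] by (simp add: mem_C)
  next
    assume "x \<in> C"
    then have "T' x \<bullet> T' x = 0" using T'_eq[OF x d'.op_mem[OF x]] d'.op_mem[OF x] by (simp add: mem_C)
    then show "T' x = 0" by simp
  qed
  then show ?thesis unfolding d'.spectral_space_zero by blast
qed

lemma finite_dimensional_kernel_restriction: "finite_dimensional (V \<inter> C)"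
  unfolding kernel_restriction by (rule d'.finite_dimensional_spectral_space[where c=0]) auto

lemma kernel_Int: "{x \<in> V \<inter> C. T x = 0} = V \<inter> form_kernel B"
  by (auto simp: form_kernel_eq mem_C)

lemma subspace_kernel_restriction: "subspace (V \<inter> C)"
  unfolding kernel_restriction using d'.closed_subspace_spectral_space by (simp add: closed_subspace_def)

lemma commens: "commensurable X N"
  using comm by (simp add: d.neg_space_eq d'.neg_space_eq)

lemma finite_dimensional_defect: "finite_dimensional (X \<inter> N\<^sup>\<bottom>)"
  using finite_dimensional_Int_orthogonal_comp[OF commens] .

lemma subspaces: "subspace X" "subspace N" "subspace P" "subspace (X \<inter> N\<^sup>\<bottom>)"
proof -
  show "subspace X" "subspace N" "subspace P"
    using d.closed_subspace_spectral_space d'.closed_subspace_spectral_space by (simp_all add: closed_subspace_def)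
  then show "subspace (X \<inter> N\<^sup>\<bottom>)" using subspace_orthogonal_comp by (intro subspace_inter)
qed

lemma N_V: "x \<in> N \<Longrightarrow> x \<in> V" and P_V: "x \<in> P \<Longrightarrow> x \<in> V"
  using d'.spectral_space_subset by blast+

lemma X_neg: "x \<in> X \<Longrightarrow> x \<noteq> 0 \<Longrightarrow> T x \<bullet> x < 0"
  using d.sign_splitting_spectral by (simp add: sign_splitting_def Let_def)

lemma N_neg: "x \<in> N \<Longrightarrow> x \<noteq> 0 \<Longrightarrow> T x \<bullet> x < 0"
  using d'.sign_splitting_spectral T'_eq[OF N_V N_V] by (simp add: sign_splitting_def Let_def)

lemma P_nonneg: "x \<in> P \<Longrightarrow> 0 \<le> T x \<bullet> x"
  using d'.form_ge[of x "{0<..}" 0] T'_eq[OF P_V P_V] by simp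

lemma X_comp: "x \<in> X\<^sup>\<bottom> \<longleftrightarrow> x \<in> d.spectral_space (- {..<0})"
  using d.spectral_space_orthogonal by simp

lemma X_comp_nonneg: "x \<in> X\<^sup>\<bottom> \<Longrightarrow> 0 \<le> T x \<bullet> x"
  using d.form_ge[of x "- {..<0}" 0] X_comp by simp

text \<open>
  The form is negative definite on \<open>N\<close> and nonnegative on \<open>X\<^sup>\<bottom>\<close>, so \<open>N \<inter> X\<^sup>\<bottom> = 0\<close>.
\<close>

lemma rel_dim_defect: "rel_dim X N = int (dim (X \<inter> N\<^sup>\<bottom>))"
proof -
  have "x = 0" if "x \<in> N \<inter> X\<^sup>\<bottom>" for x
    using N_neg[of x] X_comp_nonneg[of x] that by force
  then have "N \<inter> X\<^sup>\<bottom> \<subseteq> span {}" by auto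
  then have "dim (N \<inter> X\<^sup>\<bottom>) = 0" by (metis dim_le_card card.empty finite.emptyI le_zero_eq)
  then show ?thesis by (simp add: rel_dim_def)
qed

text \<open>
  Let \<open>K = V \<inter> C\<close>. Elements of \<open>C\<close> are \<open>B\<close>-orthogonal to \<open>V\<close>, so the form of \<open>x + k\<close> with
  \<open>x \<in> L\<close> and \<open>k \<in> K\<close> is that of \<open>x\<close>; it is nonpositive on \<open>L \<oplus> K\<close>. Consider the projection
  of \<open>L \<oplus> K\<close> onto \<open>X \<inter> N\<^sup>\<bottom>\<close>. If \<open>d = x + k\<close> is in its kernel, then \<open>d\<close> and some \<open>n \<in> N\<close> have
  the same projection to \<open>X\<close>, so the form is nonnegative at \<open>d - n \<in> X\<^sup>\<bottom>\<close>. There it is the sum of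
  the nonpositive forms of \<open>x\<close> and \<open>n\<close>, so \<open>x = n = 0\<close>, and \<open>k\<close> is a null vector of the
  nonnegative form on \<open>X\<^sup>\<bottom>\<close>, i.e. \<open>T k = 0\<close>. Counting dimensions gives the claim.
\<close>

lemma defect_upper:
  assumes L: "subspace L" "L \<subseteq> C" "\<And>x. x \<in> L \<Longrightarrow> x \<noteq> 0 \<Longrightarrow> T x \<bullet> x < 0"
  shows "finite_dimensional L" "dim L + dim (V \<inter> C) \<le> dim (X \<inter> N\<^sup>\<bottom>) + dim (V \<inter> form_kernel B)"
proof -
  let ?E = "X \<inter> N\<^sup>\<bottom>" and ?K = "V \<inter> C"
  interpret X: closed_subspace X by (rule d.closed_subspace_spectral_space)
  interpret D0: closed_subspace ?E
    by (rule closed_subspace_finite_dimensional[OF subspaces(4) finite_dimensional_defect])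
  have lin: "linear (blinfun_apply (orth_proj ?E))" by (rule linear_blinfun_apply)
  have key: "x = 0 \<and> T k = 0" if x: "x \<in> L" and k: "k \<in> ?K" and z: "orth_proj ?E (x + k) = 0" for x k
  proof -
    let ?d = "x + k"
    obtain c where c: "c > 0" "\<And>n. n \<in> N \<Longrightarrow> T' n \<bullet> n \<le> - c * (n \<bullet> n)" by (rule d'.negative_gap) (rule that)
    have nT: "norm T + 1 > 0" using norm_ge_zero[of T] by linarith
    \<comment> \<open>The negative part of the form comes from the component in \<open>X\<close> only. The bound makes the
      image of \<open>N\<close> in \<open>X\<close> closed; the \<open>1\<close> in the denominator covers the case \<open>T = 0\<close>.\<close>
    have low: "c / (norm T + 1) * norm n \<le> norm (orth_proj X n)" if n: "n \<in> N" for n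
    proof -
      let ?q = "orth_proj X n"
      have q: "?q \<in> X" "n - ?q \<in> X\<^sup>\<bottom>" by (rule X.orth_proj)+
      have "T ?q \<bullet> (n - ?q) = 0"
        using orthogonal_compD[OF q(2) d.spectral_space_invariant[OF q(1)]] by (simp add: inner_commute)
      moreover have "T n \<bullet> n = T ?q \<bullet> ?q + 2 * (T ?q \<bullet> (n - ?q)) + T (n - ?q) \<bullet> (n - ?q)"
        using T_sym[of n ?q] by (simp add: blinfun.diff_right inner_diff_left inner_diff_right)
      ultimately have "- (T n \<bullet> n) \<le> - (T ?q \<bullet> ?q)" using X_comp_nonneg[OF q(2)] by simp
      also have "\<dots> \<le> norm (T ?q) * norm ?q" using Cauchy_Schwarz_ineq2[of "T ?q" ?q] by linarith
      also have "\<dots> \<le> (norm T * norm ?q) * norm n"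
        by (intro mult_mono norm_blinfun X.norm_orth_proj_le) auto
      finally have "c * (n \<bullet> n) \<le> norm T * norm ?q * norm n" using c(2)[OF n] T'_eq[OF N_V[OF n] N_V[OF n]] by simp
      then have "norm n * (c * norm n) \<le> norm n * (norm T * norm ?q)"
        by (simp add: dot_square_norm power2_eq_square mult_ac)
      then have "c * norm n \<le> norm T * norm ?q" by (cases "n = 0") auto
      also have "\<dots> \<le> (norm T + 1) * norm ?q" by (intro mult_right_mono) auto
      finally show ?thesis by (simp add: field_simps add_pos_nonneg)
    qed
    have cl: "closed_subspace (orth_proj X ` N)"
      by (rule closed_subspace_image[OF d'.closed_subspace_spectral_space _ low]) (use c(1) nT in auto)
    interpret PN: closed_subspace "orth_proj X ` N" by (rule cl)
    have PNX: "orth_proj X ` N \<subseteq> X" using X.orth_proj by blast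
    have eq: "X \<inter> (orth_proj X ` N)\<^sup>\<bottom> = ?E"
      by (rule Int_orthogonal_comp_image_orth_proj[OF X.closed_subspace_axioms])
    let ?q = "orth_proj X ?d" and ?w = "orth_proj X ?d - orth_proj (orth_proj X ` N) (orth_proj X ?d)"
    have w: "?w \<in> ?E"
      using closed_subspace_orthogonal_decomp[OF cl X.closed_subspace_axioms PNX X.orth_proj(1)] eq by blast
    have "?d \<bullet> ?w = 0" using D0.orth_proj(2)[of ?d] z orthogonal_compD[OF _ w] by simp
    then have "?q \<bullet> ?w = 0" using X.inner_orth_proj_right[of ?w ?d] w by simp
    moreover have "orth_proj (orth_proj X ` N) ?q \<bullet> ?w = 0"
      using orthogonal_compD[OF PN.orth_proj(2) PN.orth_proj(1)] by (simp add: inner_commute)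
    ultimately have "?w \<bullet> ?w = 0" by (simp add: inner_diff_left)
    then have "?q \<in> orth_proj X ` N" using PN.orth_proj(1)[of ?q] by simp
    then obtain n where n: "n \<in> N" "?q = orth_proj X n" by blast
    have y: "?d - n \<in> X\<^sup>\<bottom>" using X.orth_proj(2)[of "?d - n"] n(2) by (simp add: blinfun.diff_right)
    have C: "T x \<bullet> n = 0" "T k \<bullet> n = 0" "T x \<bullet> k = 0" "T k \<bullet> k = 0"
      using x k L(2) N_V[OF n(1)] by (auto simp: mem_C)
    have "T (?d - n) \<bullet> (?d - n) = T x \<bullet> x + T n \<bullet> n"
      using C T_sym[of n x] T_sym[of n k] T_sym[of k x]
      by (simp add: blinfun.diff_right blinfun.add_right inner_diff_left inner_diff_right inner_add_left inner_add_right)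
    then have "0 \<le> T x \<bullet> x + T n \<bullet> n" using X_comp_nonneg[OF y] by simp
    then have "x = 0" "n = 0" using L(3)[OF x] N_neg[OF n(1)] N_neg[OF n(1)] by force+
    then have "k \<in> X\<^sup>\<bottom>" using y by simp
    then have "T k = 0" using d.form_zero_imp_kernel[of k "- {..<0}"] C(4) X_comp by simp
    then show ?thesis using \<open>x = 0\<close> by simp
  qed
  have K0: "0 \<in> ?K" using subspace_0[OF subspace_kernel_restriction] .
  show fdL: "finite_dimensional L"
  proof (rule finite_dimensional_injective(1)[OF lin L(1) _ D0.orth_proj(1) finite_dimensional_defect])
    show "x = 0" if "x \<in> L" "orth_proj ?E x = 0" for x using key[OF that(1) K0] that(2) by simp
  qed
  define S where "S = {x + k | x k. x \<in> L \<and> k \<in> ?K}"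
  have "x = 0" if "x \<in> L \<inter> ?K" for x
  proof (rule ccontr)
    assume "x \<noteq> 0"
    moreover have "T x \<bullet> x = 0" using that by (auto simp: mem_C)
    ultimately show False using L(3)[of x] that by simp
  qed
  then have D: "finite_dimensional S" "dim S = dim L + dim ?K"
    using dim_direct_sum[OF L(1) fdL subspace_kernel_restriction finite_dimensional_kernel_restriction]
    unfolding S_def by blast+
  have sD: "subspace S" unfolding S_def by (rule subspace_sums[OF L(1) subspace_kernel_restriction])
  have "dim S = dim {d \<in> S. orth_proj ?E d = 0} + dim (orth_proj ?E ` S)"
    by (rule rank_nullity[OF lin sD D(1)])
  moreover have "dim {d \<in> S. orth_proj ?E d = 0} \<le> dim (V \<inter> form_kernel B)"
  proof (rule dim_subset_finite)
    show "finite_dimensional (V \<inter> form_kernel B)"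
      using finite_dimensional_subset[OF finite_dimensional_kernel_restriction] kernel_Int by blast
    show "{d \<in> S. orth_proj ?E d = 0} \<subseteq> V \<inter> form_kernel B"
    proof
      fix d assume "d \<in> {d \<in> S. orth_proj ?E d = 0}"
      then obtain x k where d: "x \<in> L" "k \<in> ?K" "d = x + k" "orth_proj ?E (x + k) = 0"
        unfolding S_def by blast
      from key[OF d(1,2,4)] d(2,3) show "d \<in> V \<inter> form_kernel B" by (simp add: form_kernel_eq)
    qed
  qed
  moreover have "dim (orth_proj ?E ` S) \<le> dim ?E"
    by (rule dim_subset_finite[OF finite_dimensional_defect]) (use D0.orth_proj(1) in blast)
  ultimately show "dim L + dim ?K \<le> dim ?E + dim (V \<inter> form_kernel B)" using D(2) by linarith
qed

text \<open>
  Since \<open>T\<close> maps \<open>X\<close> onto itself, the vectors of \<open>X\<close> that are \<open>B\<close>-orthogonal to \<open>N\<close> form a space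
  of the same dimension as \<open>X \<inter> N\<^sup>\<bottom>\<close>. Those that are \<open>B\<close>-orthogonal to \<open>K = V \<inter> C\<close> as well have
  codimension at most \<open>dim (T ` K)\<close> in it, which is \<open>dim K\<close> minus the dimension of
  \<open>V \<inter> form_kernel B\<close>. Now subtract from such \<open>x\<close> the vector \<open>\<rho> x \<in> P\<close> for which the difference
  is \<open>B\<close>-orthogonal to \<open>P\<close>; it exists because \<open>T'\<close> maps \<open>P\<close> onto itself. The difference is
  \<open>B\<close>-orthogonal to \<open>V = N \<oplus> P \<oplus> K\<close>, and its form is that of \<open>x\<close> minus the nonnegative form of
  \<open>\<rho> x\<close>, so it remains negative.
\<close>

lemma defect_lower:
  obtains L where "subspace L" "L \<subseteq> C" "\<And>x. x \<in> L \<Longrightarrow> x \<noteq> 0 \<Longrightarrow> T x \<bullet> x < 0"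
    "dim (X \<inter> N\<^sup>\<bottom>) + dim (V \<inter> form_kernel B) \<le> dim L + dim (V \<inter> C)"
proof -
  let ?K = "V \<inter> C"
  interpret P: closed_subspace P by (rule d'.closed_subspace_spectral_space)
  have linT: "linear (blinfun_apply T)" by (rule linear_blinfun_apply)
  have G: "subspace (T ` ?K)" "finite_dimensional (T ` ?K)"
    using linear_subspace_image[OF linT subspace_kernel_restriction]
      finite_dimensional_image(1)[OF linT finite_dimensional_kernel_restriction] by auto
  have dimG: "dim ?K = dim (V \<inter> form_kernel B) + dim (T ` ?K)"
    using rank_nullity[OF linT subspace_kernel_restriction finite_dimensional_kernel_restriction] kernel_Int by simp
  define X1 where "X1 = {x \<in> X. T x \<in> N\<^sup>\<bottom>}"
  have sX1: "subspace X1"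
    using subspaces(1) subspace_orthogonal_comp[of N]
    by (auto simp: X1_def subspace_def blinfun.add_right blinfun.scaleR_right)
  have onX: "T ` X = X" by (rule d.spectral_space_nonzero_surj) simp
  have img: "T ` X1 = X \<inter> N\<^sup>\<bottom>"
  proof
    show "T ` X1 \<subseteq> X \<inter> N\<^sup>\<bottom>" using d.spectral_space_invariant by (auto simp: X1_def)
    show "X \<inter> N\<^sup>\<bottom> \<subseteq> T ` X1"
    proof
      fix y assume y: "y \<in> X \<inter> N\<^sup>\<bottom>"
      then have "y \<in> T ` X" using onX by simp
      then obtain x where "x \<in> X" "y = T x" by blast
      then show "y \<in> T ` X1" using y by (auto simp: X1_def)
    qed
  qed
  have inj: "x = 0" if "x \<in> X1" "T x = 0" for x
    using X_neg[of x] that by (force simp: X1_def)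
  have fdX1: "finite_dimensional X1"
    by (rule finite_dimensional_injective(1)[OF linT sX1 inj _ finite_dimensional_defect]) (use img in blast)+
  have dimX1: "dim X1 = dim (X \<inter> N\<^sup>\<bottom>)" using dim_injective_image[OF linT sX1 fdX1 inj] img by simp
  define Y where "Y = X1 \<inter> (T ` ?K)\<^sup>\<bottom>"
  have sY: "subspace Y" unfolding Y_def using sX1 subspace_orthogonal_comp by (rule subspace_inter)
  have fdY: "finite_dimensional Y" using finite_dimensional_subset[OF fdX1] by (auto simp: Y_def)
  have dimY: "dim X1 \<le> dim (T ` ?K) + dim Y"
    using rel_dim_finite_dimensional_le[OF sX1 fdX1 G] by (simp add: Y_def)
  have "\<exists>p\<in>P. T' p = orth_proj P (T x)" for x
  proof -
    have "T' ` P = P" by (rule d'.spectral_space_nonzero_surj) simp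
    then show ?thesis using P.orth_proj(1)[of "T x"] by (metis imageE)
  qed
  then obtain \<rho> where \<rho>: "\<And>x. \<rho> x \<in> P" "\<And>x. T' (\<rho> x) = orth_proj P (T x)" by metis
  have T'_inj: "p = 0" if "p \<in> P" "T' p = 0" for p
  proof -
    obtain c where c: "c > 0" "\<And>x. x \<in> P \<Longrightarrow> c * norm x \<le> norm (T' x)"
      by (rule d'.spectral_space_nonzero_bounded_below[of "{0<..}"]) (simp, rule that)
    show ?thesis using c(1) c(2)[OF \<open>p \<in> P\<close>] \<open>T' p = 0\<close> by (simp add: mult_le_0_iff)
  qed
  have uniq: "p = q" if "p \<in> P" "q \<in> P" "T' p = T' q" for p q
    using T'_inj[of "p - q"] that subspaces(3) by (simp add: subspace_diff blinfun.diff_right)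
  have lin\<rho>: "linear \<rho>"
  proof (rule linearI)
    show "\<rho> (x + y) = \<rho> x + \<rho> y" for x y
      by (rule uniq) (use \<rho> subspaces(3) in \<open>auto simp: subspace_add blinfun.add_right\<close>)
    show "\<rho> (c *\<^sub>R x) = c *\<^sub>R \<rho> x" for c x
      by (rule uniq) (use \<rho> subspaces(3) in \<open>auto simp: subspace_scale blinfun.scaleR_right\<close>)
  qed
  have \<rho>_orth: "T (x - \<rho> x) \<bullet> p = 0" if p: "p \<in> P" for x p
  proof -
    have "T (\<rho> x) \<bullet> p = T' (\<rho> x) \<bullet> p" using T'_eq[OF P_V[OF \<rho>(1)] P_V[OF p]] by simp
    then show ?thesis using \<rho>(2) P.inner_orth_proj_right[OF p] by (simp add: blinfun.diff_right inner_diff_left)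
  qed
  define f where "f x = x - \<rho> x" for x
  have linf: "linear f" unfolding f_def[abs_def] by (intro linear_compose_sub linear_id[unfolded id_def] lin\<rho>)
  have form_f: "T (f x) \<bullet> f x = T x \<bullet> x - T (\<rho> x) \<bullet> \<rho> x" for x
    using \<rho>_orth[OF \<rho>(1), of x x] T_sym[of x "\<rho> x"]
    by (simp add: f_def blinfun.diff_right inner_diff_left inner_diff_right)
  have neg: "T (f x) \<bullet> f x < 0" if "x \<in> Y" "x \<noteq> 0" for x
    using X_neg[of x] that P_nonneg[OF \<rho>(1)[of x]] by (simp add: form_f Y_def X1_def)
  have injf: "x = 0" if "x \<in> Y" "f x = 0" for x using neg[of x] that by force
  have V_split: "\<exists>n p k. v = n + p + k \<and> n \<in> N \<and> p \<in> P \<and> k \<in> ?K" if "v \<in> V" for v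
  proof -
    have "V = {m + p + k | m p k. m \<in> N \<and> p \<in> P \<and> k \<in> {x \<in> V. T' x = 0}}"
      using d'.sign_splitting_spectral unfolding sign_splitting_def Let_def by (elim conjE)
    from equalityD1[OF this, THEN subsetD, OF that] show ?thesis
      unfolding kernel_restriction d'.spectral_space_zero by blast
  qed
  have fC: "f x \<in> C" if x: "x \<in> Y" for x
    unfolding mem_C
  proof
    fix v assume "v \<in> V"
    then obtain n p k where v: "v = n + p + k" "n \<in> N" "p \<in> P" "k \<in> ?K" using V_split by blast
    have "T x \<bullet> n = 0" using x v(2) orthogonal_compD[of "T x" N n] by (simp add: Y_def X1_def)
    moreover have "T (\<rho> x) \<bullet> n = 0"
    proof -
      have "T' (\<rho> x) \<in> d'.spectral_space (- {..<0})"
        using d'.spectral_space_invariant[OF \<rho>(1)] d'.spectral_space_mono[of "{0<..}" "- {..<0}"] by fastforce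
      then have "T' (\<rho> x) \<in> N\<^sup>\<bottom>" using d'.spectral_space_complement by blast
      then show ?thesis using orthogonal_compD[OF _ v(2)] T'_eq[OF P_V[OF \<rho>(1)] N_V[OF v(2)]] by metis
    qed
    moreover have "T (f x) \<bullet> p = 0" unfolding f_def by (rule \<rho>_orth[OF v(3)])
    moreover have "T x \<bullet> k = 0"
      using x v(4) orthogonal_compD[of x "T ` ?K" "T k"] T_sym[of x k] by (simp add: Y_def inner_commute)
    moreover have "T (\<rho> x) \<bullet> k = 0" using v(4) P_V[OF \<rho>(1)[of x]] T_sym[of "\<rho> x" k] by (simp add: mem_C)
    ultimately show "T (f x) \<bullet> v = 0"
      unfolding v(1) inner_add_right by (simp add: f_def blinfun.diff_right inner_diff_left)
  qed
  show ?thesis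
  proof (rule that)
    show "subspace (f ` Y)" by (rule linear_subspace_image[OF linf sY])
    show "f ` Y \<subseteq> C" using fC by blast
    show "T y \<bullet> y < 0" if "y \<in> f ` Y" "y \<noteq> 0" for y
    proof -
      obtain x where "x \<in> Y" "y = f x" using \<open>y \<in> f ` Y\<close> by blast
      then show ?thesis using neg[of x] that(2) linear_0[OF linf] by force
    qed
    have "dim (f ` Y) = dim Y" by (rule dim_injective_image[OF linf sY fdY injf])
    then show "dim (X \<inter> N\<^sup>\<bottom>) + dim (V \<inter> form_kernel B) \<le> dim (f ` Y) + dim (V \<inter> C)"
      using dimX1 dimY dimG by linarith
  qed
qed

text \<open>
  The two bounds show that the space of \<open>defect_lower\<close> has the largest dimension among the negative
  subspaces of \<open>C\<close>.
\<close>

theorem index_formula: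
  "morse_index C B \<noteq> \<infinity>"
  "rel_dim (neg_space UNIV T) (neg_space V T') =
     int (the_enat (morse_index C B)) + int (dim (V \<inter> C)) - int (dim (V \<inter> form_kernel B))"
proof -
  obtain L where L: "subspace L" "L \<subseteq> C" "\<And>x. x \<in> L \<Longrightarrow> x \<noteq> 0 \<Longrightarrow> T x \<bullet> x < 0"
    "dim (X \<inter> N\<^sup>\<bottom>) + dim (V \<inter> form_kernel B) \<le> dim L + dim (V \<inter> C)"
    by (rule defect_lower) (rule that)
  note up = defect_upper[OF L(1-3)]
  have "morse_index C B = enat (dim L)"
    unfolding morse_index_def
  proof (rule antisym)
    show "(SUP M \<in> {M. subspace M \<and> M \<subseteq> C \<and> (\<forall>x\<in>M. x \<noteq> 0 \<longrightarrow> B x x < 0)}. edim M) \<le> enat (dim L)"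
    proof (rule SUP_least)
      fix M assume "M \<in> {M. subspace M \<and> M \<subseteq> C \<and> (\<forall>x\<in>M. x \<noteq> 0 \<longrightarrow> B x x < 0)}"
      then have M: "subspace M" "M \<subseteq> C" "\<And>x. x \<in> M \<Longrightarrow> x \<noteq> 0 \<Longrightarrow> T x \<bullet> x < 0" by (auto simp: B_eq)
      have "dim M \<le> dim L" using defect_upper(2)[OF M] L(4) by linarith
      then show "edim M \<le> enat (dim L)" using defect_upper(1)[OF M] by (simp add: edim_def)
    qed
    have "edim L \<le> (SUP M \<in> {M. subspace M \<and> M \<subseteq> C \<and> (\<forall>x\<in>M. x \<noteq> 0 \<longrightarrow> B x x < 0)}. edim M)"
      by (rule SUP_upper) (use L(1-3) in \<open>auto simp: B_eq\<close>)
    then show "enat (dim L) \<le> (SUP M \<in> {M. subspace M \<and> M \<subseteq> C \<and> (\<forall>x\<in>M. x \<noteq> 0 \<longrightarrow> B x x < 0)}. edim M)"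
      using up(1) by (simp add: edim_def)
  qed
  then show "morse_index C B \<noteq> \<infinity>"
    "rel_dim (neg_space UNIV T) (neg_space V T') =
     int (the_enat (morse_index C B)) + int (dim (V \<inter> C)) - int (dim (V \<inter> form_kernel B))"
    using rel_dim_defect up(2) L(4) by (simp_all add: d.neg_space_eq d'.neg_space_eq)
qed

end



section \<open>Paths of forms\<close>

lemma finite_dimensional_orthogonal_comp_codim:
  fixes V :: "'a::{real_inner, complete_space} set"
  assumes "finite_codimensional V"
  shows "finite_dimensional (V\<^sup>\<bottom>)"
proof -
  obtain F where F: "finite F" "span (V \<union> F) = UNIV" using assms by (auto simp: finite_codimensional_def)
  show ?thesis
  proof (rule finite_dimensional_transversal(1)[OF subspace_orthogonal_comp _ finite_dimensional_span[OF F(1)]])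
    show "subspace (span F)" by simp
    fix x assume x: "x \<in> V\<^sup>\<bottom>" "x \<in> (span F)\<^sup>\<bottom>"
    then have "x \<in> (V \<union> F)\<^sup>\<bottom>" by (auto simp: orthogonal_comp_span mem_orthogonal_comp_iff)
    then have "x \<in> UNIV\<^sup>\<bottom>" using orthogonal_comp_span[of "V \<union> F"] F(2) by simp
    then show "x = 0" by simp
  qed
qed

lemma orth_proj_UNIV: "orth_proj UNIV = (id_blinfun :: 'a::{real_inner, complete_space} \<Rightarrow>\<^sub>L 'a)"
  by (rule blinfun_eqI) (simp add: closed_subspace.orth_proj_id[OF closed_subspace_UNIV])

lemma compact_operator_codim:
  fixes V :: "'a::{real_inner, complete_space} set"
  assumes V: "closed_subspace V" "finite_codimensional V"
  shows "compact_operator (orth_proj UNIV - orth_proj V)"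
proof (rule compact_operator_finite_rank[OF subspace_orthogonal_comp finite_dimensional_orthogonal_comp_codim[OF V(2)]])
  show "(orth_proj UNIV - orth_proj V) x \<in> V\<^sup>\<bottom>" for x
    using closed_subspace.orth_proj(2)[OF V(1)] by (simp add: orth_proj_UNIV blinfun.diff_left)
qed

lemma essential_symmetry_compact_perturbation:
  fixes J K :: "'a::{real_inner, complete_space} \<Rightarrow>\<^sub>L 'a"
  assumes J: "is_symmetry J" and K: "compact_operator K" and sa: "self_adjoint (J + K)"
  shows "essential_symmetry UNIV (J + K)"
proof -
  have "J (J x) = x" for x
    using J by (metis blinfun_apply_blinfun_compose blinfun_apply_id_blinfun is_symmetry_def)
  then have "((J + K) o\<^sub>L (J + K)) - orth_proj UNIV = (J o\<^sub>L K) + (K o\<^sub>L (J + K))"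
    by (intro blinfun_eqI)
      (simp add: orth_proj_UNIV blinfun.add_left blinfun.diff_left blinfun.add_right algebra_simps)
  then have "compact_operator (((J + K) o\<^sub>L (J + K)) - orth_proj UNIV)"
    using compact_operator_add[OF compact_operator_compose_left[OF K] compact_operator_compose_right[OF K]] by metis
  then show ?thesis using sa by (simp add: essential_symmetry_def closed_subspace_UNIV operator_on_def)
qed

text \<open>
  With \<open>P\<close> the projection onto \<open>V\<close>, the operators \<open>(P A P)\<^sup>2 - P\<close> and \<open>P (A\<^sup>2 - I) P\<close> differ by
  \<open>P A (I - P) A P\<close>, which has finite rank.
\<close>

lemma essential_symmetry_compression:
  fixes A :: "'a::{real_inner, complete_space} \<Rightarrow>\<^sub>L 'a"
  assumes A: "essential_symmetry UNIV A" and V: "closed_subspace V" "finite_codimensional V"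
  shows "essential_symmetry V (orth_proj V o\<^sub>L A o\<^sub>L orth_proj V)" (is "essential_symmetry V ?A")
proof -
  interpret closed_subspace V by (rule V)
  let ?P = "orth_proj V" and ?I = "orth_proj UNIV :: 'a \<Rightarrow>\<^sub>L 'a"
  have sa: "self_adjoint A" and comp: "compact_operator ((A o\<^sub>L A) - ?I)" using A by (auto simp: essential_symmetry_def)
  have "(?A o\<^sub>L ?A) - ?P = (?P o\<^sub>L (((A o\<^sub>L A) - ?I) o\<^sub>L ?P)) - (?P o\<^sub>L (A o\<^sub>L ((?I - ?P) o\<^sub>L (A o\<^sub>L ?P))))"
    by (rule blinfun_eqI) (simp add: orth_proj_UNIV blinfun.diff_left blinfun.diff_right)
  moreover have "compact_operator ((?P o\<^sub>L (((A o\<^sub>L A) - ?I) o\<^sub>L ?P)) - (?P o\<^sub>L (A o\<^sub>L ((?I - ?P) o\<^sub>L (A o\<^sub>L ?P)))))"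
    by (intro compact_operator_diff compact_operator_compose_left compact_operator_compose_right comp
        compact_operator_codim[OF V])
  ultimately have "compact_operator ((?A o\<^sub>L ?A) - ?P)" by simp
  moreover have "self_adjoint ?A"
    by (simp add: self_adjoint_def orth_proj_sym self_adjointD[OF sa])
  moreover have "operator_on V ?A" by (simp add: operator_on_def orth_proj orth_proj_zero)
  ultimately show ?thesis using V(1) by (simp add: essential_symmetry_def)
qed

lemma symmetry_path_cong:
  assumes "symmetry_path W S a b" "\<And>t. t \<in> {a..b} \<Longrightarrow> T t = S t"
  shows "symmetry_path W T a b"
proof -
  interpret symmetry_path W S a b by fact
  have "continuous_on {a..b} T" by (rule continuous_on_eq[OF cont]) (simp add: assms(2))
  then show ?thesis using es diff assms(2) by (simp add: symmetry_path_def)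
qed

lemma symmetry_path_form_operators:
  fixes B :: "real \<Rightarrow> 'a::{real_inner, complete_space, second_countable_topology} \<Rightarrow>\<^sub>L 'a \<Rightarrow>\<^sub>L real"
  assumes cont: "continuous_on {a..b} B" and sym: "\<And>t. t \<in> {a..b} \<Longrightarrow> symmetric_form (B t)"
    and V: "closed_subspace V" "finite_codimensional V"
    and J: "is_symmetry J" and K: "\<And>t. t \<in> {a..b} \<Longrightarrow> compact_operator (K t)"
    and JK: "\<And>t. t \<in> {a..b} \<Longrightarrow> form_operator UNIV (B t) = J + K t"
  shows "symmetry_path UNIV (\<lambda>t. form_operator UNIV (B t)) a b" "symmetry_path V (\<lambda>t. form_operator V (B t)) a b"
proof -
  interpret V: closed_subspace V by (rule V)
  let ?T = "\<lambda>t. form_operator UNIV (B t)" and ?P = "orth_proj V"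
  have sa: "self_adjoint (?T t)" if "t \<in> {a..b}" for t
    using sym[OF that] by (simp add: self_adjoint_def symmetric_form_def form_operator_UNIV inner_commute[of _ "?T t _"])
  have es: "essential_symmetry UNIV (?T t)" if "t \<in> {a..b}" for t
    using essential_symmetry_compact_perturbation[OF J K[OF that]] sa[OF that] JK[OF that] by simp
  have diff: "compact_operator (?T s - ?T t)" if "s \<in> {a..b}" "t \<in> {a..b}" for s t
    using compact_operator_diff[OF K[OF that(1)] K[OF that(2)]] JK that by simp
  have contT: "continuous_on {a..b} ?T"
    unfolding continuous_on_iff
  proof (intro ballI allI impI)
    fix t and d :: real assume "t \<in> {a..b}" "0 < d"
    then obtain r where "r > 0" "\<forall>s\<in>{a..b}. dist s t < r \<longrightarrow> dist (B s) (B t) < d"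
      using cont unfolding continuous_on_iff by blast
    then show "\<exists>r>0. \<forall>s\<in>{a..b}. dist s t < r \<longrightarrow> dist (?T s) (?T t) < d"
      using norm_form_operator_diff_le[of "B _" "B t"]
      by (intro exI[of _ r]) (auto simp: dist_norm intro: le_less_trans)
  qed
  show "symmetry_path UNIV ?T a b" using es diff contT by (simp add: symmetry_path_def)
  show "symmetry_path V (\<lambda>t. form_operator V (B t)) a b"
    unfolding symmetry_path_def V.form_operator_compression
  proof (intro conjI allI impI)
    show "essential_symmetry V (?P o\<^sub>L ?T t o\<^sub>L ?P)" if "t \<in> {a..b}" for t
      by (rule essential_symmetry_compression[OF es[OF that] V])
    show "compact_operator ((?P o\<^sub>L ?T s o\<^sub>L ?P) - (?P o\<^sub>L ?T t o\<^sub>L ?P))" if "s \<in> {a..b}" "t \<in> {a..b}" for s t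
    proof -
      have "(?P o\<^sub>L ?T s o\<^sub>L ?P) - (?P o\<^sub>L ?T t o\<^sub>L ?P) = ?P o\<^sub>L ((?T s - ?T t) o\<^sub>L ?P)"
        by (rule blinfun_eqI) (simp add: blinfun.diff_left blinfun.diff_right)
      then show ?thesis
        using compact_operator_compose_left[OF compact_operator_compose_right[OF diff[OF that]]] by metis
    qed
    show "continuous_on {a..b} (\<lambda>t. ?P o\<^sub>L ?T t o\<^sub>L ?P)"
      by (intro bounded_bilinear.continuous_on[OF bounded_bilinear_blinfun_compose] continuous_on_const contT)
  qed
qed

lemma restricted_form_exists:
  fixes B :: "'a::{real_inner, complete_space, second_countable_topology} \<Rightarrow>\<^sub>L 'a \<Rightarrow>\<^sub>L real"
  assumes T: "essential_symmetry UNIV (form_operator UNIV B)" and T': "essential_symmetry V (form_operator V B)"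
    and V: "closed_subspace V" "finite_codimensional V"
  shows "\<exists>e l e' l'. restricted_form B V e l e' l'"
proof -
  interpret V: closed_subspace V by (rule V)
  let ?T = "form_operator UNIV B" and ?P = "orth_proj V" and ?I = "orth_proj UNIV :: 'a \<Rightarrow>\<^sub>L 'a"
  have "?T - form_operator V B = (?T o\<^sub>L (?I - ?P)) + ((?I - ?P) o\<^sub>L (?T o\<^sub>L ?P))"
    unfolding V.form_operator_compression
    by (rule blinfun_eqI) (simp add: orth_proj_UNIV blinfun.diff_left blinfun.diff_right blinfun.add_left)
  then have "compact_operator (?T - form_operator V B)"
    using compact_operator_add[OF compact_operator_compose_left[OF compact_operator_codim[OF V]]
        compact_operator_compose_right[OF compact_operator_codim[OF V]]] by metis
  from commensurable_neg_space[OF T T' this compact_operator_codim[OF V]]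
  have "commensurable (neg_space UNIV ?T) (neg_space V (form_operator V B))" .
  moreover obtain e l where "diagonal_symmetry UNIV ?T e l" using essential_symmetry_diagonal_symmetry[OF T] by blast
  moreover obtain e' l' where "diagonal_symmetry V (form_operator V B) e' l'"
    using essential_symmetry_diagonal_symmetry[OF T'] by blast
  ultimately show ?thesis unfolding restricted_form_def restricted_form_axioms_def by blast
qed

theorem theorem4p4:
  fixes B :: "real \<Rightarrow> 'a::{real_inner, complete_space, second_countable_topology} \<Rightarrow>\<^sub>L 'a \<Rightarrow>\<^sub>L real"
    and T T' K :: "real \<Rightarrow> 'a \<Rightarrow>\<^sub>L 'a"
    and J :: "'a \<Rightarrow>\<^sub>L 'a"
    and V :: "'a set"
    and a b :: real
  assumes "a < b"
    and "continuous_on {a..b} B"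
    and "\<And>t. t \<in> {a..b} \<Longrightarrow> symmetric_fredholm_form (B t)"
    and "subspace V" and "closed V" and "finite_codimensional V"
    and "\<And>t. t \<in> {a..b} \<Longrightarrow> T t = form_operator UNIV (B t)"
    and "\<And>t. t \<in> {a..b} \<Longrightarrow> T' t = form_operator V (B t)"
    and "is_symmetry J"
    and "\<And>t. t \<in> {a..b} \<Longrightarrow> compact_operator (K t)"
    and "\<And>t. t \<in> {a..b} \<Longrightarrow> T t = J + K t"
  shows
    "(\<forall>t\<in>{a, b}. commensurable (neg_space UNIV (T t)) (neg_space V (T' t)) \<and>
        morse_index (form_orth (B t) V) (B t) \<noteq> \<infinity> \<and>
        finite_dimensional (V \<inter> form_orth (B t) V) \<and>
        finite_dimensional (V \<inter> form_kernel (B t))) \<and>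
     spectral_flow UNIV T a b - spectral_flow V T' a b =
       rel_dim (neg_space UNIV (T a)) (neg_space V (T' a)) -
       rel_dim (neg_space UNIV (T b)) (neg_space V (T' b)) \<and>
     rel_dim (neg_space UNIV (T a)) (neg_space V (T' a)) -
     rel_dim (neg_space UNIV (T b)) (neg_space V (T' b)) =
       int (the_enat (morse_index (form_orth (B a) V) (B a)))
         + int (dim (V \<inter> form_orth (B a) V))
         - int (dim (V \<inter> form_kernel (B a)))
         - int (the_enat (morse_index (form_orth (B b) V) (B b)))
         - int (dim (V \<inter> form_orth (B b) V))
         + int (dim (V \<inter> form_kernel (B b)))"
proof -
  have V: "closed_subspace V" using assms(4,5) by (simp add: closed_subspace_def)
  have sym: "symmetric_form (B t)" if "t \<in> {a..b}" for t
    using assms(3)[OF that] by (simp add: symmetric_fredholm_form_def)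
  have JK: "form_operator UNIV (B t) = J + K t" if "t \<in> {a..b}" for t
    using assms(7)[OF that] assms(11)[OF that] by simp
  note paths = symmetry_path_form_operators[OF assms(2) sym V assms(6,9,10) JK]
  interpret T: symmetry_path UNIV T a b
    by (rule symmetry_path_cong[OF paths(1) assms(7)])
  interpret T': symmetry_path V T' a b
    by (rule symmetry_path_cong[OF paths(2) assms(8)])
  have rf: "\<exists>e l e' l'. restricted_form (B t) V e l e' l'" if "t \<in> {a..b}" for t
    using restricted_form_exists[OF _ _ V assms(6)] T.es[OF that] T'.es[OF that] assms(7,8)[OF that] by metis
  have comm: "commensurable (neg_space UNIV (T t)) (neg_space V (T' t))"
    and fin: "morse_index (form_orth (B t) V) (B t) \<noteq> \<infinity>"
      "finite_dimensional (V \<inter> form_orth (B t) V)" "finite_dimensional (V \<inter> form_kernel (B t))"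
    and formula: "rel_dim (neg_space UNIV (T t)) (neg_space V (T' t)) =
       int (the_enat (morse_index (form_orth (B t) V) (B t))) + int (dim (V \<inter> form_orth (B t) V))
         - int (dim (V \<inter> form_kernel (B t)))"
    if t: "t \<in> {a..b}" for t
  proof -
    obtain e l e' l' where "restricted_form (B t) V e l e' l'" using rf[OF t] by blast
    then interpret restricted_form "B t" V e l e' l' .
    show "commensurable (neg_space UNIV (T t)) (neg_space V (T' t))" using comm assms(7,8)[OF t] by simp
    show "morse_index (form_orth (B t) V) (B t) \<noteq> \<infinity>" by (rule index_formula(1))
    show "finite_dimensional (V \<inter> form_orth (B t) V)" by (rule finite_dimensional_kernel_restriction)
    then show "finite_dimensional (V \<inter> form_kernel (B t))"
      by (rule finite_dimensional_subset) (use kernel_Int in blast)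
    show "rel_dim (neg_space UNIV (T t)) (neg_space V (T' t)) =
       int (the_enat (morse_index (form_orth (B t) V) (B t))) + int (dim (V \<inter> form_orth (B t) V))
         - int (dim (V \<inter> form_kernel (B t)))" using index_formula(2) assms(7,8)[OF t] by simp
  qed
  have ab: "a \<in> {a..b}" "b \<in> {a..b}" "a \<le> b" using assms(1) by auto
  let ?X = "\<lambda>t. neg_space UNIV (T t)" and ?Y = "\<lambda>t. neg_space V (T' t)"
  have "rel_dim (?X a) (?X b) + rel_dim (?X b) (?Y b) = rel_dim (?X a) (?Y b)"
    by (rule rel_dim_add[OF T.commensurable_N[OF ab(1,2)] comm[OF ab(2)]])
  moreover have "rel_dim (?X a) (?Y a) + rel_dim (?Y a) (?Y b) = rel_dim (?X a) (?Y b)"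
    by (rule rel_dim_add[OF comm[OF ab(1)] T'.commensurable_N[OF ab(1,2)]])
  ultimately have sf: "spectral_flow UNIV T a b - spectral_flow V T' a b = rel_dim (?X a) (?Y a) - rel_dim (?X b) (?Y b)"
    using T.spectral_flow_eq_rel_dim[OF ab(3)] T'.spectral_flow_eq_rel_dim[OF ab(3)] by linarith
  show ?thesis
  proof (intro conjI ballI)
    fix t assume "t \<in> {a, b}"
    then have t: "t \<in> {a..b}" using ab by auto
    show "commensurable (?X t) (?Y t)" "morse_index (form_orth (B t) V) (B t) \<noteq> \<infinity>"
      "finite_dimensional (V \<inter> form_orth (B t) V)" "finite_dimensional (V \<inter> form_kernel (B t))"
      using comm fin t by blast+
  qed (use sf formula[OF ab(1)] formula[OF ab(2)] in linarith)+
qed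


end
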